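(* A graph $G$ belongs to $\mathcal{U}_4$ if and only if $G$ is isomorphic to an extended prism with extension pattern $(3,1)$ or with extension pattern $(3,3,\dots,3)$ ($k$ entries) for some $k\ge 2$.
   Context: In a bridgeless cubic graph, an edge is lonely if it belongs to exactly one perfect matching; $l(G)$ is the number of lonely edges. $\mathcal{U}$ is the class of 3-connected cubic graphs having at least one lonely edge, and $\mathcal{U}_k=\{G\in\mathcal{U}: l(G)=k\}$. Replacing a vertex $x$ of a cubic graph by a triangle means deleting $x$, adding three new mutually adjacent vertices, and joining each of them to a distinct neighbour of $x$. The prism $Pr$ is the 6-vertex cubic graph consisting of two vertex-disjoint triangles $T_u$ and $T_v$ together with a perfect matching of three edges between them. Label the vertices of $T_v$ as $x_1,x_2,x_3$. For $s\in\{1,2,3\}$, a $T_v$-extension of index $s$ replaces $x_s$ by a new triangle $y_1y_2y_3$ in which, for each $j\ne s$, $y_j$ is joined to $x_j$, and $y_s$ is joined to the neighbour of $x_s$ outside $T_v$; afterwards the new triangle becomes $T_v$ and its vertices are renamed $x_i:=y_i$. An extended prism with extension pattern $(s_1,\dots,s_m)$, $s_i\in\{1,2,3\}$, is the graph obtained from $Pr$ by applying successively $T_v$-extensions of indices $s_1,\dots,s_m$. (The isomorphism type depends only on the pattern up to a permutation of the labels $\{1,2,3\}$ and up to reversal of the pattern.) *)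

theory Defs
  imports Main
begin

text \<open>Finite simple graphs given by a vertex set V and a set E of 2-element edges.\<close>

definition simple_graph :: "'a set \<Rightarrow> 'a set set \<Rightarrow> bool" where
  "simple_graph V E \<longleftrightarrow> finite V \<and> (\<forall>e\<in>E. e \<subseteq> V \<and> card e = 2)"

definition degree :: "'a set set \<Rightarrow> 'a \<Rightarrow> nat" where
  "degree E v = card {e\<in>E. v \<in> e}"

definition cubic_graph :: "'a set \<Rightarrow> 'a set set \<Rightarrow> bool" where
  "cubic_graph V E \<longleftrightarrow> simple_graph V E \<and> (\<forall>v\<in>V. degree E v = 3)"

definition adj_rel :: "'a set \<Rightarrow> 'a set set \<Rightarrow> ('a \<times> 'a) set" where
  "adj_rel V E = {(a, b). a \<in> V \<and> b \<in> V \<and> {a, b} \<in> E}"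

definition connected_graph :: "'a set \<Rightarrow> 'a set set \<Rightarrow> bool" where
  "connected_graph V E \<longleftrightarrow> (\<forall>u\<in>V. \<forall>v\<in>V. (u, v) \<in> (adj_rel V E)\<^sup>*)"

text \<open>Deleting a vertex set S.\<close>
definition del_vertices :: "'a set \<Rightarrow> 'a set set \<Rightarrow> 'a set \<Rightarrow> 'a set \<times> 'a set set" where
  "del_vertices V E S = (V - S, {e\<in>E. e \<inter> S = {}})"

text \<open>3-connected: more than 3 vertices, and removing fewer than 3 vertices leaves it connected.\<close>
definition three_connected :: "'a set \<Rightarrow> 'a set set \<Rightarrow> bool" where
  "three_connected V E \<longleftrightarrow> card V \<ge> 4 \<and>
     (\<forall>S. S \<subseteq> V \<and> card S \<le> 2 \<longrightarrow> connected_graph (V - S) {e\<in>E. e \<inter> S = {}})"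

definition perfect_matching :: "'a set \<Rightarrow> 'a set set \<Rightarrow> 'a set set \<Rightarrow> bool" where
  "perfect_matching V E M \<longleftrightarrow> M \<subseteq> E \<and> (\<forall>v\<in>V. \<exists>!e. e \<in> M \<and> v \<in> e)"

definition lonely_edge :: "'a set \<Rightarrow> 'a set set \<Rightarrow> 'a set \<Rightarrow> bool" where
  "lonely_edge V E e \<longleftrightarrow> e \<in> E \<and> card {M. perfect_matching V E M \<and> e \<in> M} = 1"

definition num_lonely :: "'a set \<Rightarrow> 'a set set \<Rightarrow> nat" where
  "num_lonely V E = card {e\<in>E. lonely_edge V E e}"

text \<open>The class U and U_k.\<close>
definition in_U :: "'a set \<Rightarrow> 'a set set \<Rightarrow> bool" where
  "in_U V E \<longleftrightarrow> cubic_graph V E \<and> three_connected V E \<and> num_lonely V E \<ge> 1"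

definition in_U_k :: "nat \<Rightarrow> 'a set \<Rightarrow> 'a set set \<Rightarrow> bool" where
  "in_U_k k V E \<longleftrightarrow> in_U V E \<and> num_lonely V E = k"

definition graph_iso :: "'a set \<Rightarrow> 'a set set \<Rightarrow> 'b set \<Rightarrow> 'b set set \<Rightarrow> bool" where
  "graph_iso V E V' E' \<longleftrightarrow> (\<forall>e\<in>E. e \<subseteq> V) \<and> (\<exists>f. bij_betw f V V' \<and> (\<lambda>e. f ` e) ` E = E')"

text \<open>Extended prisms. A construction state is (V, E, x, w, n): vertex set, edge set,
  x i = the vertex x_i of the current triangle T_v (i = 1,2,3), o i = the neighbour of x_i
  outside T_v, and n = a fresh-vertex counter (all vertices are < n).\<close>

type_synonym pstate = "nat set \<times> nat set set \<times> (nat \<Rightarrow> nat) \<times> (nat \<Rightarrow> nat) \<times> nat"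

definition prism_state :: pstate where
  "prism_state = ({0..<6},
     {{0,1},{0,2},{1,2}, {3,4},{3,5},{4,5}, {0,3},{1,4},{2,5}},
     (\<lambda>i. i + 2), (\<lambda>i. i - 1), 6)"

definition ext_step :: "nat \<Rightarrow> pstate \<Rightarrow> pstate" where
  "ext_step s st = (case st of (V, E, x, w, n) \<Rightarrow>
     let y = (\<lambda>j. n + j) in
     ((V - {x s}) \<union> {y 1, y 2, y 3},
      {e\<in>E. x s \<notin> e} \<union> {{y 1, y 2}, {y 1, y 3}, {y 2, y 3}}
        \<union> {{y j, x j} | j. j \<in> {1,2,3} \<and> j \<noteq> s} \<union> {{y s, w s}},
      y,
      (\<lambda>j. if j = s then w s else x j),
      n + 4))"

definition ext_prism_state :: "nat list \<Rightarrow> pstate" where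
  "ext_prism_state pat = foldl (\<lambda>st s. ext_step s st) prism_state pat"

definition ext_prism_V :: "nat list \<Rightarrow> nat set" where
  "ext_prism_V pat = fst (ext_prism_state pat)"

definition ext_prism_E :: "nat list \<Rightarrow> nat set set" where
  "ext_prism_E pat = fst (snd (ext_prism_state pat))"

end

(* Let e = uv be an edge of a 3-connected cubic graph lying in a unique perfect matching M. The graph G - u - v has a
   unique perfect matching, so by Kotzig's theorem one of its matching edges is a bridge. Together with u and v the
   bridge cuts G along two 3-edge cuts; descending into the sides one reaches a triangle which M leaves along exactly
   one edge. Contracting it keeps the graph cubic, 3-edge-connected and in possession of a lonely edge, so every graph
   in U is a Klee graph, that is, arises from K4 by replacing vertices by triangles.

   If G arises from H by replacing t by a triangle, the perfect matchings of G correspond to the perfect matchings of H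
   and to the star matchings of H, which contain all three edges at t and cover every other vertex once. For Klee graphs
   both exist in abundance, hence the lonely edges of G are exactly those triangle edges whose opposite edge tw is lonely
   in H, and those lonely edges of H not at t that avoid all star matchings. In particular the number of lonely edges
   never increases, and it remains to follow the graphs with at least four lonely edges through the expansions: they
   are the ladders closed at both ends, and the extended prism with pattern (3,1). *)

theory Submission
  imports Defs
begin

section \<open>Graphs with a unique perfect matching have a bridge\<close>

text \<open>Connectivity is carried as \<open>three_edge_connected\<close>, since edge cuts can be
  compared directly before and after a triangle replacement; \<open>three_connected\<close> is
  translated only on entering and on leaving the argument. Exact counts of lonely edges would
  require all star matchings. Two one-sided tests stand in for them: a single star matching at
  \<open>t\<close> bounds the count from above, and a lonely edge at a neighbour of
  \<open>t\<close>, but not at \<open>t\<close>, survives because every star matching covers that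
  neighbour by its edge to \<open>t\<close>. The threshold four works as follows. K4 and the prism
  have at most six lonely edges, the ladder with three rungs at most five, longer ladders exactly
  four. All vertices of K4 and of the prism are equivalent to the apex. In the three-rung ladder the
  apexes lead to the next ladder, the ends of the outer rungs to pattern (3,1), and the middle rung
  costs two lonely edges. Elsewhere, every expansion away from an apex costs at least one. The loss
  rests on a parity argument: a star matching not centred at an apex must use an apex edge at both
  ends of the ladder.\<close>

definition pairing :: "'a set \<Rightarrow> 'a set set \<Rightarrow> bool" where
  "pairing A M \<longleftrightarrow> (\<forall>e\<in>M. card e = 2) \<and> \<Union>M = A \<and> (\<forall>e\<in>M. \<forall>f\<in>M. e \<inter> f \<noteq> {} \<longrightarrow> e = f)"

lemma pairingI:
  assumes "\<And>e. e \<in> M \<Longrightarrow> card e = 2" "\<Union>M = A"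
    "\<And>e f v. e \<in> M \<Longrightarrow> f \<in> M \<Longrightarrow> v \<in> e \<Longrightarrow> v \<in> f \<Longrightarrow> e = f"
  shows "pairing A M"
  unfolding pairing_def
proof (intro conjI ballI impI)
  fix e f assume "e \<in> M" "f \<in> M" "e \<inter> f \<noteq> {}"
  moreover then obtain v where "v \<in> e" "v \<in> f" by auto
  ultimately show "e = f" using assms(3) by metis
qed (use assms in auto)

lemma pairing_edge:
  assumes "pairing A M" "v \<in> A"
  obtains u where "{v,u} \<in> M" "u \<noteq> v" "u \<in> A"
proof -
  obtain e where e: "e \<in> M" "v \<in> e" using assms by (auto simp: pairing_def)
  then obtain a b where ab: "e = {a,b}" "a \<noteq> b" using assms(1) by (auto simp: pairing_def card_2_iff)
  have "e \<subseteq> A" using e assms(1) by (auto simp: pairing_def)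
  then show ?thesis using that[of a] that[of b] e ab by (auto simp: insert_commute)
qed

lemma pairing_partner_unique:
  assumes "pairing A M" "{v,u} \<in> M" "{v,u'} \<in> M"
  shows "u = u'"
proof -
  have "{v,u} = {v,u'}" using assms by (auto simp: pairing_def)
  then show ?thesis by (auto simp: doubleton_eq_iff)
qed

lemma pairing_eqI:
  assumes "pairing A M" "e \<in> M" "f \<in> M" "v \<in> e" "v \<in> f"
  shows "e = f"
  using assms by (auto simp: pairing_def)

lemma pairing_edge_cases:
  assumes "pairing A M" "{u,v} \<in> M" "e \<in> M"
  shows "e = {u,v} \<or> (u \<notin> e \<and> v \<notin> e)"
  using pairing_eqI[OF assms(1,3,2), of u] pairing_eqI[OF assms(1,3,2), of v] by auto

lemma pairing_edge_sub: "pairing A M \<Longrightarrow> e \<in> M \<Longrightarrow> e \<subseteq> A"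
  by (auto simp: pairing_def)

lemma pairing_remove:
  assumes "pairing A M" "e \<in> M"
  shows "pairing (A - e) (M - {e})"
proof -
  have "\<Union>(M - {e}) = A - e"
    using assms pairing_eqI[OF assms] unfolding pairing_def by auto
  then show ?thesis using assms(1) unfolding pairing_def by simp
qed

lemma pairing_insert:
  assumes "pairing A M" "e \<inter> A = {}" "card e = 2"
  shows "pairing (A \<union> e) (insert e M)"
proof -
  have "f \<inter> e = {}" if "f \<in> M" for f using that assms(2) pairing_edge_sub[OF assms(1)] by blast
  then show ?thesis using assms unfolding pairing_def by (simp add: Int_commute Un_commute)
qed

text \<open>No edge of \<open>L\<close> or \<open>N\<close> crosses the boundary of
  \<open>K\<close>, so the part of one matching outside \<open>K\<close> and the part of the other
  inside fit together without conflict.\<close>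

lemma pairing_swap:
  assumes "pairing A L" "pairing B N" "\<And>e. e \<in> L \<union> N \<Longrightarrow> e \<subseteq> K \<or> e \<inter> K = {}"
  shows "pairing ((A - K) \<union> (B \<inter> K)) ({e\<in>L. e \<inter> K = {}} \<union> {e\<in>N. e \<subseteq> K})"
proof -
  have "\<Union>L = A" "\<Union>N = B" using assms by (auto simp: pairing_def)
  have 2: "\<Union>{e\<in>L. e \<inter> K = {}} = A - K"
  proof (intro equalityI subsetI)
    fix v assume v: "v \<in> A - K"
    then obtain e where "e \<in> L" "v \<in> e" using \<open>\<Union>L = A\<close> by auto
    then show "v \<in> \<Union>{e\<in>L. e \<inter> K = {}}" using assms(3)[of e] v by auto
  qed (use \<open>\<Union>L = A\<close> in auto)
  have 3: "\<Union>{e\<in>N. e \<subseteq> K} = B \<inter> K"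
  proof (intro equalityI subsetI)
    fix v assume v: "v \<in> B \<inter> K"
    then obtain e where "e \<in> N" "v \<in> e" using \<open>\<Union>N = B\<close> by auto
    then show "v \<in> \<Union>{e\<in>N. e \<subseteq> K}" using assms(3)[of e] v by auto
  qed (use \<open>\<Union>N = B\<close> in auto)
  have "e = f" if e: "e \<in> {e\<in>L. e \<inter> K = {}} \<union> {e\<in>N. e \<subseteq> K}" and f: "f \<in> {e\<in>L. e \<inter> K = {}} \<union> {e\<in>N. e \<subseteq> K}"
    and "e \<inter> f \<noteq> {}" for e f
  proof -
    obtain v where v: "v \<in> e" "v \<in> f" using \<open>e \<inter> f \<noteq> {}\<close> by blast
    show ?thesis
    proof (cases "v \<in> K")
      case True
      then have "e \<in> N" "f \<in> N" using e f v by auto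
      then show ?thesis using pairing_eqI[OF assms(2)] v by auto
    next
      case False
      then have "e \<in> L" "f \<in> L" using e f v by auto
      then show ?thesis using pairing_eqI[OF assms(1)] v by auto
    qed
  qed
  moreover have "\<Union>({e\<in>L. e \<inter> K = {}} \<union> {e\<in>N. e \<subseteq> K}) = (A - K) \<union> (B \<inter> K)"
    using 2 3 by (simp only: Union_Un_distrib)
  moreover have "\<forall>e \<in> {e\<in>L. e \<inter> K = {}} \<union> {e\<in>N. e \<subseteq> K}. card e = 2"
    using assms(1,2) by (auto simp: pairing_def)
  ultimately show ?thesis unfolding pairing_def by blast
qed

text \<open>\<open>K\<close> is the component of \<open>p\<close> in the union of the two matchings.\<close>

lemma exchange_component:
  assumes "finite A" "pairing A L" "pairing B N" "p \<in> B" "p \<notin> A"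
  shows "\<exists>p' K. p' \<noteq> p \<and> p \<in> K \<and> K \<inter> ((A - B) \<union> (B - A)) = {p,p'}
     \<and> (\<forall>e\<in>L\<union>N. e \<subseteq> K \<or> e \<inter> K = {})"
  using assms
proof (induction A arbitrary: B L N p rule: finite_psubset_induct)
  case (psubset A)
  obtain p1 where p1: "{p,p1} \<in> N" "p1 \<noteq> p" "p1 \<in> B" by (rule pairing_edge[OF psubset.prems(2,3)])
  show ?case
  proof (cases "p1 \<in> A")
    case False
    have "e \<subseteq> {p,p1} \<or> e \<inter> {p,p1} = {}" if "e \<in> L \<union> N" for e
      using that False psubset.prems p1 pairing_eqI[OF psubset.prems(2) p1(1)] pairing_edge_sub[OF psubset.prems(1)]
      by blast
    then show ?thesis using p1 False psubset.prems by (intro exI[of _ p1] exI[of _ "{p,p1}"]) auto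
  next
    case True
    obtain p2 where p2: "{p1,p2} \<in> L" "p2 \<noteq> p1" "p2 \<in> A" by (rule pairing_edge[OF psubset.prems(1) True])
    have pne: "p \<noteq> p2" using p2 psubset.prems by auto
    show ?thesis
    proof (cases "p2 \<in> B")
      case False
      have "e \<subseteq> {p,p1,p2} \<or> e \<inter> {p,p1,p2} = {}" if "e \<in> L \<union> N" for e
      proof (cases "e \<in> L")
        case True
        then have "p \<notin> e" using psubset.prems(4) pairing_edge_sub[OF psubset.prems(1)] by blast
        then show ?thesis using pairing_edge_cases[OF psubset.prems(1) p2(1) True] by auto
      next
        case eN: False
        then have "e \<in> N" using that by auto
        moreover from this have "p2 \<notin> e" using False pairing_edge_sub[OF psubset.prems(2)] by blast
        ultimately show ?thesis using pairing_edge_cases[OF psubset.prems(2) p1(1)] by auto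
      qed
      then show ?thesis using p1 p2 True False psubset.prems pne by (intro exI[of _ p2] exI[of _ "{p,p1,p2}"]) auto
    next
      case p2B: True
      \<comment> \<open>The alternating path continues: without its first two edges,
        \<open>p2\<close> is covered by what remains of \<open>N\<close> but not by what remains of
        \<open>L\<close>, which is the situation of \<open>p\<close> in a smaller instance.\<close>
      let ?A = "A - {p1,p2}" and ?B = "B - {p,p1}" and ?L = "L - {{p1,p2}}" and ?N = "N - {{p,p1}}"
      have "\<exists>p' K. p' \<noteq> p2 \<and> p2 \<in> K \<and> K \<inter> ((?A - ?B) \<union> (?B - ?A)) = {p2,p'}
         \<and> (\<forall>e\<in>?L\<union>?N. e \<subseteq> K \<or> e \<inter> K = {})"
        using p1 p2 p2B pne True psubset.prems
        by (intro psubset.IH pairing_remove) auto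
      then obtain p' K where K: "p' \<noteq> p2" "p2 \<in> K" "K \<inter> ((?A - ?B) \<union> (?B - ?A)) = {p2,p'}"
         "\<And>e. e\<in>?L\<union>?N \<Longrightarrow> e \<subseteq> K \<or> e \<inter> K = {}" by auto
      have pA: "p \<notin> A" by fact
      have dsj: "e \<inter> {p,p1} = {}" if e: "e \<in> ?L \<union> ?N" for e
      proof (cases "e \<in> ?L")
        case True
        then have "p \<notin> e" using pA pairing_edge_sub[OF psubset.prems(1)] by blast
        then show ?thesis using pairing_edge_cases[OF psubset.prems(1) p2(1), of e] True by auto
      next
        case False
        then show ?thesis using pairing_edge_cases[OF psubset.prems(2) p1(1), of e] e by auto
      qed
      have "e \<subseteq> insert p (insert p1 K) \<or> e \<inter> (insert p (insert p1 K)) = {}" if "e \<in> L \<union> N" for e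
      proof (cases "e \<in> ?L \<union> ?N")
        case True
        then show ?thesis using K(4)[OF True] dsj[OF True] by blast
      next
        case False
        then show ?thesis using that K(2) by auto
      qed
      moreover have "insert p (insert p1 K) \<inter> ((A - B) \<union> (B - A)) = {p,p'}" "p' \<noteq> p"
        using K(1-3) p1 p2 p2B pA True psubset.prems(3) pne by auto
      ultimately show ?thesis by (intro exI[of _ p'] exI[of _ "insert p (insert p1 K)"]) auto
    qed
  qed
qed

text \<open>Inside \<open>K\<close> the covered sets \<open>A\<close> and \<open>B\<close> differ
  only at the two ends \<open>p\<close> and \<open>p'\<close> of the alternating path, so exchanging
  the matchings on \<open>K\<close> changes the covered vertices at these ends only. Applications
  distinguish where \<open>p'\<close> lies.\<close>

lemma exchange:
  assumes "finite A" "pairing A L" "pairing B N" "p \<in> B" "p \<notin> A"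
  obtains p' K where "p' \<noteq> p" "p \<in> K" "p' \<in> (A - B) \<union> (B - A)"
    "K \<inter> ((A - B) \<union> (B - A)) = {p,p'}"
    "\<forall>e\<in>L \<union> N. e \<subseteq> K \<or> e \<inter> K = {}"
    "pairing ((A - {p,p'}) \<union> (B \<inter> {p,p'})) ({e\<in>L. e \<inter> K = {}} \<union> {e\<in>N. e \<subseteq> K})"
    "pairing ((B - {p,p'}) \<union> (A \<inter> {p,p'})) ({e\<in>N. e \<inter> K = {}} \<union> {e\<in>L. e \<subseteq> K})"
proof -
  obtain p' K where K: "p' \<noteq> p" "p \<in> K" "K \<inter> ((A - B) \<union> (B - A)) = {p,p'}"
    "\<And>e. e \<in> L \<union> N \<Longrightarrow> e \<subseteq> K \<or> e \<inter> K = {}"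
    using exchange_component[OF assms] by auto
  have "(A - K) \<union> (B \<inter> K) = (A - {p,p'}) \<union> (B \<inter> {p,p'})" using K(3) by blast
  then have s1: "pairing ((A - {p,p'}) \<union> (B \<inter> {p,p'})) ({e\<in>L. e \<inter> K = {}} \<union> {e\<in>N. e \<subseteq> K})"
    using pairing_swap[OF assms(2,3) K(4)] by simp
  have "(B - K) \<union> (A \<inter> K) = (B - {p,p'}) \<union> (A \<inter> {p,p'})" using K(3) by blast
  then have s2: "pairing ((B - {p,p'}) \<union> (A \<inter> {p,p'})) ({e\<in>N. e \<inter> K = {}} \<union> {e\<in>L. e \<subseteq> K})"
    using pairing_swap[OF assms(3,2), of K] K(4) by (simp only: Un_commute)
  have "p' \<in> K \<inter> ((A - B) \<union> (B - A))" using K(3) by simp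
  then show ?thesis using that[OF K(1,2) _ K(3) _ s1 s2] K(4) by blast
qed

definition pairable :: "'a set set \<Rightarrow> 'a set \<Rightarrow> bool" where
  "pairable E A \<longleftrightarrow> (\<exists>N\<subseteq>E. pairing A N)"

text \<open>This is Kotzig's theorem. The bridge is described by the side \<open>X\<close> that it
  cuts off, the form in which cut edges can be counted later; the witness is \<open>X = D p\<close>,
  the vertices whose deletion together with \<open>p\<close> leaves a perfectly matchable
  rest.\<close>

lemma unique_matching_bridge:
  assumes fin: "finite W" and ne: "W \<noteq> {}" and E: "\<And>e. e \<in> E \<Longrightarrow> e \<subseteq> W \<and> card e = 2"
    and ME: "M \<subseteq> E" and M: "pairing W M" and uniq: "\<And>N. N \<subseteq> E \<Longrightarrow> pairing W N \<Longrightarrow> N = M"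
  shows "\<exists>X p q. X \<subseteq> W \<and> {p,q} \<in> M \<and> q \<in> X \<and> p \<in> W - X \<and>
     (\<forall>y z. y \<in> X \<longrightarrow> z \<in> W - X \<longrightarrow> {y,z} \<in> E \<longrightarrow> y = q \<and> z = p)"
proof -
  \<comment> \<open>If \<open>card (D p)\<close> is minimal, then \<open>D p\<close> is one side of the bridge: an edge from \<open>D p\<close> to another vertex \<open>z\<close>
    would give \<open>D z \<subset> D p\<close>.\<close>
  define D where "D p = {y \<in> W. y \<noteq> p \<and> pairable E (W - {p,y})}" for p
  have D_sym: "y \<in> D p \<longleftrightarrow> p \<in> D y" if "y \<in> W" "p \<in> W" for p y
    using that by (auto simp: D_def insert_commute)
  have DI: "y \<in> D p" if "y \<in> W" "y \<noteq> p" "N \<subseteq> E" "pairing A N" "A = W - {p,y}" for p y N A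
    using that by (auto simp: D_def pairable_def)
  have finD: "finite (D p)" for p using fin by (simp add: D_def)
  obtain p where p: "p \<in> W" and pmin: "\<And>a. a \<in> W \<Longrightarrow> card (D p) \<le> card (D a)"
    using ex_min_if_finite[of "(\<lambda>a. card (D a)) ` W"] fin ne
    by (metis (no_types, lifting) arg_min_if_finite(1) arg_min_least)
  obtain q where q: "{p,q} \<in> M" "q \<noteq> p" "q \<in> W" by (rule pairing_edge[OF M p])
  have M_remove: "M - {{a,d}} \<subseteq> E" "pairing (W - {a,d}) (M - {{a,d}})" if "{a,d} \<in> M" for a d
    using pairing_remove[OF M that] ME by auto
  have qD: "q \<in> D p" using q M_remove[OF q(1)] by (auto simp: D_def pairable_def)
  have extend: "N \<union> {{a,d}} = M" if "N \<subseteq> E" "pairing (W - {a,d}) N" "{a,d} \<in> E" "a \<noteq> d" for N a d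
  proof (rule uniq)
    have "a \<in> W" "d \<in> W" using E[OF that(3)] by auto
    then have "W - {a,d} \<union> {a,d} = W" by auto
    then show "pairing W (N \<union> {{a,d}})"
      using pairing_insert[OF that(2), of "{a,d}"] that(4) by (simp add: Int_commute)
  qed (use that in auto)
  have main: "y = q \<and> z = p" if yz: "y \<in> D p" "z \<in> W - D p" "{y,z} \<in> E" for y z
  proof (rule ccontr)
    assume neg: "\<not> (y = q \<and> z = p)"
    obtain N where N: "N \<subseteq> E" "pairing (W - {p,y}) N" and yW: "y \<in> W" and yp: "y \<noteq> p"
      using yz(1) by (auto simp: D_def pairable_def)
    have zp: "z \<noteq> p"
    proof
      assume zp: "z = p"
      then have "{y,p} \<in> E" using yz by simp
      then have "N \<union> {{p,y}} = M" using extend[OF N] yp by (simp add: insert_commute)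
      then have "{p,y} \<in> M" by auto
      then show False using pairing_partner_unique[OF M q(1)] neg zp by auto
    qed
    have aW: "z \<in> W" and aD: "z \<notin> D p" using yz by auto
    then have pz: "p \<notin> D z" using D_sym p by auto
    have zy: "z \<noteq> y" using yz by auto
    obtain d where d: "{z,d} \<in> M" "d \<noteq> z" "d \<in> W" by (rule pairing_edge[OF M aW])
    have dE: "{z,d} \<in> E" using d ME by auto
    have dp: "d \<noteq> p"
    proof
      assume "d = p"
      then have "{p,z} \<in> M" using d by (simp add: insert_commute)
      then have "z = q" using pairing_partner_unique[OF M q(1)] by auto
      then show False using qD aD by auto
    qed
    \<comment> \<open>Rotating \<open>N\<close> along \<open>{y,z}\<close> frees the partner
      \<open>a'\<close> of \<open>z\<close> in place of \<open>y\<close>. Compared with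
      \<open>M\<close> minus \<open>{z,d}\<close>, the path from \<open>p\<close> ends in
      \<open>a'\<close>, \<open>z\<close> or \<open>d\<close>: the first would give a second perfect
      matching, the last would put \<open>z\<close> into \<open>D p\<close>, and the end
      \<open>z\<close> shows that \<open>d\<close> lies in \<open>D p\<close>.\<close>
    have dD: "d \<in> D p"
    proof (cases "y = d")
      case True then show ?thesis using yz by auto
    next
      case yd: False
      have "z \<in> W - {p,y}" using aW zp zy by auto
      then obtain a' where a': "{z,a'} \<in> N" "a' \<noteq> z" "a' \<in> W - {p,y}" by (rule pairing_edge[OF N(2)])
      define N1 where "N1 = N - {{z,a'}} \<union> {{y,z}}"
      have "pairing (W - {p,y} - {z,a'}) (N - {{z,a'}})" using pairing_remove[OF N(2) a'(1)] .
      then have "pairing (W - {p,y} - {z,a'} \<union> {y,z}) (insert {y,z} (N - {{z,a'}}))"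
        by (rule pairing_insert) (use zy in auto)
      moreover have "W - {p,y} - {z,a'} \<union> {y,z} = W - {p,a'}" using a' yW aW zp yp by auto
      ultimately have N1: "pairing (W - {p,a'}) N1" by (simp add: N1_def)
      have N1E: "N1 \<subseteq> E" using N(1) yz(3) by (auto simp: N1_def)
      show ?thesis
      proof (cases "a' = d")
        case True
        then show ?thesis using DI[OF d(3) dp N1E N1] by simp
      next
        case a'd: False
        let ?M1 = "M - {{z,d}}"
        have fin': "finite (W - {p,a'})" using fin by auto
        have pB: "p \<in> W - {z,d}" "p \<notin> W - {p,a'}" using p zp dp by auto
        obtain p' K where K: "p' \<noteq> p" "p \<in> K" "p' \<in> (W-{p,a'} - (W-{z,d})) \<union> (W-{z,d} - (W-{p,a'}))"
          "K \<inter> ((W-{p,a'} - (W-{z,d})) \<union> (W-{z,d} - (W-{p,a'}))) = {p,p'}"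
          "\<forall>e \<in> N1 \<union> ?M1. e \<subseteq> K \<or> e \<inter> K = {}"
          "pairing ((W-{p,a'} - {p,p'}) \<union> ((W-{z,d}) \<inter> {p,p'})) ({e\<in>N1. e \<inter> K = {}} \<union> {e\<in>?M1. e \<subseteq> K})"
          "pairing ((W-{z,d} - {p,p'}) \<union> ((W-{p,a'}) \<inter> {p,p'})) ({e\<in>?M1. e \<inter> K = {}} \<union> {e\<in>N1. e \<subseteq> K})"
          by (rule exchange[OF fin' N1 M_remove(2)[OF d(1)] pB])
        have sub: "{e\<in>N1. e \<inter> K = {}} \<union> {e\<in>?M1. e \<subseteq> K} \<subseteq> E" "{e\<in>?M1. e \<inter> K = {}} \<union> {e\<in>N1. e \<subseteq> K} \<subseteq> E"
          using N1E ME by auto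
        from K(3) consider "p' = a'" | "p' = z" | "p' = d" using K(1) by auto
        then show ?thesis
        proof cases
          case 1
          have "W-{p,a'} - {p,p'} \<union> (W-{z,d}) \<inter> {p,p'} = W" using 1 a' a'd p zp dp by auto
          then have eq: "{e\<in>N1. e \<inter> K = {}} \<union> {e\<in>?M1. e \<subseteq> K} = M" using uniq[OF sub(1)] K(6) by simp
          have "z \<notin> K" using K(4) 1 a' aW zp d by auto
          moreover have "{y,z} \<in> N1" by (simp add: N1_def)
          ultimately have "{y,z} \<in> M" using K(5)[rule_format, of "{y,z}"] eq by auto
          then have "y = d" using pairing_partner_unique[OF M, of z y d] d by (simp add: insert_commute)
          then show ?thesis using yd by simp
        next
          case 2
          have "W-{z,d} - {p,p'} \<union> (W-{p,a'}) \<inter> {p,p'} = W - {p,d}" using 2 a' a'd p zp dp d aW by auto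
          then show ?thesis by (rule DI[OF d(3) dp sub(2) K(7)])
        next
          case 3
          have "W-{z,d} - {p,p'} \<union> (W-{p,a'}) \<inter> {p,p'} = W - {p,z}" using 3 a' a'd p zp dp d aW by auto
          then have "z \<in> D p" by (rule DI[OF aW zp sub(2) K(7)])
          then show ?thesis using aD by simp
        qed
      qed
    qed
    then obtain L where L: "L \<subseteq> E" "pairing (W - {p,d}) L" by (auto simp: D_def pairable_def)
    \<comment> \<open>For \<open>u\<close> in \<open>D z\<close> the matchings \<open>L\<close> and
      \<open>R\<close> are compared from \<open>p\<close>. As before the path can only end in
      \<open>z\<close>, and the swap then frees \<open>p\<close> and \<open>u\<close> in place of
      \<open>z\<close> and \<open>u\<close>. Were \<open>u = q\<close>, the complementary swap
      together with \<open>{z,d}\<close> would be \<open>M\<close>, although \<open>R\<close>, which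
      has to supply the edge at \<open>p\<close>, misses \<open>q\<close>.\<close>
    have "D z \<subseteq> D p - {q}"
    proof
      fix u assume u: "u \<in> D z"
      then obtain R where R: "R \<subseteq> E" "pairing (W - {z,u}) R" "u \<in> W" "u \<noteq> z" by (auto simp: D_def pairable_def)
      have up: "u \<noteq> p" using u pz by auto
      have "u \<in> D p \<and> u \<noteq> q"
      proof (cases "u = d")
        case True
        moreover have "d \<noteq> q"
          using pairing_partner_unique[OF M, of q z p] d q zp by (auto simp: insert_commute)
        ultimately show ?thesis using dD by simp
      next
        case ud: False
        have fin': "finite (W - {p,d})" using fin by auto
        have pB: "p \<in> W - {z,u}" "p \<notin> W - {p,d}" using p zp up by auto
        obtain p' K where K: "p' \<noteq> p" "p \<in> K" "p' \<in> (W-{p,d} - (W-{z,u})) \<union> (W-{z,u} - (W-{p,d}))"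
          "K \<inter> ((W-{p,d} - (W-{z,u})) \<union> (W-{z,u} - (W-{p,d}))) = {p,p'}"
          "\<forall>e \<in> L \<union> R. e \<subseteq> K \<or> e \<inter> K = {}"
          "pairing ((W-{p,d} - {p,p'}) \<union> ((W-{z,u}) \<inter> {p,p'})) ({e\<in>L. e \<inter> K = {}} \<union> {e\<in>R. e \<subseteq> K})"
          "pairing ((W-{z,u} - {p,p'}) \<union> ((W-{p,d}) \<inter> {p,p'})) ({e\<in>R. e \<inter> K = {}} \<union> {e\<in>L. e \<subseteq> K})"
          by (rule exchange[OF fin' L(2) R(2) pB])
        have sub: "{e\<in>L. e \<inter> K = {}} \<union> {e\<in>R. e \<subseteq> K} \<subseteq> E" "{e\<in>R. e \<inter> K = {}} \<union> {e\<in>L. e \<subseteq> K} \<subseteq> E"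
          using L R by auto
        from K(3) consider "p' = d" | "p' = z" | "p' = u" using K(1) by auto
        then show ?thesis
        proof cases
          case 1
          have "W-{p,d} - {p,p'} \<union> (W-{z,u}) \<inter> {p,p'} = W" using 1 p zp up d ud R by auto
          then have eq: "{e\<in>L. e \<inter> K = {}} \<union> {e\<in>R. e \<subseteq> K} = M" using uniq[OF sub(1)] K(6) by simp
          have "d \<in> K" using K(4) 1 by auto
          moreover have "z \<notin> K" using K(4) 1 zp d aW ud R by auto
          moreover have "{z,d} \<in> L \<union> R" using d(1) eq by auto
          ultimately show ?thesis using K(5)[rule_format, of "{z,d}"] by auto
        next
          case 2
          have eq1: "W-{z,u} - {p,p'} \<union> (W-{p,d}) \<inter> {p,p'} = W - {p,u}" using 2 p zp up d ud R aW by auto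
          then have "u \<in> D p" by (rule DI[OF R(3) up sub(2) K(7)])
          moreover have "u \<noteq> q"
          proof
            assume uq: "u = q"
            have "W-{p,d} - {p,p'} \<union> (W-{z,u}) \<inter> {p,p'} = W - {z,d}" using 2 p dp zp up d ud R aW by auto
            then have eq: "{e\<in>L. e \<inter> K = {}} \<union> {e\<in>R. e \<subseteq> K} \<union> {{z,d}} = M"
              using extend[OF sub(1) _ dE] K(6) d by simp
            have "{p,q} \<noteq> {z,d}" using zp dp by (auto simp: doubleton_eq_iff)
            then have "{p,q} \<in> R" using q(1) eq K(2) by auto
            then show False using pairing_edge_sub[OF R(2)] uq by auto
          qed
          ultimately show ?thesis by simp
        next
          case 3
          have "W-{z,u} - {p,p'} \<union> (W-{p,d}) \<inter> {p,p'} = W - {p,z}" using 3 p zp up d ud R aW by auto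
          then have "z \<in> D p" by (rule DI[OF aW zp sub(2) K(7)])
          then show ?thesis using aD by simp
        qed
      qed
      then show "u \<in> D p - {q}" by simp
    qed
    then have "D z \<subset> D p" using qD by auto
    then have "card (D z) < card (D p)" using finD psubset_card_mono by metis
    then show False using pmin[OF aW] by simp
  qed
  have "D p \<subseteq> W" "p \<notin> D p" by (auto simp: D_def)
  then show ?thesis using q(1) qD p main by blast
qed

section \<open>Triangles in cubic graphs with a lonely edge\<close>

definition nb :: "'a set set \<Rightarrow> 'a \<Rightarrow> 'a set" where
  "nb E v = {u. {v,u} \<in> E}"

text \<open>The pairs are oriented from \<open>X\<close> outwards, so the cardinality counts each
  edge of the cut once and \<open>fst\<close>, \<open>snd\<close> give its ends on either
  side.\<close>

definition cut :: "'a set \<Rightarrow> 'a set set \<Rightarrow> 'a set \<Rightarrow> ('a \<times> 'a) set" where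
  "cut V E X = {(a,b). a \<in> X \<and> b \<in> V - X \<and> {a,b} \<in> E}"

definition three_edge_connected :: "'a set \<Rightarrow> 'a set set \<Rightarrow> bool" where
  "three_edge_connected V E \<longleftrightarrow> (\<forall>X. X \<subseteq> V \<longrightarrow> X \<noteq> {} \<longrightarrow> X \<noteq> V \<longrightarrow> 3 \<le> card (cut V E X))"

lemma simple_graph_edge:
  assumes "simple_graph V E" "e \<in> E"
  obtains u v where "e = {u,v}" "u \<noteq> v" "u \<in> V" "v \<in> V"
proof -
  have "card e = 2" "e \<subseteq> V" using assms by (auto simp: simple_graph_def)
  then show ?thesis using that by (auto simp: card_2_iff)
qed

lemma simple_graph_edge_neq:
  assumes "simple_graph V E" "{u,v} \<in> E"
  shows "u \<noteq> v" "u \<in> V" "v \<in> V"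
  using assms by (auto simp: simple_graph_def)

lemma in_nb: "u \<in> nb E v \<longleftrightarrow> {v,u} \<in> E"
  by (simp add: nb_def)

lemma nb_sym: "u \<in> nb E v \<longleftrightarrow> v \<in> nb E u"
  by (simp add: nb_def insert_commute)

lemma nb_subset: "simple_graph V E \<Longrightarrow> nb E v \<subseteq> V - {v}"
  by (auto simp: nb_def dest: simple_graph_edge_neq)

lemma degree_eq_card_nb:
  assumes "simple_graph V E"
  shows "degree E v = card (nb E v)"
proof -
  have "{e\<in>E. v \<in> e} = (\<lambda>u. {v,u}) ` nb E v"
  proof (intro equalityI subsetI)
    fix e assume e: "e \<in> {e\<in>E. v \<in> e}"
    then obtain a b where "e = {a,b}" by (auto elim: simple_graph_edge[OF assms])
    then show "e \<in> (\<lambda>u. {v,u}) ` nb E v" using e by (auto simp: nb_def insert_commute)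
  qed (auto simp: nb_def)
  moreover have "inj_on (\<lambda>u. {v,u}) (nb E v)" by (auto simp: inj_on_def doubleton_eq_iff)
  ultimately show ?thesis by (simp add: degree_def card_image)
qed

lemma perfect_matching_iff_pairing:
  assumes "simple_graph V E"
  shows "perfect_matching V E M \<longleftrightarrow> M \<subseteq> E \<and> pairing V M"
proof
  assume M: "perfect_matching V E M"
  then have "M \<subseteq> E" by (simp add: perfect_matching_def)
  moreover have "\<Union>M = V"
    using M assms by (fastforce simp: perfect_matching_def simple_graph_def)
  moreover have "e = f" if "e \<in> M" "f \<in> M" "e \<inter> f \<noteq> {}" for e f
  proof -
    obtain v where "v \<in> e" "v \<in> f" using \<open>e \<inter> f \<noteq> {}\<close> by blast
    moreover from this have "v \<in> V" using \<open>\<Union>M = V\<close> that by blast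
    ultimately show ?thesis using M that unfolding perfect_matching_def by blast
  qed
  moreover have "\<forall>e\<in>M. card e = 2" using assms \<open>M \<subseteq> E\<close> by (auto simp: simple_graph_def)
  ultimately show "M \<subseteq> E \<and> pairing V M" unfolding pairing_def by blast
next
  assume M: "M \<subseteq> E \<and> pairing V M"
  have "\<exists>!e. e \<in> M \<and> v \<in> e" if "v \<in> V" for v
  proof -
    have "v \<in> \<Union>M" using M that by (simp add: pairing_def)
    then show ?thesis using pairing_eqI[of V M] M by blast
  qed
  then show "perfect_matching V E M" using M by (simp add: perfect_matching_def)
qed

lemma finite_cut: "finite V \<Longrightarrow> X \<subseteq> V \<Longrightarrow> finite (cut V E X)"
  by (rule finite_subset[of _ "V \<times> V"]) (auto simp: cut_def)

lemma card_cut_Diff: "X \<subseteq> V \<Longrightarrow> card (cut V E (V - X)) = card (cut V E X)"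
proof -
  assume "X \<subseteq> V"
  then have "cut V E (V - X) = prod.swap ` cut V E X"
    by (auto simp: cut_def insert_commute image_iff)
  then show ?thesis by (simp add: card_image)
qed

lemma lonely_edge_iff:
  "lonely_edge V E e \<longleftrightarrow> e \<in> E \<and> (\<exists>!M. perfect_matching V E M \<and> e \<in> M)"
proof -
  have "card {M. perfect_matching V E M \<and> e \<in> M} = 1 \<longleftrightarrow> (\<exists>!M. perfect_matching V E M \<and> e \<in> M)"
    unfolding One_nat_def card_1_singleton_iff Ex1_def by blast
  then show ?thesis by (simp add: lonely_edge_def)
qed

text \<open>The bridge of the uniquely matchable graph on \<open>X - {a}\<close> splits \<open>X - {a}\<close> into two sets, each bounded
  by exactly three edges; the larger one takes over the role of \<open>X\<close>.\<close>

lemma triangle_inside: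
  assumes cub: "cubic_graph V E" and c3: "three_edge_connected V E"
    and ME: "M \<subseteq> E" and MV: "pairing V M"
    and "X \<subseteq> V" "X \<noteq> V" "3 \<le> card X" "a \<in> X" "card (cut V E X) = 3"
    "pairing (X - {a}) {e\<in>M. e \<subseteq> X}"
    "\<And>N. N \<subseteq> E \<Longrightarrow> pairing (X - {a}) N \<Longrightarrow> N = {e\<in>M. e \<subseteq> X}"
  shows "\<exists>x y z. x \<noteq> y \<and> x \<noteq> z \<and> {x,y} \<in> E \<and> {x,z} \<in> E \<and> {y,z} \<in> M"
  using assms(5-)
proof (induction "card X" arbitrary: X a rule: less_induct)
  case less
  note XV = less.prems(1) and X3 = less.prems(3) and aX = less.prems(4) and cX = less.prems(5)
    and pX = less.prems(6) and uX = less.prems(7)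
  have sg: "simple_graph V E" using cub by (simp add: cubic_graph_def)
  then have finV: "finite V" by (simp add: simple_graph_def)
  have fin: "finite X" using XV finV finite_subset by blast
  let ?W = "X - {a}" and ?E = "{e\<in>E. e \<subseteq> X - {a}}"
  let ?M = "{e\<in>M. e \<subseteq> X}"
  have "card ?W = card X - 1" using XV aX fin by simp
  then have "card ?W \<noteq> 0" using X3 by linarith
  then have Wne: "?W \<noteq> {}" by (metis card.empty)
  have M_E: "?M \<subseteq> ?E" using pX ME by (auto simp: pairing_def)
  have "\<exists>X1 p q. X1 \<subseteq> ?W \<and> {p,q} \<in> ?M \<and> q \<in> X1 \<and> p \<in> ?W - X1 \<and>
     (\<forall>y z. y \<in> X1 \<longrightarrow> z \<in> ?W - X1 \<longrightarrow> {y,z} \<in> ?E \<longrightarrow> y = q \<and> z = p)"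
  proof (rule unique_matching_bridge)
    show "N = ?M" if "N \<subseteq> ?E" "pairing ?W N" for N using uX[of N] that by blast
  qed (use fin Wne sg M_E pX in \<open>auto simp: simple_graph_def\<close>)
  then obtain X1 p q where *: "X1 \<subseteq> ?W" "{p,q} \<in> ?M" "q \<in> X1" "p \<in> ?W - X1"
    "\<forall>y z. y \<in> X1 \<longrightarrow> z \<in> ?W - X1 \<longrightarrow> {y,z} \<in> ?E \<longrightarrow> y = q \<and> z = p"
    by (elim exE conjE) (rule that)
  have only_pq: "y = q \<and> z = p" if "y \<in> X1" "z \<in> ?W - X1" "{y,z} \<in> E" for y z
    using *(5)[rule_format, OF that(1,2)] that *(1) by auto
  have pqMX: "{p,q} \<in> M" using *(2) by simp
  note X1 = *(1) pqMX *(3,4) only_pq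
  define X2 where "X2 = ?W - X1"
  have pqE: "{p,q} \<in> E" "{q,p} \<in> E" using X1(2) ME by (auto simp: insert_commute)
  have aV: "a \<in> V" using XV aX by auto
  obtain b where b: "{a,b} \<in> M" "b \<noteq> a" "b \<in> V" by (rule pairing_edge[OF MV aV])
  have bX: "b \<notin> X"
  proof
    assume "b \<in> X"
    then have "{a,b} \<in> ?M" using b XV aX by auto
    then show False using pX by (auto simp: pairing_def)
  qed
  have abE: "{a,b} \<in> E" using b ME by auto
  \<comment> \<open>Only two edges of the cut of \<open>X\<close> besides \<open>{a,b}\<close> and
    two further edges at \<open>a\<close> can leave \<open>X - {a}\<close>. The bridge
    \<open>{p,q}\<close> is added once for each side, so the cuts of \<open>X1\<close> and
    \<open>X2\<close> have at most six edges together, and 3-edge-connectivity leaves exactly three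
    for each.\<close>
  let ?P = "cut V E X - {(a,b)}" and ?Q = "(\<lambda>w. (w,a)) ` (nb E a - {b})"
  have card_nb_a: "card (nb E a) = 3"
    using cub aV degree_eq_card_nb[OF sg] by (simp add: cubic_graph_def)
  have fin_nb: "finite (nb E a)" using card_nb_a card.infinite by fastforce
  have cP: "card ?P = 2" using XV aX cX b bX abE finite_cut[OF finV XV]
    by (subst card_Diff_singleton) (auto simp: cut_def)
  have cQ: "card ?Q = 2" using card_nb_a abE fin_nb
    by (subst card_image) (auto simp: inj_on_def in_nb)
  have WPQ: "cut V E ?W \<subseteq> ?P \<union> ?Q"
    using aX bX by (auto simp: cut_def nb_def insert_commute)
  have finPQ: "finite (?P \<union> ?Q)" using finite_cut[OF finV XV] fin_nb by auto
  have "card (?P \<union> ?Q) \<le> 4" using card_Un_le[of ?P ?Q] cP cQ by simp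
  then have cW: "card (cut V E ?W) \<le> 4" using card_mono[OF finPQ WPQ] by simp
  have subV: "X1 \<subseteq> V" "X2 \<subseteq> V" "?W \<subseteq> V" using X1(1) XV aX by (auto simp: X2_def)
  have pX2: "p \<in> X2" "q \<notin> X2" "a \<notin> X2" "a \<notin> X1" using X1(1-4) by (auto simp: X2_def)
  let ?C1 = "{(u,v) \<in> cut V E ?W. u \<in> X1}" and ?C2 = "{(u,v) \<in> cut V E ?W. u \<in> X2}"
  have X1'': "y = q" "z = p" if "y \<in> X1" "z \<in> X" "z \<noteq> a" "z \<notin> X1" "{y,z} \<in> E" for y z
    using X1(5)[of y z] that by auto
  have cut1: "cut V E X1 = insert (q,p) ?C1"
    using X1(1,3,4) subV pqE pX2 by (auto simp: cut_def X2_def dest: X1'')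
  have X1': "y = p \<and> z = q" if "y \<in> X2" "z \<in> X1" "{y,z} \<in> E" for y z
    using X1(5)[of z y] that by (auto simp: X2_def insert_commute)
  have cut2: "cut V E X2 = insert (p,q) ?C2"
    using X1(1,3,4) subV pqE pX2 by (auto simp: cut_def X2_def insert_commute dest: X1'')
  have finW: "finite (cut V E ?W)" using finite_cut[OF finV subV(3)] .
  have fC: "finite ?C1" "finite ?C2" by (rule finite_subset[OF _ finW], auto)+
  have C12: "card ?C1 + card ?C2 = card (cut V E ?W)"
  proof -
    have "?C1 \<union> ?C2 = cut V E ?W" by (auto simp: cut_def X2_def)
    moreover have "?C1 \<inter> ?C2 = {}" by (auto simp: X2_def)
    ultimately show ?thesis using card_Un_disjoint[OF fC] by simp
  qed
  have c1: "card (cut V E X1) = Suc (card ?C1)"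
    unfolding cut1 using fC(1) X1(4) by (intro card_insert_disjoint) (auto simp: cut_def)
  have c2: "card (cut V E X2) = Suc (card ?C2)"
    unfolding cut2 using fC(2) X1(1,3) by (intro card_insert_disjoint) (auto simp: cut_def)
  have "3 \<le> card (cut V E X1)" "3 \<le> card (cut V E X2)"
    using c3 subV aV pX2 X1(3) unfolding three_edge_connected_def by blast+
  then have cc: "card (cut V E X1) = 3" "card (cut V E X2) = 3" "card (cut V E ?W) = 4"
    using c1 c2 C12 cW by auto
  \<comment> \<open>Equality in the count: both remaining neighbours of \<open>a\<close> lie in
    \<open>X - {a}\<close>, which will close the triangle when both sides are single
    vertices.\<close>
  have "cut V E ?W = ?P \<union> ?Q"
    using card_subset_eq[OF finPQ WPQ] cc(3) \<open>card (?P \<union> ?Q) \<le> 4\<close> card_mono[OF finPQ WPQ] by simp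
  then have nb_a: "w \<in> ?W" if "w \<in> nb E a - {b}" for w
    using that by (auto simp: cut_def)
  have Mcase: "e \<subseteq> X1 \<or> e \<subseteq> X2 \<or> e = {p,q}" if e: "e \<in> ?M" for e
  proof -
    obtain y z where yz: "e = {y,z}" using e ME sg by (auto elim: simple_graph_edge)
    have "e \<subseteq> ?W" "{y,z} \<in> E" "{z,y} \<in> E" using e M_E yz by (auto simp: insert_commute)
    then show ?thesis using yz X1' by (auto simp: X2_def)
  qed
  have pq_ne: "p \<noteq> q" using X1(1-4) by auto
  \<comment> \<open>Either side is a smaller instance, the end \<open>r\<close> of the bridge taking
    the role of \<open>a\<close>. Uniqueness is inherited because another matching of
    \<open>Y - {r}\<close> would combine with the rest of \<open>M\<close> to a second matching of
    \<open>X - {a}\<close>.\<close>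
  have half: "?thesis" if Y: "Y \<subseteq> ?W" "r \<in> Y" "card (cut V E Y) = 3" "3 \<le> card Y"
    and MY: "\<And>e. e \<in> ?M \<Longrightarrow> e \<inter> Y = {} \<or> e \<subseteq> Y \<or> e = {r,s}" and rs: "{r,s} \<in> ?M" "s \<notin> Y" for Y r s
  proof (rule less.hyps)
    show "card Y < card X" using Y(1) aX fin by (intro psubset_card_mono) auto
    show "Y \<subseteq> V" "Y \<noteq> V" using Y(1) subV aV by auto
    show "3 \<le> card Y" "r \<in> Y" "card (cut V E Y) = 3" using Y by auto
    have nr: "r \<notin> e" if "e \<in> M" "e \<subseteq> Y" for e
      using pairing_edge_cases[OF MV _ that(1), of r s] rs that by auto
    show pY: "pairing (Y - {r}) {e\<in>M. e \<subseteq> Y}"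
    proof -
      have "\<Union>{e\<in>M. e \<subseteq> Y} = Y - {r}"
      proof (intro equalityI subsetI)
        fix v assume v: "v \<in> Y - {r}"
        have "\<Union>?M = ?W" using pX by (simp add: pairing_def)
        then obtain e where e: "e \<in> ?M" "v \<in> e" using v Y(1) by blast
        then show "v \<in> \<Union>{e\<in>M. e \<subseteq> Y}" using MY[OF e(1)] v rs by auto
      qed (use nr in auto)
      then show ?thesis using MV by (simp add: pairing_def)
    qed
    fix N assume N: "N \<subseteq> E" "pairing (Y - {r}) N"
    let ?R = "{e\<in>?M. \<not> e \<subseteq> Y}"
    have R: "e \<inter> Y \<subseteq> {r}" if "e \<in> ?R" for e using MY[of e] that rs(2) by auto
    have "pairing ((Y - {r}) \<union> (?W - (Y - {r}))) (N \<union> ?R)"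
    proof -
      have U: "\<Union>N = Y - {r}" "\<Union>{e\<in>M. e \<subseteq> Y} = Y - {r}" "\<Union>?M = ?W" using N pY pX by (auto simp: pairing_def)
      have "\<Union>?M = \<Union>{e\<in>M. e \<subseteq> Y} \<union> \<Union>?R" using Y(1) by auto
      then have r2: "\<Union>(N \<union> ?R) = ?W" using U by simp
      have r3: "e = f" if ef: "e \<in> N \<union> ?R" "f \<in> N \<union> ?R" and v: "v \<in> e" "v \<in> f" for e f v
      proof (cases "v \<in> Y - {r}")
        case True
        then have "e \<in> N" "f \<in> N" using ef v R[of e] R[of f] by blast+
        then show ?thesis using pairing_eqI[OF N(2)] v by blast
      next
        case False
        then have "e \<in> ?R" "f \<in> ?R" using ef v pairing_edge_sub[OF N(2)] by blast+
        then show ?thesis using pairing_eqI[OF MV, of e f v] v by blast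
      qed
      have r1: "card e = 2" if "e \<in> N \<union> ?R" for e using that N(2) MV by (auto simp: pairing_def)
      have eq: "(Y - {r}) \<union> (?W - (Y - {r})) = ?W" using Y(1) by auto
      show ?thesis unfolding eq by (rule pairingI[OF r1 r2 r3])
    qed
    moreover have eq: "(Y - {r}) \<union> (?W - (Y - {r})) = ?W" using Y(1) by auto
    moreover have "N \<union> ?R \<subseteq> E" using N(1) ME by auto
    ultimately have NR: "N \<union> ?R = ?M" using uX[of "N \<union> ?R"] by simp
    show "N = {e\<in>M. e \<subseteq> Y}"
    proof (intro equalityI subsetI)
      fix e assume "e \<in> N"
      then show "e \<in> {e\<in>M. e \<subseteq> Y}" using pairing_edge_sub[OF N(2)] NR by blast
    next
      fix e assume "e \<in> {e\<in>M. e \<subseteq> Y}"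
      then have "e \<in> ?M" "e \<notin> ?R" using Y(1) by auto
      then show "e \<in> N" using NR by blast
    qed
  qed
  have pqM: "{p,q} \<in> ?M" "{q,p} \<in> ?M" using *(2) by (auto simp: insert_commute)
  have Mc1: "e \<inter> X1 = {} \<or> e \<subseteq> X1 \<or> e = {q,p}" if "e \<in> ?M" for e
    using Mcase[OF that] by (auto simp: X2_def)
  have Mc2: "e \<inter> X2 = {} \<or> e \<subseteq> X2 \<or> e = {p,q}" if "e \<in> ?M" for e
    using Mcase[OF that] by (auto simp: X2_def)
  have X2W: "X2 \<subseteq> ?W" by (auto simp: X2_def)
  have pX1: "p \<notin> X1" using X1(4) by simp
  show ?case
  proof (cases "3 \<le> card X1 \<or> 3 \<le> card X2")
    case True
    then show ?thesis
      using half[OF X1(1,3) cc(1) _ Mc1 pqM(2) pX1] half[OF X2W pX2(1) cc(2) _ Mc2 pqM(1) pX2(2)] by fast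
  next
    case False
    \<comment> \<open>A vertex of \<open>Y\<close> other than \<open>r\<close> has its partner in
      \<open>Y\<close> as well, and the partner is not \<open>r\<close> either, so \<open>Y\<close>
      would have three elements.\<close>
    have single: "Y = {r}" if "Y \<subseteq> ?W" "r \<in> Y" "\<not> 3 \<le> card Y" "{r,s} \<in> ?M" "s \<notin> Y"
      and MY: "\<And>e. e \<in> ?M \<Longrightarrow> e \<inter> Y = {} \<or> e \<subseteq> Y \<or> e = {r,s}" for Y r s
    proof (rule ccontr)
      assume "Y \<noteq> {r}"
      then obtain v where v: "v \<in> Y" "v \<noteq> r" using \<open>r \<in> Y\<close> by blast
      have "v \<in> ?W" using v(1) \<open>Y \<subseteq> ?W\<close> by blast
      then obtain u where u: "{v,u} \<in> ?M" "u \<noteq> v" by (rule pairing_edge[OF pX])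
      have "{v,u} \<noteq> {r,s}" using v that(5) by (auto simp: doubleton_eq_iff)
      moreover have "u \<noteq> r" using pairing_edge_cases[OF MV, of r s "{v,u}"] that(4) u calculation by auto
      ultimately have "{r,u,v} \<subseteq> Y" using MY[OF u(1)] v that(2) by auto
      moreover have "card {r,u,v} = 3" using v u \<open>u \<noteq> r\<close> by auto
      moreover have "finite Y" using that(1) fin finite_subset by blast
      ultimately show False using card_mono[of Y "{r,u,v}"] that(3) by simp
    qed
    have "X1 = {q}" using single[OF X1(1,3) _ pqM(2) pX1 Mc1] False by blast
    moreover have "X2 = {p}" using single[OF X2W pX2(1) _ pqM(1) pX2(2) Mc2] False by blast
    ultimately have W: "?W = {p,q}" using X1(1) by (auto simp: X2_def)
    have "nb E a - {b} = {p,q}"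
    proof (rule card_subset_eq)
      show "card (nb E a - {b}) = card {p,q}" using card_nb_a abE fin_nb pq_ne by (simp add: in_nb)
    qed (use nb_a W in auto)
    then have "{a,p} \<in> E" "{a,q} \<in> E" by (auto simp: nb_def)
    then show ?thesis using pqMX pq_ne *(1,3,4) by (intro exI[of _ a] exI[of _ p] exI[of _ q]) auto
  qed
qed

text \<open>For \<open>e = {u,v}\<close> the descent starts with the set \<open>V - {v}\<close> and
  the vertex \<open>u\<close>: the cut consists of the three edges at \<open>v\<close>, and
  uniqueness of \<open>M\<close> through \<open>e\<close> becomes uniqueness of the matching on
  \<open>V - {u,v}\<close>.\<close>

lemma lonely_triangle:
  assumes cub: "cubic_graph V E" and c3: "three_edge_connected V E" and cV: "4 \<le> card V"
    and M: "perfect_matching V E M" and e: "e \<in> M"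
    and uniq: "\<And>N. perfect_matching V E N \<Longrightarrow> e \<in> N \<Longrightarrow> N = M"
  obtains x y z where "x \<noteq> y" "x \<noteq> z" "{x,y} \<in> E" "{x,z} \<in> E" "{y,z} \<in> M"
proof -
  have sg: "simple_graph V E" using cub by (simp add: cubic_graph_def)
  then have finV: "finite V" by (simp add: simple_graph_def)
  have M': "M \<subseteq> E" "pairing V M" using M perfect_matching_iff_pairing[OF sg] by auto
  have eE: "e \<in> E" using e M' by auto
  obtain u v where uv: "e = {u,v}" "u \<noteq> v" "u \<in> V" "v \<in> V" by (rule simple_graph_edge[OF sg eE])
  let ?X = "V - {v}"
  have M_eq: "{f\<in>M. f \<subseteq> ?X} = M - {e}"
    using pairing_edge_sub[OF M'(2)] pairing_eqI[OF M'(2) _ e, of _ v] uv by auto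
  have X_eq: "?X - {u} = V - e" using uv by auto
  have cX: "cut V E {v} = (\<lambda>w. (v,w)) ` nb E v"
    using nb_subset[OF sg, of v] by (auto simp: cut_def nb_def)
  have "card (cut V E {v}) = 3"
    unfolding cX using cub uv degree_eq_card_nb[OF sg] by (subst card_image) (auto simp: inj_on_def cubic_graph_def)
  then have "card (cut V E ?X) = 3" using card_cut_Diff[of "{v}" V E] uv by simp
  moreover have "3 \<le> card ?X" using cV uv finV by simp
  moreover have "pairing (?X - {u}) {f\<in>M. f \<subseteq> ?X}"
    unfolding M_eq X_eq by (rule pairing_remove[OF M'(2) e])
  moreover have "N = {f\<in>M. f \<subseteq> ?X}" if "N \<subseteq> E" "pairing (?X - {u}) N" for N
  proof -
    have "pairing (V - e) N" using that X_eq by simp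
    then have "pairing (V - e \<union> e) (insert e N)" by (rule pairing_insert) (use uv in auto)
    moreover have "V - e \<union> e = V" using uv by auto
    ultimately have "insert e N = M" using uniq perfect_matching_iff_pairing[OF sg] that(1) eE by auto
    moreover have "e \<notin> N" using pairing_edge_sub[OF that(2), of e] uv by auto
    ultimately show ?thesis unfolding M_eq by auto
  qed
  ultimately have "\<exists>x y z. x \<noteq> y \<and> x \<noteq> z \<and> {x,y} \<in> E \<and> {x,z} \<in> E \<and> {y,z} \<in> M"
    using uv by (intro triangle_inside[OF cub c3 M', of ?X u]) auto
  then show ?thesis using that by blast
qed

section \<open>Replacing a vertex by a triangle\<close>

text \<open>The map \<open>x\<close> sends a neighbour \<open>w\<close> of \<open>t\<close> to the triangle vertex taking over the edge \<open>{t, w}\<close>. The vertex \<open>t\<close>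
  itself may be reused as a triangle vertex.\<close>

definition expansion :: "'a set \<Rightarrow> 'a set set \<Rightarrow> 'a \<Rightarrow> ('a \<Rightarrow> 'a) \<Rightarrow> 'a set \<Rightarrow> 'a set set \<Rightarrow> bool" where
  "expansion V E t x V' E' \<longleftrightarrow> t \<in> V \<and> inj_on x (nb E t) \<and> x ` nb E t \<inter> (V - {t}) = {} \<and>
     V' = (V - {t}) \<union> x ` nb E t \<and>
     E' = {e\<in>E. t \<notin> e} \<union> (\<lambda>w. {x w, w}) ` nb E t \<union> (\<lambda>w. x ` (nb E t - {w})) ` nb E t"

text \<open>A star matching at \<open>t\<close> turns into a perfect matching that leaves the triangle through all three edges.\<close>

definition star_matching :: "'a set \<Rightarrow> 'a set set \<Rightarrow> 'a \<Rightarrow> 'a set set \<Rightarrow> bool" where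
  "star_matching V E t N \<longleftrightarrow> N \<subseteq> E \<and> (\<forall>v\<in>V - {t}. \<exists>!e. e \<in> N \<and> v \<in> e) \<and> {e\<in>E. t \<in> e} \<subseteq> N"

lemma ex1_image_iff:
  assumes "\<And>a b. P a \<Longrightarrow> P b \<Longrightarrow> f a = f b \<Longrightarrow> a = b"
  shows "(\<exists>!y. \<exists>a. P a \<and> y = f a) \<longleftrightarrow> (\<exists>!a. P a)"
proof
  assume "\<exists>!y. \<exists>a. P a \<and> y = f a"
  then obtain y where ya: "\<exists>a. P a \<and> y = f a" and y: "\<forall>z. (\<exists>a. P a \<and> z = f a) \<longrightarrow> z = y"
    by (rule ex1E)
  from ya obtain a where a: "P a" "y = f a" by blast
  show "\<exists>!a. P a"
  proof (rule ex1I[of _ a])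
    show "P a" by (fact a(1))
    fix b assume b: "P b"
    then have "f b = y" using y by blast
    then show "b = a" using assms[OF b a(1)] a(2) by simp
  qed
next
  assume "\<exists>!a. P a"
  then obtain a where a: "P a" "\<forall>b. P b \<longrightarrow> b = a" by (rule ex1E)
  show "\<exists>!y. \<exists>a. P a \<and> y = f a"
  proof (rule ex1I[of _ "f a"])
    show "\<exists>b. P b \<and> f a = f b" using a(1) by blast
    fix y assume "\<exists>b. P b \<and> y = f b"
    then show "y = f a" using a(2) by blast
  qed
qed

lemma ex1_disj_iff:
  assumes "P a" "\<And>b. P b \<Longrightarrow> \<not> Q b"
  shows "(\<exists>!b. P b \<or> Q b) \<longleftrightarrow> (\<exists>!b. P b) \<and> (\<forall>b. \<not> Q b)"
proof
  assume "\<exists>!b. P b \<or> Q b"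
  then obtain c where c: "\<forall>b. P b \<or> Q b \<longrightarrow> b = c" by (rule ex1E)
  have "a = c" using c assms(1) by blast
  then have nq: "\<forall>b. \<not> Q b" and u: "\<And>b. P b \<Longrightarrow> b = a" using c assms by blast+
  have "\<exists>!b. P b" by (rule ex1I[of P a]) (fact assms(1), erule u)
  then show "(\<exists>!b. P b) \<and> (\<forall>b. \<not> Q b)" using nq by (rule conjI)
next
  assume "(\<exists>!b. P b) \<and> (\<forall>b. \<not> Q b)"
  then show "\<exists>!b. P b \<or> Q b" by simp
qed

text \<open>Degree three is assumed at \<open>t\<close> only, so the locale already applies to a
  contracted graph whose cubicity is still open; \<open>cubic_iff\<close> then supplies it.\<close>

locale expand =
  fixes V :: "'a set" and E :: "'a set set" and t :: 'a and x :: "'a \<Rightarrow> 'a" and V' E'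
  assumes simple: "simple_graph V E" and card_nb: "card (nb E t) = 3" and expn: "expansion V E t x V' E'"
begin

abbreviation "W \<equiv> nb E t"

text \<open>This carries an old edge over to the new graph: an edge \<open>{t,w}\<close> becomes
  \<open>{x w, w}\<close>. The remaining new edges are the triangle edges \<open>opp w\<close>, each
  opposite to \<open>x w\<close>.\<close>

definition \<phi> :: "'a set \<Rightarrow> 'a set" where
  "\<phi> e = (e - {t}) \<union> (if t \<in> e then x ` (e - {t}) else {})"

definition opp :: "'a \<Rightarrow> 'a set" where
  "opp w = x ` (W - {w})"

lemma t: "t \<in> V" and inj: "inj_on x W" and fresh: "x ` W \<inter> (V - {t}) = {}"
  and V': "V' = (V - {t}) \<union> x ` W"
  using expn by (auto simp: expansion_def)

lemma W_sub: "W \<subseteq> V - {t}" using nb_subset[OF simple] .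

lemma finite_W: "finite W" using card_nb card.infinite by fastforce

lemma finite_V: "finite V" using simple by (simp add: simple_graph_def)

lemma t_edge:
  assumes "e \<in> E" "t \<in> e"
  shows "\<exists>w\<in>W. e = {t,w}"
proof -
  obtain u v where "e = {u,v}" by (rule simple_graph_edge[OF simple assms(1)])
  then show ?thesis using assms by (auto simp: nb_def insert_commute)
qed

lemma \<phi>_old [simp]: "t \<notin> e \<Longrightarrow> \<phi> e = e" by (simp add: \<phi>_def)

lemma \<phi>_t: "w \<in> W \<Longrightarrow> \<phi> {t,w} = {x w, w}"
proof -
  assume "w \<in> W"
  then have "{t,w} - {t} = {w}" using W_sub by auto
  then show ?thesis by (simp add: \<phi>_def insert_commute)
qed

lemma E': "E' = \<phi> ` E \<union> opp ` W"
proof -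
  have "E = {e\<in>E. t \<notin> e} \<union> (\<lambda>w. {t,w}) ` W"
    using t_edge by (auto simp: in_nb)
  then have "\<phi> ` E = \<phi> ` {e\<in>E. t \<notin> e} \<union> \<phi> ` ((\<lambda>w. {t,w}) ` W)"
    by (metis image_Un)
  also have "\<phi> ` {e\<in>E. t \<notin> e} = {e\<in>E. t \<notin> e}" by (auto simp: image_iff)
  also have "\<phi> ` ((\<lambda>w. {t,w}) ` W) = (\<lambda>w. {x w, w}) ` W" by (auto simp: image_iff \<phi>_t)
  finally show ?thesis using expn by (simp add: expansion_def opp_def[abs_def])
qed

lemma mem_\<phi>_old: "e \<in> E \<Longrightarrow> v \<in> V - {t} \<Longrightarrow> v \<in> \<phi> e \<longleftrightarrow> v \<in> e"
proof (cases "t \<in> e")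
  case True
  assume "e \<in> E" and v: "v \<in> V - {t}"
  then obtain w where w: "w \<in> W" "e = {t,w}" using t_edge True by auto
  then have "v \<noteq> x w" using fresh v by auto
  then show ?thesis using w v by (simp add: \<phi>_t)
qed simp

lemma mem_\<phi>_new: "e \<in> E \<Longrightarrow> w \<in> W \<Longrightarrow> x w \<in> \<phi> e \<longleftrightarrow> e = {t,w}"
proof (cases "t \<in> e")
  case True
  assume "e \<in> E" "w \<in> W"
  then obtain u where u: "u \<in> W" "e = {t,u}" using t_edge True by auto
  have "x w \<noteq> u" using fresh u W_sub \<open>w \<in> W\<close> by auto
  moreover have "x w = x u \<longleftrightarrow> w = u" using inj u \<open>w \<in> W\<close> by (auto simp: inj_on_def)
  ultimately show ?thesis using u W_sub \<open>w \<in> W\<close> by (auto simp: \<phi>_t doubleton_eq_iff)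
next
  case False
  assume "e \<in> E" "w \<in> W"
  then have "e \<subseteq> V - {t}" using simple False by (auto simp: simple_graph_def)
  then show ?thesis using fresh False \<open>w \<in> W\<close> by auto
qed

lemma mem_opp_old: "v \<in> V - {t} \<Longrightarrow> v \<notin> opp w"
  using fresh by (auto simp: opp_def)

lemma mem_opp_new: "u \<in> W \<Longrightarrow> x u \<in> opp w \<longleftrightarrow> u \<noteq> w"
  using inj by (auto simp: opp_def inj_on_def)

lemma inj_\<phi>: "inj_on \<phi> E"
proof (rule inj_onI)
  fix e f assume ef: "e \<in> E" "f \<in> E" "\<phi> e = \<phi> f"
  have "e - {t} = f - {t}"
    using mem_\<phi>_old[OF ef(1)] mem_\<phi>_old[OF ef(2)] ef simple unfolding simple_graph_def by blast
  moreover have "e \<noteq> {}" "f \<noteq> {}" using ef simple by (auto simp: simple_graph_def)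
  moreover have "t \<in> e \<longleftrightarrow> t \<in> f"
    using t_edge[OF ef(1)] t_edge[OF ef(2)] mem_\<phi>_new[OF ef(1)] mem_\<phi>_new[OF ef(2)] ef(3) by blast
  ultimately show "e = f" by blast
qed

lemma inj_opp: "inj_on opp W"
proof (rule inj_onI)
  fix u w assume "u \<in> W" "w \<in> W" "opp u = opp w"
  then show "u = w" using mem_opp_new[of u u] mem_opp_new[of u w] by auto
qed

lemma \<phi>_neq_opp: "e \<in> E \<Longrightarrow> \<phi> e \<noteq> opp w"
proof
  assume e: "e \<in> E" and eq: "\<phi> e = opp w"
  obtain v where v: "v \<in> e" "v \<noteq> t" using simple_graph_edge[OF simple e] by (metis insertCI)
  then have "v \<in> V - {t}" using simple e by (auto simp: simple_graph_def)
  then show False using mem_\<phi>_old[OF e] v mem_opp_old eq by auto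
qed

lemma W_third: "u \<in> W \<Longrightarrow> w \<in> W \<Longrightarrow> \<exists>y\<in>W. y \<noteq> u \<and> y \<noteq> w"
proof (rule ccontr)
  assume "u \<in> W" "w \<in> W" "\<not> (\<exists>y\<in>W. y \<noteq> u \<and> y \<noteq> w)"
  then have "W \<subseteq> {u,w}" by auto
  then have "card W \<le> card {u,w}" by (intro card_mono) auto
  also have "\<dots> \<le> 2" by (simp add: card_insert_if)
  finally show False using card_nb by simp
qed

lemma W_third_unique: "u \<in> W \<Longrightarrow> w \<in> W \<Longrightarrow> u \<noteq> w \<Longrightarrow> \<exists>!y. y \<in> W \<and> y \<noteq> u \<and> y \<noteq> w"
proof -
  assume uw: "u \<in> W" "w \<in> W" "u \<noteq> w"
  have "card (W - {u,w}) = 1" using uw card_nb finite_W by (simp add: card_Diff_subset)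
  then obtain y where "W - {u,w} = {y}" by (metis One_nat_def card_1_singleton_iff)
  then have "z \<in> W \<and> z \<noteq> u \<and> z \<noteq> w \<longleftrightarrow> z = y" for z by (simp add: set_eq_iff)
  then show ?thesis by simp
qed

lemma W_choose: obtains w where "w \<in> W"
proof -
  have "W \<noteq> {}" using card_nb by auto
  then show ?thesis using that by blast
qed

lemma ex1_old:
  assumes "M \<subseteq> E" "v \<in> V - {t}"
  shows "(\<exists>!e. e \<in> \<phi> ` M \<union> opp ` Y \<and> v \<in> e) \<longleftrightarrow> (\<exists>!e. e \<in> M \<and> v \<in> e)"
proof -
  have 1: "e \<in> \<phi> ` M \<union> opp ` Y \<and> v \<in> e \<longleftrightarrow> (\<exists>f\<in>M. v \<in> f \<and> e = \<phi> f)" for e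
    using mem_opp_old[OF assms(2)] mem_\<phi>_old[OF _ assms(2)] assms(1) by blast
  have 2: "f = g" if "f \<in> M" "g \<in> M" "\<phi> f = \<phi> g" for f g
    using that inj_\<phi> assms(1) by (auto simp: inj_on_def)
  show ?thesis unfolding 1
  proof
    assume "\<exists>!e. \<exists>f\<in>M. v \<in> f \<and> e = \<phi> f"
    then show "\<exists>!e. e \<in> M \<and> v \<in> e" using 2 by metis
  next
    assume "\<exists>!e. e \<in> M \<and> v \<in> e"
    then show "\<exists>!e. \<exists>f\<in>M. v \<in> f \<and> e = \<phi> f" by metis
  qed
qed

lemma new_incidence:
  assumes "M \<subseteq> E" "Y \<subseteq> W" "u \<in> W"
  shows "e \<in> \<phi> ` M \<union> opp ` Y \<and> x u \<in> e \<longleftrightarrow>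
     ({t,u} \<in> M \<and> e = \<phi> {t,u}) \<or> (\<exists>y\<in>Y - {u}. e = opp y)"
proof -
  have "e \<in> \<phi> ` M \<and> x u \<in> e \<longleftrightarrow> {t,u} \<in> M \<and> e = \<phi> {t,u}"
    using mem_\<phi>_new[OF _ assms(3)] assms(1) by blast
  moreover have "e \<in> opp ` Y \<and> x u \<in> e \<longleftrightarrow> (\<exists>y\<in>Y - {u}. e = opp y)"
    using mem_opp_new[OF assms(3)] by auto
  ultimately show ?thesis by blast
qed

lemma \<phi>_mem_iff: "M \<subseteq> E \<Longrightarrow> e \<in> E \<Longrightarrow> \<phi> e \<in> \<phi> ` M \<union> opp ` Y \<longleftrightarrow> e \<in> M"
proof -
  assume *: "M \<subseteq> E" "e \<in> E"
  have "\<phi> e \<notin> opp ` Y" using \<phi>_neq_opp[OF *(2)] by blast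
  then show ?thesis using inj_on_image_mem_iff[OF inj_\<phi> *(2,1)] by simp
qed

lemma opp_mem_iff: "M \<subseteq> E \<Longrightarrow> Y \<subseteq> W \<Longrightarrow> w \<in> W \<Longrightarrow> opp w \<in> \<phi> ` M \<union> opp ` Y \<longleftrightarrow> w \<in> Y"
proof -
  assume *: "M \<subseteq> E" "Y \<subseteq> W" "w \<in> W"
  have "opp w \<notin> \<phi> ` M" using \<phi>_neq_opp * by (metis imageE subsetD)
  then show ?thesis using inj_on_image_mem_iff[OF inj_opp *(3,2)] by simp
qed

text \<open>One formula for both kinds of matchings. If \<open>{t,w}\<close> is the only edge of
  \<open>M\<close> at \<open>t\<close>, the two triangle vertices other than \<open>x w\<close> are
  left uncovered and \<open>opp w\<close> joins them; in a star matching no \<open>w\<close>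
  qualifies and nothing is added.\<close>

definition lift :: "'a set set \<Rightarrow> 'a set set" where
  "lift M = \<phi> ` M \<union> opp ` {w \<in> W. {e \<in> M. t \<in> e} = {{t,w}}}"

lemma lift_star: "star_matching V E t N \<Longrightarrow> lift N = \<phi> ` N"
proof -
  assume N: "star_matching V E t N"
  have "{e \<in> N. t \<in> e} \<noteq> {{t,w}}" if w: "w \<in> W" for w
  proof -
    obtain y where "y \<in> W" "y \<noteq> w" using W_third[OF w w] by auto
    then have "{t,y} \<in> {e \<in> N. t \<in> e}" "{t,y} \<noteq> {t,w}"
      using N by (auto simp: star_matching_def in_nb doubleton_eq_iff)
    then show ?thesis by (metis singletonD)
  qed
  then show ?thesis by (auto simp: lift_def)
qed

lemma matching_at:
  assumes "M \<subseteq> E" "\<exists>!e. e \<in> M \<and> t \<in> e"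
  obtains w where "w \<in> W" "{t,w} \<in> M" "{e \<in> M. t \<in> e} = {{t,w}}"
    "\<And>u. {t,u} \<in> M \<Longrightarrow> u = w"
proof -
  obtain e where e: "e \<in> M" "t \<in> e" "\<And>f. f \<in> M \<Longrightarrow> t \<in> f \<Longrightarrow> f = e"
    by (rule ex1E[OF assms(2)]) blast
  then obtain w where w: "w \<in> W" "e = {t,w}" using t_edge assms(1) by blast
  show ?thesis
  proof (rule that[OF w(1)])
    show "{t,w} \<in> M" using e(1) w(2) by simp
    show "{e \<in> M. t \<in> e} = {{t,w}}"
    proof (rule equalityI)
      show "{e \<in> M. t \<in> e} \<subseteq> {{t,w}}"
      proof
        fix f assume "f \<in> {e \<in> M. t \<in> e}"
        then have "f = e" using e(3)[of f] by simp
        then show "f \<in> {{t,w}}" using w(2) by simp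
      qed
      show "{{t,w}} \<subseteq> {e \<in> M. t \<in> e}" using e(1) w(2) by simp
    qed
    show "u = w" if "{t,u} \<in> M" for u using e(3)[OF that] w by (auto simp: doubleton_eq_iff)
  qed
qed

lemma lift_perfect:
  assumes "{e \<in> M. t \<in> e} = {{t,w}}" "w \<in> W"
  shows "lift M = \<phi> ` M \<union> opp ` {w}"
proof -
  have "{u \<in> W. {e \<in> M. t \<in> e} = {{t,u}}} = {w}" using assms by (auto simp: doubleton_eq_iff)
  then show ?thesis by (simp add: lift_def)
qed

lemma sub_E': "M \<subseteq> E \<Longrightarrow> Y \<subseteq> W \<Longrightarrow> \<phi> ` M \<union> opp ` Y \<subseteq> E'"
  using E' by auto

lemma ex1_new_single:
  assumes "M \<subseteq> E" "w \<in> W" "\<And>u. {t,u} \<in> M \<longleftrightarrow> u = w" "u \<in> W"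
  shows "\<exists>!e. e \<in> \<phi> ` M \<union> opp ` {w} \<and> x u \<in> e"
proof -
  have "e \<in> \<phi> ` M \<union> opp ` {w} \<and> x u \<in> e \<longleftrightarrow> e = (if u = w then \<phi> {t,u} else opp w)" for e
    using new_incidence[OF assms(1) _ assms(4), of "{w}" e] assms(2,3) by auto
  then show ?thesis by simp
qed

text \<open>The matching condition is required at \<open>t\<close> and at the single vertex
  \<open>v\<close> only. Hence the lemma serves perfect matchings and also star matchings centred at
  a vertex other than \<open>t\<close>.\<close>

lemma lift_matching:
  assumes "M \<subseteq> E" "v \<in> V" "v \<noteq> t \<Longrightarrow> \<exists>!e. e \<in> M \<and> v \<in> e" "\<exists>!e. e \<in> M \<and> t \<in> e"
  shows "v \<noteq> t \<Longrightarrow> \<exists>!e. e \<in> lift M \<and> v \<in> e" "u \<in> W \<Longrightarrow> \<exists>!e. e \<in> lift M \<and> x u \<in> e" "lift M \<subseteq> E'"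
proof -
  obtain w where w: "w \<in> W" "{t,w} \<in> M" "{e \<in> M. t \<in> e} = {{t,w}}" "\<And>u. {t,u} \<in> M \<Longrightarrow> u = w"
    by (rule matching_at[OF assms(1,4)]) blast
  note L = lift_perfect[OF w(3,1)]
  show "\<exists>!e. e \<in> lift M \<and> v \<in> e" if "v \<noteq> t"
    unfolding L using ex1_old[OF assms(1), of v "{w}"] assms(2) assms(3)[OF that] that by simp
  have iff: "{t,u} \<in> M \<longleftrightarrow> u = w" for u using w(2) w(4)[of u] by auto
  show "\<exists>!e. e \<in> lift M \<and> x u \<in> e" if "u \<in> W"
    unfolding L by (rule ex1_new_single[OF assms(1) w(1) iff that])
  show "lift M \<subseteq> E'" unfolding L using sub_E'[OF assms(1), of "{w}"] w(1) by simp
qed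

lemma perfect_lift:
  assumes "perfect_matching V E M"
  shows "perfect_matching V' E' (lift M)"
proof -
  have M: "M \<subseteq> E" "\<And>v. v \<in> V \<Longrightarrow> \<exists>!e. e \<in> M \<and> v \<in> e" using assms by (auto simp: perfect_matching_def)
  note L = lift_matching[OF M(1) _ M(2) M(2)[OF t]]
  show ?thesis unfolding perfect_matching_def
  proof (intro conjI ballI)
    show "lift M \<subseteq> E'" using L(3)[OF t t] .
    fix v assume "v \<in> V'"
    then consider "v \<in> V" "v \<noteq> t" | u where "u \<in> W" "v = x u" using V' by auto
    then show "\<exists>!e. e \<in> lift M \<and> v \<in> e" using L(1)[of v] L(2)[OF t t] by cases auto
  qed
qed

lemma star_lift:
  assumes "star_matching V E t N"
  shows "perfect_matching V' E' (lift N)"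
proof -
  have N: "N \<subseteq> E" "\<And>v. v \<in> V - {t} \<Longrightarrow> \<exists>!e. e \<in> N \<and> v \<in> e" "\<And>u. u \<in> W \<Longrightarrow> {t,u} \<in> N"
    using assms by (auto simp: star_matching_def in_nb)
  note L = lift_star[OF assms]
  show ?thesis unfolding perfect_matching_def L
  proof (intro conjI ballI)
    show "\<phi> ` N \<subseteq> E'" using sub_E'[OF N(1), of "{}"] by simp
    fix v assume "v \<in> V'"
    then consider "v \<in> V - {t}" | u where "u \<in> W" "v = x u" using V' by auto
    then show "\<exists>!e. e \<in> \<phi> ` N \<and> v \<in> e"
    proof cases
      case 1 then show ?thesis using ex1_old[OF N(1) 1, of "{}"] N(2)[OF 1] by simp
    next
      case 2
      have "e \<in> \<phi> ` N \<and> x u \<in> e \<longleftrightarrow> e = \<phi> {t,u}" for e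
        using new_incidence[OF N(1) _ 2(1), of "{}" e] N(3)[OF 2(1)] by auto
      then show ?thesis unfolding 2(2) by simp
    qed
  qed
qed

text \<open>A matching contains at most one triangle edge, since any two of them meet. With none,
  all three triangle vertices are matched outwards, giving a star matching; with
  \<open>opp w\<close>, only \<open>x w\<close> is matched outwards, giving a perfect matching
  through \<open>{t,w}\<close>.\<close>

lemma matching_cases:
  assumes "perfect_matching V' E' M'"
  obtains M where "perfect_matching V E M" "M' = lift M" | N where "star_matching V E t N" "M' = lift N"
proof -
  define M where "M = {e\<in>E. \<phi> e \<in> M'}"
  define Y where "Y = {w\<in>W. opp w \<in> M'}"
  have ME: "M \<subseteq> E" and YW: "Y \<subseteq> W" by (auto simp: M_def Y_def)
  have M'E: "M' \<subseteq> E'" and M'1: "\<And>v. v \<in> V' \<Longrightarrow> \<exists>!e. e \<in> M' \<and> v \<in> e"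
    using assms by (auto simp: perfect_matching_def)
  have M': "M' = \<phi> ` M \<union> opp ` Y" using M'E E' by (auto simp: M_def Y_def)
  have old: "\<exists>!e. e \<in> M \<and> v \<in> e" if "v \<in> V - {t}" for v
    using ex1_old[OF ME that, of Y] M'1[of v] that V' M' by simp
  have new: "\<exists>!e. ({t,u} \<in> M \<and> e = \<phi> {t,u}) \<or> (\<exists>y\<in>Y - {u}. e = opp y)" if "u \<in> W" for u
    using M'1[of "x u"] that V' unfolding M' new_incidence[OF ME YW that] by simp
  show ?thesis
  proof (cases "Y = {}")
    case True
    have "{t,u} \<in> M" if "u \<in> W" for u using new[OF that] True by auto
    then have "{e\<in>E. t \<in> e} \<subseteq> M" using t_edge by blast
    then have "star_matching V E t M" using ME old by (simp add: star_matching_def)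
    moreover from this have "M' = lift M" using lift_star M' True by simp
    ultimately show ?thesis using that(2) by blast
  next
    case False
    then obtain w where w: "w \<in> Y" "w \<in> W" using YW by auto
    have Y: "Y = {w}"
    proof (rule ccontr)
      assume "Y \<noteq> {w}"
      then obtain y where y: "y \<in> Y" "y \<noteq> w" using w by auto
      then obtain u where u: "u \<in> W" "u \<noteq> w" "u \<noteq> y" using W_third[of w y] w YW by auto
      have "opp w = opp y" using new[OF u(1)] u w y by (metis DiffI singletonD)
      then show False using inj_opp w y YW by (auto simp: inj_on_def)
    qed
    have iff: "{t,u} \<in> M \<longleftrightarrow> u = w" for u
    proof
      assume tu: "{t,u} \<in> M"
      then have u: "u \<in> W" using ME by (auto simp: in_nb)
      show "u = w"
      proof (rule ccontr)
        assume "u \<noteq> w"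
        then have "\<phi> {t,u} = opp w" using new[OF u] tu Y by auto
        then show False using \<phi>_neq_opp tu ME by blast
      qed
    next
      assume "u = w"
      then show "{t,u} \<in> M" using new[OF w(2)] Y by auto
    qed
    have Mt: "{e \<in> M. t \<in> e} = {{t,w}}"
    proof (intro equalityI subsetI)
      fix e assume "e \<in> {e \<in> M. t \<in> e}"
      moreover from this obtain u where "e = {t,u}" using t_edge ME by blast
      ultimately show "e \<in> {{t,w}}" using iff by simp
    qed (use iff[of w] in simp)
    then have "e \<in> M \<and> t \<in> e \<longleftrightarrow> e = {t,w}" for e by (metis (mono_tags, lifting) mem_Collect_eq singleton_iff)
    then have t1: "\<exists>!e. e \<in> M \<and> t \<in> e" by simp
    have "\<exists>!e. e \<in> M \<and> v \<in> e" if "v \<in> V" for v using t1 old[of v] that by (cases "v = t") simp_all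
    then have "perfect_matching V E M" using ME unfolding perfect_matching_def by simp
    moreover have "M' = lift M" using lift_perfect[OF Mt w(2)] M' Y by simp
    ultimately show ?thesis using that(1) by blast
  qed
qed

lemma \<phi>_in_lift: "M \<subseteq> E \<Longrightarrow> e \<in> E \<Longrightarrow> \<phi> e \<in> lift M \<longleftrightarrow> e \<in> M"
  unfolding lift_def by (rule \<phi>_mem_iff)

lemma opp_in_lift:
  assumes "M \<subseteq> E" "w \<in> W"
  shows "opp w \<in> lift M \<longleftrightarrow> {e \<in> M. t \<in> e} = {{t,w}}"
  unfolding lift_def using opp_mem_iff[OF assms(1) _ assms(2), of "{w \<in> W. {e \<in> M. t \<in> e} = {{t,w}}}"] assms(2) by auto

lemma opp_in_lift_perfect:
  assumes "perfect_matching V E M" "w \<in> W"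
  shows "opp w \<in> lift M \<longleftrightarrow> {t,w} \<in> M"
proof -
  have M: "M \<subseteq> E" "\<exists>!e. e \<in> M \<and> t \<in> e" using assms t by (auto simp: perfect_matching_def)
  show ?thesis using M(2) unfolding opp_in_lift[OF M(1) assms(2)] by blast
qed

lemma opp_notin_lift_star:
  assumes "star_matching V E t N" "w \<in> W"
  shows "opp w \<notin> lift N"
proof
  assume "opp w \<in> lift N"
  then obtain e where "e \<in> N" "\<phi> e = opp w" unfolding lift_star[OF assms(1)] by (elim imageE) simp
  moreover from this have "e \<in> E" using assms(1) by (auto simp: star_matching_def)
  ultimately show False using \<phi>_neq_opp by simp
qed

lemma inj_lift: "M \<subseteq> E \<Longrightarrow> N \<subseteq> E \<Longrightarrow> lift M = lift N \<Longrightarrow> M = N"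
  using \<phi>_in_lift by blast

text \<open>Star matchings lift to matchings without triangle edges, so the matchings through
  \<open>opp w\<close> are precisely the lifts of the perfect matchings through
  \<open>{t,w}\<close>.\<close>

lemma lonely_opp_iff:
  assumes "w \<in> W"
  shows "lonely_edge V' E' (opp w) \<longleftrightarrow> lonely_edge V E {t,w}"
proof -
  have "opp w \<in> E'" "{t,w} \<in> E" using assms E' by (auto simp: in_nb)
  moreover have "(\<exists>!M'. perfect_matching V' E' M' \<and> opp w \<in> M') \<longleftrightarrow> (\<exists>!M. perfect_matching V E M \<and> {t,w} \<in> M)"
    (is "?L \<longleftrightarrow> ?R")
  proof
    assume L: ?L
    then obtain M' where M': "perfect_matching V' E' M'" "opp w \<in> M'" by blast
    from M'(1) show ?R
    proof (rule matching_cases)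
      fix M assume M: "perfect_matching V E M" "M' = lift M"
      show ?R
      proof (rule ex1I[of _ M])
        show "perfect_matching V E M \<and> {t,w} \<in> M" using M M'(2) opp_in_lift_perfect[OF M(1) assms] by simp
        fix N assume N: "perfect_matching V E N \<and> {t,w} \<in> N"
        then have "perfect_matching V' E' (lift N)" "opp w \<in> lift N"
          using perfect_lift opp_in_lift_perfect[OF _ assms] by auto
        then have "lift N = lift M" using L M' M(2) by blast
        then show "N = M" using inj_lift N M(1) by (simp add: perfect_matching_def)
      qed
    next
      fix N assume "star_matching V E t N" "M' = lift N"
      then show ?R using opp_notin_lift_star[OF _ assms] M'(2) by blast
    qed
  next
    assume R: ?R
    then obtain M where M: "perfect_matching V E M" "{t,w} \<in> M" by blast
    show ?L
    proof (rule ex1I[of _ "lift M"])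
      show "perfect_matching V' E' (lift M) \<and> opp w \<in> lift M"
        using perfect_lift[OF M(1)] opp_in_lift_perfect[OF M(1) assms] M(2) by simp
      fix N' assume N': "perfect_matching V' E' N' \<and> opp w \<in> N'"
      then have "perfect_matching V' E' N'" ..
      then show "N' = lift M"
      proof (rule matching_cases)
        fix N assume N: "perfect_matching V E N" "N' = lift N"
        then have "{t,w} \<in> N" using N' opp_in_lift_perfect[OF N(1) assms] by simp
        then have "N = M" using R N(1) M by blast
        then show ?thesis using N by simp
      next
        fix N assume "star_matching V E t N" "N' = lift N"
        then show ?thesis using opp_notin_lift_star[OF _ assms] N' by blast
      qed
    qed
  qed
  ultimately show ?thesis by (simp add: lonely_edge_iff)
qed

text \<open>Both kinds of matchings lift to matchings through a transported edge, and
  \<open>lift\<close> is injective on their union, so they are counted together.\<close>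

lemma perfect_or_star_ex1:
  assumes "e \<in> E"
  shows "lonely_edge V' E' (\<phi> e) \<longleftrightarrow> (\<exists>!M. (perfect_matching V E M \<or> star_matching V E t M) \<and> e \<in> M)"
proof -
  have sub: "M \<subseteq> E" if "perfect_matching V E M \<or> star_matching V E t M" for M
    using that by (auto simp: perfect_matching_def star_matching_def)
  have 1: "perfect_matching V' E' M' \<longleftrightarrow> (\<exists>M. (perfect_matching V E M \<or> star_matching V E t M) \<and> M' = lift M)" for M'
    using perfect_lift star_lift by (metis matching_cases)
  have 2: "perfect_matching V' E' M' \<and> \<phi> e \<in> M' \<longleftrightarrow> (\<exists>M. ((perfect_matching V E M \<or> star_matching V E t M) \<and> e \<in> M) \<and> M' = lift M)" for M'
    unfolding 1 using \<phi>_in_lift[OF sub assms] by blast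
  have 3: "M = N" if "perfect_matching V E M \<or> star_matching V E t M" "perfect_matching V E N \<or> star_matching V E t N" "lift M = lift N" for M N
    using inj_lift sub that by blast
  have "\<phi> e \<in> E'" using assms E' by auto
  then have "lonely_edge V' E' (\<phi> e) \<longleftrightarrow> (\<exists>!M'. \<exists>M. ((perfect_matching V E M \<or> star_matching V E t M) \<and> e \<in> M) \<and> M' = lift M)"
    unfolding lonely_edge_iff 2 by simp
  also have "\<dots> \<longleftrightarrow> (\<exists>!M. (perfect_matching V E M \<or> star_matching V E t M) \<and> e \<in> M)"
    by (rule ex1_image_iff) (use 3 in blast)
  finally show ?thesis .
qed

lemma not_perfect_and_star: "\<not> (perfect_matching V E M \<and> star_matching V E t M)"
proof
  assume M: "perfect_matching V E M \<and> star_matching V E t M"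
  obtain w where w: "w \<in> W" by (rule W_choose)
  obtain y where y: "y \<in> W" "y \<noteq> w" using W_third[OF w w] by auto
  have "{t,w} \<in> M" "{t,y} \<in> M" using M w y by (auto simp: star_matching_def in_nb)
  moreover have "{t,w} \<noteq> {t,y}" using y by (auto simp: doubleton_eq_iff)
  moreover have "\<exists>!e. e \<in> M \<and> t \<in> e" using M t by (auto simp: perfect_matching_def)
  ultimately show False by blast
qed

text \<open>The hypotheses make the counts decisive: an edge at \<open>t\<close> lies in a perfect
  matching and in a star matching, so its image is never lonely; an edge away from \<open>t\<close>
  already lies in a perfect matching, so a single star matching through it destroys loneliness. The
  injective map in the statement sends \<open>{t,w}\<close> to \<open>opp w\<close> and fixes the
  other edges.\<close>

lemma lonely_edges_expansion:
  assumes P: "\<And>e. e \<in> E \<Longrightarrow> \<exists>M. perfect_matching V E M \<and> e \<in> M" and Q: "\<exists>N. star_matching V E t N"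
  shows "{e. lonely_edge V' E' e} = (\<lambda>e. if t \<in> e then x ` (W - e) else e) `
     {e. lonely_edge V E e \<and> (t \<in> e \<or> (\<forall>N. star_matching V E t N \<longrightarrow> e \<notin> N))}" (is "?A = ?g ` ?B")
    and "card {e. lonely_edge V' E' e} =
     card {e. lonely_edge V E e \<and> (t \<in> e \<or> (\<forall>N. star_matching V E t N \<longrightarrow> e \<notin> N))}"
proof -
  have gt: "?g {t,w} = opp w" if "w \<in> W" for w
  proof -
    have "W - {t,w} = W - {w}" using W_sub by auto
    then show ?thesis by (simp add: opp_def)
  qed
  have old: "lonely_edge V' E' e \<longleftrightarrow> lonely_edge V E e \<and> (\<forall>N. star_matching V E t N \<longrightarrow> e \<notin> N)"
    if e: "e \<in> E" "t \<notin> e" for e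
  proof -
    obtain M where M: "perfect_matching V E M \<and> e \<in> M" using P[OF e(1)] by (elim exE)
    have "lonely_edge V' E' e \<longleftrightarrow> (\<exists>!M. (perfect_matching V E M \<and> e \<in> M) \<or> (star_matching V E t M \<and> e \<in> M))"
      using perfect_or_star_ex1[OF e(1)] e(2) by (simp add: conj_disj_distribR)
    also have "\<dots> \<longleftrightarrow> (\<exists>!M. perfect_matching V E M \<and> e \<in> M) \<and> (\<forall>M. \<not> (star_matching V E t M \<and> e \<in> M))"
      by (rule ex1_disj_iff[of "\<lambda>M. perfect_matching V E M \<and> e \<in> M", OF M]) (use not_perfect_and_star in blast)
    finally show ?thesis using e(1) by (simp add: lonely_edge_iff)
  qed
  have cross: "\<not> lonely_edge V' E' (\<phi> {t,w})" if w: "w \<in> W" for w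
  proof
    assume L: "lonely_edge V' E' (\<phi> {t,w})"
    have tw: "{t,w} \<in> E" using w by (simp add: in_nb)
    obtain M where M: "perfect_matching V E M" "{t,w} \<in> M" using P tw by blast
    obtain N where N: "star_matching V E t N" using Q by blast
    have "{t,w} \<in> N" using N tw by (auto simp: star_matching_def)
    then have "M = N" using L[unfolded perfect_or_star_ex1[OF tw]] M N by (elim ex1E) metis
    then show False using M N not_perfect_and_star by blast
  qed
  have BE: "?B \<subseteq> E" by (auto simp: lonely_edge_def)
  show A: "?A = ?g ` ?B"
  proof (intro equalityI subsetI)
    fix e assume "e \<in> ?A"
    then have e: "lonely_edge V' E' e" by simp
    then have "e \<in> E'" by (simp add: lonely_edge_def)
    then consider f where "f \<in> E" "e = \<phi> f" | w where "w \<in> W" "e = opp w" using E' by auto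
    then show "e \<in> ?g ` ?B"
    proof cases
      case 1
      have "t \<notin> f" using cross t_edge[OF 1(1)] e 1(2) by blast
      then have "e \<in> ?B" "t \<notin> e" using 1 e old[of e] by auto
      then show ?thesis by (intro image_eqI[of _ _ e]) auto
    next
      case 2
      then have "{t,w} \<in> ?B" using e lonely_opp_iff by simp
      then show ?thesis using gt[OF 2(1)] 2(2) by (intro image_eqI[of _ _ "{t,w}"]) auto
    qed
  next
    fix e assume "e \<in> ?g ` ?B"
    then obtain f where f: "e = ?g f" "f \<in> ?B" by (rule imageE)
    show "e \<in> ?A"
    proof (cases "t \<in> f")
      case True
      then obtain w where w: "w \<in> W" "f = {t,w}" using t_edge BE f(2) by blast
      then have "e = opp w" using f(1) gt by simp
      then show ?thesis using w f(2) lonely_opp_iff by simp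
    next
      case False
      then show ?thesis using f BE old[of f] by auto
    qed
  qed
  have inj_g: "inj_on ?g ?B"
  proof (rule inj_onI)
    fix e f assume ef: "e \<in> ?B" "f \<in> ?B" and eq: "?g e = ?g f"
    have E: "e \<in> E" "f \<in> E" using ef BE by auto
    have ne: "\<phi> e' \<noteq> opp w" if "e' \<in> E" for e' w using \<phi>_neq_opp that by blast
    show "e = f"
    proof (cases "t \<in> e")
      case True
      then obtain w where w: "w \<in> W" "e = {t,w}" using t_edge E by blast
      then have 1: "?g e = opp w" using gt by simp
      show ?thesis
      proof (cases "t \<in> f")
        case True
        then obtain u where u: "u \<in> W" "f = {t,u}" using t_edge E by blast
        then have "opp w = opp u" using 1 gt eq by simp
        then show ?thesis using inj_opp w u by (auto simp: inj_on_def)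
      next
        case False
        then have "\<phi> f = opp w" using 1 eq by simp
        then show ?thesis using ne E by blast
      qed
    next
      case te: False
      then have 1: "?g e = \<phi> e" by simp
      show ?thesis
      proof (cases "t \<in> f")
        case True
        then obtain u where u: "u \<in> W" "f = {t,u}" using t_edge E by blast
        then have "\<phi> e = opp u" using 1 gt eq by simp
        then show ?thesis using ne E by blast
      next
        case False
        then show ?thesis using eq te by simp
      qed
    qed
  qed
  show "card ?A = card ?B" unfolding A by (rule card_image[OF inj_g])
qed

end

section \<open>Degrees and edge cuts under triangle replacement\<close>

context expand
begin

lemma simple': "simple_graph V' E'"
proof -
  have "finite V'" using V' finite_V finite_W by simp
  moreover have "e \<subseteq> V' \<and> card e = 2" if "e \<in> E'" for e
  proof -
    consider "e \<in> E" "t \<notin> e" | w where "w \<in> W" "e = {x w, w}" | w where "w \<in> W" "e = opp w"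
    proof -
      consider f where "f \<in> E" "e = \<phi> f" | w where "w \<in> W" "e = opp w" using \<open>e \<in> E'\<close> E' by auto
      then show thesis
      proof cases
        case 1
        show thesis
        proof (cases "t \<in> f")
          case True
          then obtain w where "w \<in> W" "f = {t,w}" using t_edge 1 by blast
          then show thesis using \<phi>_t[of w] 1 that(2) by simp
        next
          case False
          then show thesis using 1 that(1) by simp
        qed
      qed (use that(3) in blast)
    qed
    then show ?thesis
    proof cases
      case 1 then show ?thesis using simple V' by (auto simp: simple_graph_def)
    next
      case 2
      then have "x w \<noteq> w" using fresh W_sub by (metis IntI empty_iff imageI subsetD)
      then show ?thesis using 2 W_sub V' by auto
    next
      case 3
      have "card (opp w) = card (W - {w})"
        unfolding opp_def by (rule card_image) (rule inj_on_subset[OF inj], auto)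
      then show ?thesis using 3 card_nb V' by (auto simp: opp_def)
    qed
  qed
  ultimately show ?thesis by (simp add: simple_graph_def)
qed

lemma nb_old: "v \<in> V - {t} \<Longrightarrow> nb E' v = (nb E v - {t}) \<union> (if v \<in> W then {x v} else {})"
proof -
  assume v: "v \<in> V - {t}"
  have "{v,a} \<in> E' \<longleftrightarrow> ({v,a} \<in> E \<and> a \<noteq> t) \<or> (v \<in> W \<and> a = x v)" for a
  proof
    assume a: "{v,a} \<in> E'"
    then have "\<exists>e\<in>E. {v,a} = \<phi> e" using E' mem_opp_old[OF v] by (metis UnE imageE insertI1)
    then obtain e where e: "e \<in> E" "{v,a} = \<phi> e" by blast
    show "({v,a} \<in> E \<and> a \<noteq> t) \<or> (v \<in> W \<and> a = x v)"
    proof (cases "t \<in> e")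
      case True
      then obtain w where w: "w \<in> W" "e = {t,w}" using t_edge e by blast
      then have "{v,a} = {x w,w}" using e \<phi>_t by simp
      moreover have "v \<noteq> x w" using fresh v w by auto
      ultimately show ?thesis using w by (auto simp: doubleton_eq_iff)
    next
      case False
      then show ?thesis using e by auto
    qed
  next
    assume "({v,a} \<in> E \<and> a \<noteq> t) \<or> (v \<in> W \<and> a = x v)"
    then show "{v,a} \<in> E'"
    proof
      assume *: "{v,a} \<in> E \<and> a \<noteq> t"
      then have "\<phi> {v,a} = {v,a}" using v by (intro \<phi>_old) auto
      then show ?thesis using * E' by (metis UnI1 imageI)
    next
      assume *: "v \<in> W \<and> a = x v"
      then have "{v,a} = \<phi> {t,v}" "{t,v} \<in> E" using \<phi>_t[of v] by (simp_all add: in_nb insert_commute)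
      then show ?thesis using E' by auto
    qed
  qed
  then show ?thesis using v by (auto simp: nb_def)
qed

lemma nb_new: "u \<in> W \<Longrightarrow> nb E' (x u) = insert u (x ` (W - {u}))"
proof -
  assume u: "u \<in> W"
  have "{x u,a} \<in> E' \<longleftrightarrow> a = u \<or> a \<in> x ` (W - {u})" for a
  proof
    assume a: "{x u,a} \<in> E'"
    have ne: "x u \<noteq> a" using simple_graph_edge_neq[OF simple' a] by simp
    from a consider e where "e \<in> E" "{x u,a} = \<phi> e" | w where "w \<in> W" "{x u,a} = opp w"
      using E' by auto
    then show "a = u \<or> a \<in> x ` (W - {u})"
    proof cases
      case 1
      then have "e = {t,u}" using mem_\<phi>_new[OF 1(1) u] by auto
      then have "{x u,a} = {x u,u}" using 1 \<phi>_t u by simp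
      then show ?thesis by (auto simp: doubleton_eq_iff)
    next
      case 2
      then have "a \<in> opp w" by auto
      then show ?thesis using ne by (auto simp: opp_def)
    qed
  next
    assume "a = u \<or> a \<in> x ` (W - {u})"
    then show "{x u,a} \<in> E'"
    proof
      assume "a = u"
      then have "{x u,a} = \<phi> {t,u}" "{t,u} \<in> E" using \<phi>_t[OF u] u by (simp_all add: in_nb)
      then show ?thesis using E' by auto
    next
      assume "a \<in> x ` (W - {u})"
      then obtain y where y: "y \<in> W" "y \<noteq> u" "a = x y" by auto
      obtain w where w: "w \<in> W \<and> w \<noteq> u \<and> w \<noteq> y" and w': "\<forall>z. z \<in> W \<and> z \<noteq> u \<and> z \<noteq> y \<longrightarrow> z = w"
        by (rule ex1E[OF W_third_unique[OF u y(1) y(2)[symmetric]]])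
      have "z \<in> W - {w} \<longleftrightarrow> z \<in> {u,y}" for z using w w'[rule_format, of z] u y(1) by blast
      then have "W - {w} = {u,y}" by blast
      then have "opp w = {x u,a}" using y by (simp add: opp_def)
      then show ?thesis using E' w by auto
    qed
  qed
  then show ?thesis by (auto simp: nb_def)
qed

lemma card_nb_old: "v \<in> V - {t} \<Longrightarrow> card (nb E' v) = card (nb E v)"
proof -
  assume v: "v \<in> V - {t}"
  show ?thesis
  proof (cases "v \<in> W")
    case True
    have "x v \<notin> nb E v - {t}" using fresh True nb_subset[OF simple, of v] by auto
    moreover have "finite (nb E v)" using finite_subset[OF nb_subset[OF simple, of v]] finite_V by simp
    moreover have "t \<in> nb E v" using True unfolding nb_sym[of v] .
    moreover have "nb E' v = insert (x v) (nb E v - {t})" using nb_old[OF v] True by simp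
    ultimately show ?thesis using card.remove[of "nb E v" t] by simp
  next
    case False
    then have "t \<notin> nb E v" unfolding nb_sym[of v] .
    then show ?thesis using False nb_old[OF v] by simp
  qed
qed

lemma card_nb_new: "u \<in> W \<Longrightarrow> card (nb E' (x u)) = 3"
proof -
  assume u: "u \<in> W"
  have "u \<notin> x ` (W - {u})" using fresh u W_sub by auto
  moreover have "card (x ` (W - {u})) = 2"
    using u card_nb finite_W inj by (subst card_image) (auto intro: inj_on_subset)
  ultimately show ?thesis using nb_new[OF u] finite_W by simp
qed

lemma cubic_iff: "cubic_graph V' E' \<longleftrightarrow> cubic_graph V E"
proof -
  have "(\<forall>v\<in>V'. card (nb E' v) = 3) \<longleftrightarrow> (\<forall>v\<in>V. card (nb E v) = 3)"
  proof
    assume *: "\<forall>v\<in>V'. card (nb E' v) = 3"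
    show "\<forall>v\<in>V. card (nb E v) = 3"
    proof
      fix v assume "v \<in> V"
      then show "card (nb E v) = 3" using * card_nb_old[of v] card_nb V' by (cases "v = t") auto
    qed
  next
    assume *: "\<forall>v\<in>V. card (nb E v) = 3"
    show "\<forall>v\<in>V'. card (nb E' v) = 3"
    proof
      fix v assume "v \<in> V'"
      then consider "v \<in> V - {t}" | u where "u \<in> W" "v = x u" using V' by auto
      then show "card (nb E' v) = 3" using * card_nb_old[of v] card_nb_new by cases auto
    qed
  qed
  then show ?thesis using simple simple' degree_eq_card_nb by (simp add: cubic_graph_def degree_eq_card_nb)
qed

lemma card_V': "card V' = card V + 2"
proof -
  have "card V' = card (V - {t}) + card (x ` W)"
    unfolding V' using fresh finite_V finite_W by (intro card_Un_disjoint) auto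
  also have "card (x ` W) = 3" using card_image[OF inj] card_nb by simp
  also have "card (V - {t}) = card V - 1" using t finite_V by simp
  finally show ?thesis using t finite_V card_gt_0_iff[of V] by auto
qed

text \<open>A set avoiding \<open>t\<close> avoids the new triangle too. Edges from it into
  \<open>t\<close> are redirected to the triangle vertices of their own ends, and this matches the
  two cuts bijectively.\<close>

lemma card_cut_old:
  assumes X: "X \<subseteq> V - {t}"
  shows "card (cut V' E' X) = card (cut V E X)"
proof -
  let ?f = "\<lambda>(a,b). (a, if b = t then x a else b)"
  have Wt: "a \<in> W \<longleftrightarrow> t \<in> nb E a" for a using nb_sym .
  have "cut V' E' X = ?f ` cut V E X"
  proof (intro equalityI subsetI)
    fix p assume "p \<in> cut V' E' X"
    then obtain a b where p: "p = (a,b)" "a \<in> X" "b \<in> V' - X" "b \<in> nb E' a" by (auto simp: cut_def nb_def)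
    have a: "a \<in> V - {t}" using p X by auto
    from p(4) have "(b \<in> nb E a \<and> b \<noteq> t) \<or> (a \<in> W \<and> b = x a)"
      unfolding nb_old[OF a] by (auto split: if_splits)
    then show "p \<in> ?f ` cut V E X"
    proof
      assume *: "b \<in> nb E a \<and> b \<noteq> t"
      then have "b \<in> V" using nb_subset[OF simple] by auto
      then have "(a,b) \<in> cut V E X" using * p by (simp add: cut_def in_nb)
      then show ?thesis using * p by (intro image_eqI[of _ _ "(a,b)"]) auto
    next
      assume *: "a \<in> W \<and> b = x a"
      then have "(a,t) \<in> cut V E X" using p X t by (auto simp: cut_def nb_def insert_commute)
      then show ?thesis using * p by (intro image_eqI[of _ _ "(a,t)"]) auto
    qed
  next
    fix p assume "p \<in> ?f ` cut V E X"
    then obtain a b where p: "p = ?f (a,b)" "a \<in> X" "b \<in> V - X" "b \<in> nb E a" by (auto simp: cut_def nb_def)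
    have a: "a \<in> V - {t}" using p X by auto
    show "p \<in> cut V' E' X"
    proof (cases "b = t")
      case True
      then have aW: "a \<in> W" using p Wt by simp
      then have "x a \<in> nb E' a" using nb_old[OF a] by simp
      moreover have "x a \<notin> X" using fresh X aW by auto
      ultimately show ?thesis using p True V' aW by (simp add: cut_def in_nb)
    next
      case False
      then have "b \<in> nb E' a" using nb_old[OF a] p by simp
      then show ?thesis using p False V' by (simp add: cut_def in_nb)
    qed
  qed
  moreover have "inj_on ?f (cut V E X)"
  proof (rule inj_onI)
    fix p q assume "p \<in> cut V E X" "q \<in> cut V E X" "?f p = ?f q"
    moreover have False if "{a,t} \<in> E" "x a \<in> V" "x a \<noteq> t" for a
      using that fresh by (auto simp: nb_def insert_commute)
    ultimately show "p = q" by (auto simp: cut_def split: if_splits)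
  qed
  ultimately show ?thesis by (simp add: card_image)
qed

text \<open>Since a set and its complement have cuts of the same size, the side avoiding
  \<open>t\<close> can be taken, where \<open>card_cut_old\<close> applies.\<close>

lemma three_edge_connected_contract:
  assumes "three_edge_connected V' E'"
  shows "three_edge_connected V E"
  unfolding three_edge_connected_def
proof (intro allI impI)
  fix X assume X: "X \<subseteq> V" "X \<noteq> {}" "X \<noteq> V"
  have *: "3 \<le> card (cut V E Y)" if Y: "Y \<subseteq> V - {t}" "Y \<noteq> {}" for Y
  proof -
    obtain w where "w \<in> W" by (rule W_choose)
    then have "x w \<notin> Y" "x w \<in> V'" using Y V' fresh by auto
    then have "Y \<subseteq> V'" "Y \<noteq> V'" using Y V' by auto
    then have "3 \<le> card (cut V' E' Y)" using assms Y(2) unfolding three_edge_connected_def by simp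
    then show ?thesis using card_cut_old[OF Y(1)] by simp
  qed
  show "3 \<le> card (cut V E X)"
  proof (cases "t \<in> X")
    case True
    have "V - X \<subseteq> V - {t}" "V - X \<noteq> {}" using True X(1,3) by auto
    then show ?thesis using *[of "V - X"] card_cut_Diff[OF X(1), of E] by simp
  next
    case False
    then show ?thesis using *[OF _ X(2)] X(1) by (simp add: subset_Diff_insert)
  qed
qed

text \<open>If \<open>X\<close> does not split the triangle, \<open>card_cut_old\<close> applies to
  it or to its complement. Otherwise one triangle vertex \<open>x u\<close> is alone on its side.
  Adding it to the rest of that side loses at most the cut edge \<open>{u, x u}\<close> and gains
  two triangle edges, so three is not undercut; if there is no rest, the cut consists of the three
  edges at \<open>x u\<close>.\<close>

lemma three_edge_connected_expand:
  assumes "three_edge_connected V E"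
  shows "three_edge_connected V' E'"
  unfolding three_edge_connected_def
proof (intro allI impI)
  fix X assume X: "X \<subseteq> V'" "X \<noteq> {}" "X \<noteq> V'"
  have finV': "finite V'" using simple' by (simp add: simple_graph_def)
  have none: "3 \<le> card (cut V' E' Y)" if Y: "Y \<subseteq> V - {t}" "Y \<noteq> {}" for Y
  proof -
    have "Y \<subseteq> V" "Y \<noteq> V" using Y t by auto
    then have "3 \<le> card (cut V E Y)" using assms Y(2) unfolding three_edge_connected_def by simp
    then show ?thesis using card_cut_old[OF Y(1)] by simp
  qed
  have one: "3 \<le> card (cut V' E' Z)" if Z: "Z \<subseteq> V'" "u \<in> W" "Z \<inter> x ` W = {x u}" for Z u
  proof (cases "Z = {x u}")
    case True
    have "cut V' E' Z = (\<lambda>b. (x u, b)) ` nb E' (x u)"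
      using True nb_subset[OF simple', of "x u"] by (auto simp: cut_def nb_def)
    then show ?thesis using card_nb_new[OF Z(2)] by (simp add: card_image inj_on_def)
  next
    case False
    define Y where "Y = Z - {x u}"
    have Y: "Y \<subseteq> V - {t}" "Y \<noteq> {}" using False Z V' by (auto simp: Y_def)
    have YV': "Y \<subseteq> V'" using Z(1) by (auto simp: Y_def)
    let ?A = "cut V' E' Y - {(u, x u)}" and ?B = "(\<lambda>w. (x u, x w)) ` (W - {u})"
    have xY: "x w \<notin> Y" if "w \<in> W" for w using Y(1) fresh that by auto
    have xZ: "x w \<notin> Z" if "w \<in> W" "w \<noteq> u" for w
      using Z that inj by (auto simp: inj_on_def set_eq_iff)
    have "?A \<subseteq> cut V' E' Z"
    proof
      fix p assume "p \<in> ?A"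
      then obtain a b where p: "p = (a,b)" "a \<in> Y" "b \<in> V' - Y" "{a,b} \<in> E'" "p \<noteq> (u, x u)" by (auto simp: cut_def)
      have "b \<noteq> x u"
      proof
        assume b: "b = x u"
        then have "a \<in> nb E' (x u)" using p by (simp add: in_nb insert_commute)
        then have "a = u \<or> a \<in> x ` W" unfolding nb_new[OF Z(2)] by auto
        then show False using p b xY by auto
      qed
      then show "p \<in> cut V' E' Z" using p by (auto simp: cut_def Y_def)
    qed
    moreover have "?B \<subseteq> cut V' E' Z"
    proof
      fix p assume "p \<in> ?B"
      then obtain w where w: "w \<in> W" "w \<noteq> u" "p = (x u, x w)" by auto
      have "x w \<in> nb E' (x u)" using nb_new[OF Z(2)] w by auto
      then show "p \<in> cut V' E' Z" using w Z V' xZ[OF w(1,2)] by (auto simp: cut_def in_nb)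
    qed
    moreover have "?A \<inter> ?B = {}" using xY[OF Z(2)] by (auto simp: cut_def)
    moreover have fA: "finite ?A" using finite_cut[OF finV' YV'] by simp
    moreover have fB: "finite ?B" using finite_W by simp
    ultimately have "card ?A + card ?B \<le> card (cut V' E' Z)"
      using card_mono[OF finite_cut[OF finV' Z(1)], of "?A \<union> ?B"] card_Un_disjoint[OF fA fB] by auto
    moreover have "card ?B = 2" using inj Z(2) card_nb finite_W
      by (subst card_image) (auto simp: inj_on_def)
    moreover have "card ?A \<ge> card (cut V' E' Y) - 1"
      by (metis card_Diff_insert card_Diff_singleton_if diff_le_self le_refl)
    ultimately show ?thesis using none[OF Y] by linarith
  qed
  have Wx: "card (x ` W) = 3" using card_image[OF inj] card_nb by simp
  have fx: "finite (x ` W)" using finite_W by simp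
  have sub: "Y \<subseteq> V - {t}" if "Y \<subseteq> V'" "Y \<inter> x ` W = {}" for Y using that V' by auto
  consider "X \<inter> x ` W = {}" | "x ` W \<subseteq> X" | "card (X \<inter> x ` W) = 1" | "card (x ` W - X) = 1"
  proof -
    have "card (X \<inter> x ` W) + card (x ` W - X) = 3"
      using card_Int_Diff[OF fx, of X] Wx by (simp add: Int_commute)
    moreover have "card (X \<inter> x ` W) = 0 \<longleftrightarrow> X \<inter> x ` W = {}" using fx by simp
    moreover have "card (x ` W - X) = 0 \<longleftrightarrow> x ` W \<subseteq> X" using fx by auto
    ultimately have "X \<inter> x ` W = {} \<or> x ` W \<subseteq> X \<or> card (X \<inter> x ` W) = 1 \<or> card (x ` W - X) = 1" by linarith
    then show thesis using that by blast
  qed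
  then show "3 \<le> card (cut V' E' X)"
  proof cases
    case 1 then show ?thesis using none[OF sub[OF X(1)]] X by blast
  next
    case 2
    have "V' - X \<subseteq> V - {t}" using 2 V' by auto
    then show ?thesis using none[of "V' - X"] X card_cut_Diff[OF X(1), of E'] by auto
  next
    case 3
    then obtain y where y: "X \<inter> x ` W = {y}" by (auto simp: card_1_singleton_iff)
    then have "y \<in> x ` W" by blast
    then obtain u where "u \<in> W" "y = x u" by blast
    then show ?thesis using one[OF X(1)] y by simp
  next
    case 4
    then obtain y where y: "x ` W - X = {y}" by (auto simp: card_1_singleton_iff)
    then have "y \<in> x ` W" by blast
    then obtain u where u: "u \<in> W" "y = x u" by blast
    have "(V' - X) \<inter> x ` W = x ` W - X" using V' by auto
    then show ?thesis using one[of "V' - X" u] y u card_cut_Diff[OF X(1), of E'] by simp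
  qed
qed

end

section \<open>Klee graphs\<close>

lemma connected_graph_edge:
  assumes "connected_graph V E" "A \<subseteq> V" "A \<noteq> {}" "A \<noteq> V"
  obtains a b where "a \<in> A" "b \<in> V - A" "{a,b} \<in> E"
proof -
  obtain u v where uv: "u \<in> A" "v \<in> V - A" using assms by blast
  have "(u,v) \<in> (adj_rel V E)\<^sup>*" using assms(1,2) uv by (auto simp: connected_graph_def)
  then have "v \<in> A \<or> (\<exists>a\<in>A. \<exists>b\<in>V - A. {a,b} \<in> E)"
  proof (induction rule: rtrancl_induct)
    case base then show ?case using uv by simp
  next
    case (step y z)
    then show ?case by (auto simp: adj_rel_def)
  qed
  then show ?thesis using uv that by blast
qed

lemma connected_graphI:
  assumes "\<And>A. A \<subseteq> V \<Longrightarrow> A \<noteq> {} \<Longrightarrow> A \<noteq> V \<Longrightarrow> \<exists>a\<in>A. \<exists>b\<in>V - A. {a,b} \<in> E"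
  shows "connected_graph V E"
  unfolding connected_graph_def
proof (intro ballI)
  fix u v assume uv: "u \<in> V" "v \<in> V"
  let ?A = "{y\<in>V. (u,y) \<in> (adj_rel V E)\<^sup>*}"
  have "?A = V"
  proof (rule ccontr)
    assume "?A \<noteq> V"
    then obtain a b where "a \<in> ?A" "b \<in> V - ?A" "{a,b} \<in> E" using assms[of ?A] uv by auto
    then have "(u,a) \<in> (adj_rel V E)\<^sup>*" "(a,b) \<in> adj_rel V E" "b \<notin> ?A" "b \<in> V" by (auto simp: adj_rel_def)
    then show False by (auto intro: rtrancl_into_rtrancl)
  qed
  then show "(u,v) \<in> (adj_rel V E)\<^sup>*" using uv by auto
qed

text \<open>All edges leaving \<open>X\<close> start in \<open>S\<close>, so deleting the at most
  two vertices of \<open>S\<close> separates the nonempty set \<open>X - S\<close> from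
  \<open>V - X\<close>.\<close>

lemma cut_covered_contradiction:
  assumes "three_connected V E" "finite V" "S \<subseteq> X" "X \<subseteq> V" "X \<noteq> V" "S \<noteq> X" "card S \<le> 2"
    "\<And>a b. a \<in> X \<Longrightarrow> b \<in> V - X \<Longrightarrow> {a,b} \<in> E \<Longrightarrow> a \<in> S"
  shows False
proof -
  have "connected_graph (V - S) {e\<in>E. e \<inter> S = {}}"
    using assms by (auto simp: three_connected_def)
  then obtain a b where "a \<in> X - S" "b \<in> V - S - (X - S)" "{a,b} \<in> {e\<in>E. e \<inter> S = {}}"
    by (rule connected_graph_edge[of _ _ "X - S"]) (use assms in auto)
  then show False using assms(8)[of a b] by auto
qed

text \<open>The ends of at most two cut edges on one side would separate the graph unless they
  exhaust that side. Applied to both sides this leaves two vertices each, so the graph is K4, whose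
  cut between two pairs has four edges.\<close>

lemma three_connected_imp_three_edge_connected:
  assumes cub: "cubic_graph V E" and c3: "three_connected V E"
  shows "three_edge_connected V E"
  unfolding three_edge_connected_def
proof (intro allI impI, rule ccontr)
  fix X assume X: "X \<subseteq> V" "X \<noteq> {}" "X \<noteq> V" "\<not> 3 \<le> card (cut V E X)"
  have sg: "simple_graph V E" using cub by (simp add: cubic_graph_def)
  then have fin: "finite V" by (simp add: simple_graph_def)
  have finc: "finite (cut V E X)" using finite_cut[OF fin X(1)] .
  have S: "fst ` cut V E X = X"
  proof (rule ccontr)
    assume "fst ` cut V E X \<noteq> X"
    then show False
      by (intro cut_covered_contradiction[OF c3 fin _ X(1,3), of "fst ` cut V E X"])
        (use X(4) card_image_le[OF finc, of fst] in \<open>auto simp: cut_def image_iff\<close>)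
  qed
  have S': "snd ` cut V E X = V - X"
  proof (rule ccontr)
    assume "snd ` cut V E X \<noteq> V - X"
    then show False
      by (intro cut_covered_contradiction[OF c3 fin _ _ _, of "snd ` cut V E X" "V - X"])
        (use X card_image_le[OF finc, of snd] in \<open>auto simp: cut_def image_iff insert_commute\<close>)
  qed
  have "card X \<le> 2" "card (V - X) \<le> 2"
    using card_image_le[OF finc, of fst] card_image_le[OF finc, of snd] X(4) S S' by auto
  moreover have finX: "finite X" using X(1) fin finite_subset by blast
  moreover have V4: "4 \<le> card V" using c3 by (simp add: three_connected_def)
  moreover have "card V = card X + card (V - X)"
    using card_Un_disjoint[of X "V - X"] finX fin X(1) by (simp add: Un_absorb1)
  ultimately have card2: "card X = 2" "card (V - X) = 2" "card V = 4" by auto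
  have "nb E a = V - {a}" if "a \<in> V" for a
  proof (rule card_subset_eq)
    show "card (nb E a) = card (V - {a})"
      using cub that card2 fin degree_eq_card_nb[OF sg] by (simp add: cubic_graph_def)
  qed (use nb_subset[OF sg] fin in auto)
  then have "X \<times> (V - X) \<subseteq> cut V E X" using X(1) by (auto simp: cut_def nb_def set_eq_iff)
  then have "card (X \<times> (V - X)) \<le> card (cut V E X)" using finc card_mono by blast
  then show False using card2 X(4) by (simp add: card_cartesian_product)
qed

text \<open>For a separating pair \<open>{s,s'}\<close> the degree count is tight: \<open>s\<close>
  and \<open>s'\<close> are not adjacent and send three edges in total to each of \<open>A\<close>
  and \<open>B\<close>. With \<open>k\<close> edges from \<open>s\<close> to \<open>A\<close>, the
  cuts of \<open>insert s A\<close> and \<open>insert s' A\<close> have sizes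
  \<open>6 - 2 * k\<close> and \<open>2 * k\<close>, and one of these even numbers is below
  three.\<close>

lemma three_edge_connected_imp_three_connected:
  assumes cub: "cubic_graph V E" and c3: "three_edge_connected V E" and c4: "4 \<le> card V"
  shows "three_connected V E"
  unfolding three_connected_def
proof (intro conjI allI impI c4)
  fix S assume S: "S \<subseteq> V \<and> card S \<le> 2"
  have sg: "simple_graph V E" using cub by (simp add: cubic_graph_def)
  then have fin: "finite V" by (simp add: simple_graph_def)
  have nbf: "finite (nb E s)" for s using finite_subset[OF nb_subset[OF sg]] fin by simp
  show "connected_graph (V - S) {e\<in>E. e \<inter> S = {}}"
  proof (rule connected_graphI, rule ccontr)
    fix A assume A: "A \<subseteq> V - S" "A \<noteq> {}" "A \<noteq> V - S"
      and no: "\<not> (\<exists>a\<in>A. \<exists>b\<in>V - S - A. {a,b} \<in> {e\<in>E. e \<inter> S = {}})"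
    define B where "B = V - S - A"
    have B: "B \<subseteq> V - S" "B \<noteq> {}" "A \<inter> B = {}" using A by (auto simp: B_def)
    have noAB: "{a,b} \<notin> E" "{b,a} \<notin> E" if "a \<in> A" "b \<in> B" for a b
      using no that A(1) by (auto simp: B_def insert_commute)
    let ?d = "\<lambda>C s. card (nb E s \<inter> C)"
    have deg: "?d A s + ?d B s + ?d (S - {s}) s = 3" if "s \<in> S" for s
    proof -
      have "nb E s = (nb E s \<inter> A) \<union> (nb E s \<inter> B) \<union> (nb E s \<inter> (S - {s}))"
        using nb_subset[OF sg, of s] A(1) by (auto simp: B_def)
      moreover have "card ((nb E s \<inter> A) \<union> (nb E s \<inter> B) \<union> (nb E s \<inter> (S - {s}))) = ?d A s + ?d B s + ?d (S - {s}) s"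
      proof -
        have "card ((nb E s \<inter> A) \<union> (nb E s \<inter> B)) = ?d A s + ?d B s"
          using nbf[of s] B(3) by (intro card_Un_disjoint) auto
        moreover have "card ((nb E s \<inter> A) \<union> (nb E s \<inter> B) \<union> (nb E s \<inter> (S - {s}))) =
            card ((nb E s \<inter> A) \<union> (nb E s \<inter> B)) + ?d (S - {s}) s"
          using nbf[of s] A(1) B(1) by (intro card_Un_disjoint) auto
        ultimately show ?thesis by simp
      qed
      moreover have "card (nb E s) = 3" using cub that S degree_eq_card_nb[OF sg] by (auto simp: cubic_graph_def)
      ultimately show ?thesis by simp
    qed
    have side: "3 \<le> (\<Sum>s\<in>S. ?d C s)"
      if C: "C \<subseteq> V - S" "C \<noteq> {}" and C': "\<And>a b. a \<in> C \<Longrightarrow> b \<in> V - S - C \<Longrightarrow> {a,b} \<notin> E" and ne: "V - C \<noteq> {}" for C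
    proof -
      have "C \<noteq> V" using ne by auto
      then have "3 \<le> card (cut V E C)" using c3 C unfolding three_edge_connected_def by auto
      moreover have "cut V E C \<subseteq> (\<Union>s\<in>S. (\<lambda>a. (a,s)) ` (nb E s \<inter> C))"
      proof
        fix p assume "p \<in> cut V E C"
        then obtain a b where p: "p = (a,b)" "a \<in> C" "b \<in> V - C" "{a,b} \<in> E" by (auto simp: cut_def)
        then have "b \<in> S" using C'[of a b] by auto
        moreover have "a \<in> nb E b" using p by (simp add: in_nb insert_commute)
        ultimately show "p \<in> (\<Union>s\<in>S. (\<lambda>a. (a,s)) ` (nb E s \<inter> C))" using p by auto
      qed
      moreover have fS: "finite S" using S fin finite_subset by blast
      moreover have "card (\<Union>s\<in>S. (\<lambda>a. (a,s)) ` (nb E s \<inter> C)) \<le> (\<Sum>s\<in>S. card ((\<lambda>a. (a,s)) ` (nb E s \<inter> C)))"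
        using fS by (rule card_UN_le)
      moreover have "finite (\<Union>s\<in>S. (\<lambda>a. (a,s)) ` (nb E s \<inter> C))" using fS nbf by auto
      moreover have "card ((\<lambda>a. (a,s)) ` (nb E s \<inter> C)) = ?d C s" for s by (simp add: card_image inj_on_def)
      ultimately show ?thesis using card_mono by (metis (no_types, lifting) order_trans sum.cong)
    qed
    have sA: "3 \<le> (\<Sum>s\<in>S. ?d A s)" by (rule side[OF A(1,2)]) (use noAB(1) B in \<open>auto simp: B_def\<close>)
    have sB: "3 \<le> (\<Sum>s\<in>S. ?d B s)" by (rule side[OF B(1,2)]) (use noAB(2) A in \<open>auto simp: B_def\<close>)
    have mixed: "3 \<le> ?d A s' + ?d B s + ?d {s'} s" if ss: "S = {s,s'}" "s \<noteq> s'" for s s'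
    proof -
      let ?P = "(\<lambda>a. (a,s')) ` (nb E s' \<inter> A)" and ?Q = "(\<lambda>b. (s,b)) ` (nb E s \<inter> B)" and ?R = "(\<lambda>c. (s,c)) ` (nb E s \<inter> {s'})"
      have sub: "insert s A \<subseteq> V" using A ss S by auto
      obtain b where "b \<in> B" using B by auto
      then have "b \<in> V" "b \<notin> insert s A" using B ss by auto
      then have "insert s A \<noteq> V" by blast
      then have "3 \<le> card (cut V E (insert s A))" using c3 sub unfolding three_edge_connected_def by simp
      also have "cut V E (insert s A) \<subseteq> ?P \<union> ?Q \<union> ?R"
      proof
        fix p assume "p \<in> cut V E (insert s A)"
        then obtain a b where p: "p = (a,b)" "a = s \<or> a \<in> A" "b \<in> V" "b \<noteq> s" "b \<notin> A" "{a,b} \<in> E" by (auto simp: cut_def)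
        then have "b \<in> B \<or> b = s'" using ss by (auto simp: B_def)
        then show "p \<in> ?P \<union> ?Q \<union> ?R" using p noAB(1) by (auto simp: nb_def insert_commute)
      qed
      then have "card (cut V E (insert s A)) \<le> card (?P \<union> ?Q \<union> ?R)" using nbf by (intro card_mono) auto
      also have "\<dots> \<le> card ?P + card ?Q + card ?R" using card_Un_le[of "?P \<union> ?Q" ?R] card_Un_le[of ?P ?Q] by linarith
      also have "\<dots> = ?d A s' + ?d B s + ?d {s'} s" by (simp add: card_image inj_on_def)
      finally show ?thesis .
    qed
    have fS: "finite S" using S fin finite_subset by blast
    consider "card S = 0" | "card S = 1" | "card S = 2" using S by linarith
    then show False
    proof cases
      case 1
      then show ?thesis using sA fS by simp
    next
      case 2
      then obtain s where "S = {s}" by (auto simp: card_1_singleton_iff)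
      then show ?thesis using sA sB deg[of s] by simp
    next
      case 3
      then obtain s s' where ss: "S = {s,s'}" "s \<noteq> s'" by (auto simp: card_2_iff)
      have d: "S - {s} = {s'}" "S - {s'} = {s}" using ss by auto
      have "3 \<le> ?d A s + ?d A s'" "3 \<le> ?d B s + ?d B s'" using sA sB ss by auto
      moreover have "?d A s + ?d B s + ?d {s'} s = 3" "?d A s' + ?d B s' + ?d {s} s' = 3"
        using deg[of s] deg[of s'] d ss(1) by auto
      moreover have "3 \<le> ?d A s' + ?d B s + ?d {s'} s" "3 \<le> ?d A s + ?d B s' + ?d {s} s'"
        using mixed[OF ss] mixed[of s' s] ss by (auto simp: insert_commute)
      ultimately show ?thesis by presburger
    qed
  qed
qed

lemma cubic_card4_complete:
  assumes "cubic_graph V E" "card V = 4"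
  shows "E = {e. e \<subseteq> V \<and> card e = 2}"
proof -
  have sg: "simple_graph V E" using assms by (simp add: cubic_graph_def)
  then have fin: "finite V" by (simp add: simple_graph_def)
  have nb: "nb E a = V - {a}" if "a \<in> V" for a
  proof (rule card_subset_eq)
    show "card (nb E a) = card (V - {a})"
      using assms that fin degree_eq_card_nb[OF sg] by (simp add: cubic_graph_def)
  qed (use nb_subset[OF sg] fin in auto)
  show ?thesis
  proof (intro equalityI subsetI)
    fix e assume "e \<in> {e. e \<subseteq> V \<and> card e = 2}"
    then obtain a b where "e = {a,b}" "a \<noteq> b" "a \<in> V" "b \<in> V" by (auto simp: card_2_iff)
    then have "b \<in> nb E a" using nb by simp
    then show "e \<in> E" using \<open>e = {a,b}\<close> by (simp add: in_nb)
  qed (use sg in \<open>auto simp: simple_graph_def\<close>)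
qed

inductive klee :: "'a set \<Rightarrow> 'a set set \<Rightarrow> bool" where
  K4: "card V = 4 \<Longrightarrow> klee V {e. e \<subseteq> V \<and> card e = 2}"
| expand: "klee V E \<Longrightarrow> expansion V E t x V' E' \<Longrightarrow> klee V' E'"

text \<open>Here \<open>g s\<close> is the neighbour of \<open>s\<close> outside the triangle and
  its inverse \<open>h\<close> becomes the map of the expansion, while \<open>x\<close> is kept as
  the contracted vertex. Contraction must not produce parallel edges, which amounts to injectivity
  of \<open>g\<close>.\<close>

lemma triangle_contraction:
  assumes cub: "cubic_graph V E" and c3: "three_edge_connected V E" and V4: "4 < card V"
    and tri: "x \<noteq> y" "x \<noteq> z" "y \<noteq> z" "{x,y} \<in> E" "{x,z} \<in> E" "{y,z} \<in> E"
  obtains V1 E1 h where "expand V1 E1 x h V E" "h ` nb E1 x = {x,y,z}" "4 \<le> card V1"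
proof -
  have sg: "simple_graph V E" using cub by (simp add: cubic_graph_def)
  then have fin: "finite V" by (simp add: simple_graph_def)
  have nbf: "finite (nb E s)" for s using finite_subset[OF nb_subset[OF sg]] fin by simp
  define T where "T = {x,y,z}"
  have TV: "T \<subseteq> V" using simple_graph_edge_neq[OF sg] tri by (auto simp: T_def)
  have Tadj: "{s,s'} \<in> E" if "s \<in> T" "s' \<in> T" "s \<noteq> s'" for s s'
    using that tri by (auto simp: T_def insert_commute)
  have card_nb: "card (nb E s) = 3" if "s \<in> V" for s
    using cub that degree_eq_card_nb[OF sg] by (simp add: cubic_graph_def)
  have T3: "card T = 3" "finite T" using tri by (auto simp: T_def)
  have outer: "\<exists>w. nb E s - T = {w}" if s: "s \<in> T" for s
  proof -
    have "T - {s} \<subseteq> nb E s" by (auto simp: in_nb intro: Tadj[OF s])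
    moreover have "nb E s \<inter> T \<subseteq> T - {s}" using nb_subset[OF sg, of s] by auto
    ultimately have "nb E s \<inter> T = T - {s}" by auto
    then have "card (nb E s \<inter> T) = 2" using s T3 by simp
    then have "card (nb E s - T) = 1" using card_nb[of s] s TV card_Int_Diff[OF nbf, of s T] by auto
    then show ?thesis by (simp add: card_1_singleton_iff)
  qed
  define g where "g s = (THE w. nb E s - T = {w})" for s
  have g: "nb E s - T = {g s}" if "s \<in> T" for s
    using outer[OF that] unfolding g_def by (metis (mono_tags, lifting) singleton_inject the_equality)
  have gE: "{s, g s} \<in> E" "g s \<notin> T" "g s \<in> V" if "s \<in> T" for s
    using g[OF that] nb_subset[OF sg, of s] by (auto simp: in_nb)
  have g_only: "w = g s" if "s \<in> T" "{s,w} \<in> E" "w \<notin> T" for s w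
    using g[OF that(1)] that by (auto simp: nb_def)
  \<comment> \<open>If two triangle vertices shared their outer neighbour, only the third edge at
    that neighbour and the outer edge of the remaining triangle vertex could leave these four
    vertices; \<open>4 < card V\<close> makes them a proper subset.\<close>
  have inj_g: "inj_on g T"
  proof (rule inj_onI, rule ccontr)
    fix s s' assume ss: "s \<in> T" "s' \<in> T" "g s = g s'" "s \<noteq> s'"
    let ?w = "g s" and ?X = "insert (g s) T"
    have "card (T - {s,s'}) = 1" using T3 ss by (simp add: card_Diff_subset)
    then obtain r where r: "T - {s,s'} = {r}" by (auto simp: card_1_singleton_iff)
    have X: "?X \<subseteq> V" "?X \<noteq> {}" using TV gE(3)[OF ss(1)] by auto
    have "card ?X = 4" using T3 gE(2)[OF ss(1)] by simp
    then have "?X \<noteq> V" using V4 by auto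
    then have "3 \<le> card (cut V E ?X)" using c3 X unfolding three_edge_connected_def by simp
    moreover have "cut V E ?X \<subseteq> insert (r, g r) ((\<lambda>a. (?w,a)) ` (nb E ?w - {s,s'}))"
    proof
      fix p assume "p \<in> cut V E ?X"
      then obtain a b where p: "p = (a,b)" "a \<in> ?X" "b \<in> V - ?X" "{a,b} \<in> E" by (auto simp: cut_def)
      show "p \<in> insert (r, g r) ((\<lambda>a. (?w,a)) ` (nb E ?w - {s,s'}))"
      proof (cases "a = ?w")
        case True
        then show ?thesis using p ss by (auto simp: nb_def)
      next
        case False
        then have a: "a \<in> T" using p by auto
        then have b: "b = g a" using g_only p by auto
        then have "a \<noteq> s" "a \<noteq> s'" using p ss by auto
        then have "a = r" using a r by blast
        then show ?thesis using p b by simp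
      qed
    qed
    moreover have "card (insert (r, g r) ((\<lambda>a. (?w,a)) ` (nb E ?w - {s,s'}))) \<le> 2"
    proof -
      have "s \<in> nb E ?w" "s' \<in> nb E ?w" using gE(1)[OF ss(1)] gE(1)[OF ss(2)] ss(3) by (auto simp: nb_def insert_commute)
      then have "card (nb E ?w - {s,s'}) = 1" using card_nb[OF gE(3)[OF ss(1)]] ss(4) by (simp add: card_Diff_subset)
      then have "card ((\<lambda>a. (?w,a)) ` (nb E ?w - {s,s'})) = 1" by (simp add: card_image inj_on_def)
      then show ?thesis by (simp add: card_insert_le_m1)
    qed
    moreover have "finite (insert (r, g r) ((\<lambda>a. (?w,a)) ` (nb E ?w - {s,s'})))" using nbf by simp
    ultimately have "3 \<le> card (insert (r, g r) ((\<lambda>a. (?w,a)) ` (nb E ?w - {s,s'})))"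
      using card_mono order_trans by blast
    then show False using \<open>card (insert (r, g r) ((\<lambda>a. (?w,a)) ` (nb E ?w - {s,s'}))) \<le> 2\<close> by simp
  qed
  define V1 where "V1 = V - T \<union> {x}"
  define E1 where "E1 = {e\<in>E. e \<inter> T = {}} \<union> (\<lambda>s. {x, g s}) ` T"
  define h where "h = inv_into T g"
  have xT: "x \<in> T" by (simp add: T_def)
  have hg: "h (g s) = s" if "s \<in> T" for s using inj_g that by (simp add: h_def)
  have gx: "g s \<noteq> x" if "s \<in> T" for s using gE(2)[OF that] xT by auto
  have nb1: "nb E1 x = g ` T"
    using xT gx by (auto simp: nb_def E1_def doubleton_eq_iff)
  have sg1: "simple_graph V1 E1"
    unfolding simple_graph_def
  proof (intro conjI ballI)
    show "finite V1" using fin by (simp add: V1_def)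
    fix e assume "e \<in> E1"
    then consider "e \<in> E" "e \<inter> T = {}" | s where "s \<in> T" "e = {x, g s}" by (auto simp: E1_def)
    then show "e \<subseteq> V1" "card e = 2"
    proof (atomize (full), cases)
      case 1 then show "e \<subseteq> V1 \<and> card e = 2" using sg by (auto simp: simple_graph_def V1_def)
    next
      case 2 then show "e \<subseteq> V1 \<and> card e = 2" using gE(2,3)[of s] gx[of s] by (auto simp: V1_def)
    qed
  qed
  have hT: "h ` nb E1 x = T" unfolding nb1 using hg by (auto simp: image_iff)
  have "expansion V1 E1 x h V E"
    unfolding expansion_def
  proof (intro conjI)
    show "x \<in> V1" by (simp add: V1_def)
    show "inj_on h (nb E1 x)" unfolding nb1 h_def by (rule inj_on_inv_into) simp
    show "h ` nb E1 x \<inter> (V1 - {x}) = {}" unfolding hT by (auto simp: V1_def)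
    show "V = V1 - {x} \<union> h ` nb E1 x" unfolding hT using TV xT by (auto simp: V1_def)
    have old: "{e \<in> E1. x \<notin> e} = {e\<in>E. e \<inter> T = {}}" using xT by (auto simp: E1_def)
    have new: "(\<lambda>w. {h w, w}) ` nb E1 x = (\<lambda>s. {s, g s}) ` T"
      unfolding nb1 image_image using hg by (intro image_cong) auto
    have h_minus: "h ` (g ` T - {g s}) = T - {s}" if "s \<in> T" for s
    proof -
      have "g ` T - {g s} = g ` (T - {s})" using inj_on_image_set_diff[OF inj_g, of T "{s}"] that by simp
      then show ?thesis using hg by (auto simp: image_iff)
    qed
    have opp: "(\<lambda>w. h ` (nb E1 x - {w})) ` nb E1 x = (\<lambda>s. T - {s}) ` T"
      unfolding nb1 image_image using h_minus by (intro image_cong) auto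
    have pairs: "(\<lambda>s. T - {s}) ` T = {{y,z},{x,z},{x,y}}" using tri by (auto simp: T_def)
    show "E = {e \<in> E1. x \<notin> e} \<union> (\<lambda>w. {h w, w}) ` nb E1 x \<union> (\<lambda>w. h ` (nb E1 x - {w})) ` nb E1 x"
      unfolding old new opp
    proof (intro equalityI subsetI)
      fix e assume e: "e \<in> E"
      show "e \<in> {e\<in>E. e \<inter> T = {}} \<union> (\<lambda>s. {s, g s}) ` T \<union> (\<lambda>s. T - {s}) ` T"
      proof (cases "e \<inter> T = {}")
        case False
        then obtain s where s: "s \<in> e" "s \<in> T" by auto
        obtain a b where "e = {a,b}" "a \<noteq> b" by (rule simple_graph_edge[OF sg e])
        then obtain w where w: "e = {s,w}" "w \<noteq> s" using s by auto
        show ?thesis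
        proof (cases "w \<in> T")
          case True
          then have "e \<in> {{y,z},{x,z},{x,y}}" using w s by (auto simp: T_def)
          then show ?thesis unfolding pairs by blast
        next
          case False
          then have "w = g s" using g_only[OF s(2)] e w by simp
          then show ?thesis using w s by auto
        qed
      qed (use e in auto)
    next
      fix e assume "e \<in> {e\<in>E. e \<inter> T = {}} \<union> (\<lambda>s. {s, g s}) ` T \<union> (\<lambda>s. T - {s}) ` T"
      then show "e \<in> E" unfolding pairs using gE(1) tri by auto
    qed
  qed
  moreover have "card (nb E1 x) = 3" unfolding nb1 using card_image[OF inj_g] T3 by simp
  ultimately have ex: "expand V1 E1 x h V E" using sg1 by (simp add: expand_def)
  have "insert x (nb E1 x) \<subseteq> V1" using nb_subset[OF sg1, of x] by (auto simp: V1_def)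
  moreover have "finite V1" using fin by (simp add: V1_def)
  moreover have "card (insert x (nb E1 x)) = 4"
    using \<open>card (nb E1 x) = 3\<close> nb_subset[OF sg1, of x] card.infinite[of "nb E1 x"] by (subst card_insert_disjoint) (auto intro: ccontr)
  ultimately have "4 \<le> card V1" by (metis card_mono)
  then show ?thesis using that[OF ex] hT by (simp add: T_def)
qed

text \<open>The triangle is chosen with \<open>{y,z}\<close> in \<open>M\<close>. So
  \<open>M\<close> uses a triangle edge and is the lift of a perfect matching, not of a star
  matching; this is what keeps a lonely edge in the contracted graph, whether \<open>e\<close> is a
  transported edge or a triangle edge.\<close>

lemma lonely_imp_klee:
  assumes "cubic_graph V E" "three_edge_connected V E" "4 \<le> card V" "lonely_edge V E e"
  shows "klee V E"
  using assms
proof (induction "card V" arbitrary: V E e rule: less_induct)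
  case less
  note cub = less.prems(1) and c3 = less.prems(2) and V4 = less.prems(3)
  have sg: "simple_graph V E" using cub by (simp add: cubic_graph_def)
  show ?case
  proof (cases "card V = 4")
    case True
    then show ?thesis using cubic_card4_complete[OF cub] klee.K4 by metis
  next
    case False
    have "\<exists>!M. perfect_matching V E M \<and> e \<in> M" using less.prems(4) by (simp add: lonely_edge_iff)
    then obtain M where M: "perfect_matching V E M" "e \<in> M"
      and uniq: "\<And>N. perfect_matching V E N \<Longrightarrow> e \<in> N \<Longrightarrow> N = M" by (elim ex1E) metis
    obtain x y z where tri: "x \<noteq> y" "x \<noteq> z" "{x,y} \<in> E" "{x,z} \<in> E" "{y,z} \<in> M"
      by (rule lonely_triangle[OF cub c3 V4 M uniq])
    have yzE: "{y,z} \<in> E" using tri(5) M(1) by (auto simp: perfect_matching_def)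
    have "y \<noteq> z" using simple_graph_edge_neq[OF sg yzE] by simp
    obtain V1 E1 h where ex: "expand V1 E1 x h V E" and h: "h ` nb E1 x = {x,y,z}" and V1: "4 \<le> card V1"
      using triangle_contraction[OF cub c3 _ tri(1,2) \<open>y \<noteq> z\<close> tri(3,4) yzE] False V4 by (metis le_neq_implies_less)
    interpret expand V1 E1 x h V E by (fact ex)
    have "x \<in> h ` nb E1 x" using h by simp
    then obtain w0 where w0: "w0 \<in> nb E1 x" "h w0 = x" by auto
    have "opp w0 = {x,y,z} - {x}"
    proof -
      have "opp w0 = h ` nb E1 x - h ` {w0}"
        unfolding opp_def using inj w0 by (subst inj_on_image_set_diff[OF inj]) auto
      then show ?thesis using h w0 by simp
    qed
    then have yz: "{y,z} = opp w0" using tri by auto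
    have lonely1: "\<exists>f. lonely_edge V1 E1 f"
      using M(1)
    proof (rule matching_cases)
      fix N assume "star_matching V1 E1 x N" "M = lift N"
      then show ?thesis using opp_notin_lift_star w0 yz tri(5) by metis
    next
      fix M0 assume M0: "perfect_matching V1 E1 M0" "M = lift M0"
      have "e \<in> E" using M by (auto simp: perfect_matching_def)
      then consider f where "f \<in> E1" "e = \<phi> f" | w where "w \<in> nb E1 x" "e = opp w" using E' by auto
      then show ?thesis
      proof cases
        case 1
        have f: "f \<in> M0" using \<phi>_in_lift[OF _ 1(1), of M0] M0 M(2) 1(2) by (auto simp: perfect_matching_def)
        have only: "N = M0" if N: "perfect_matching V1 E1 N" "f \<in> N" for N
        proof (rule inj_lift)
          show "N \<subseteq> E1" "M0 \<subseteq> E1" using N M0 by (auto simp: perfect_matching_def)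
          have "e \<in> lift N" using \<phi>_in_lift[OF \<open>N \<subseteq> E1\<close> 1(1)] N(2) 1(2) by simp
          then show "lift N = lift M0" using uniq[OF perfect_lift[OF N(1)]] M0(2) by simp
        qed
        have "\<exists>!N. perfect_matching V1 E1 N \<and> f \<in> N"
        proof (rule ex1I[of _ M0])
          show "perfect_matching V1 E1 M0 \<and> f \<in> M0" using f M0(1) by simp
          show "N = M0" if "perfect_matching V1 E1 N \<and> f \<in> N" for N using only[of N] that by simp
        qed
        then have "lonely_edge V1 E1 f" using 1(1) by (simp add: lonely_edge_iff)
        then show ?thesis ..
      next
        case 2
        then show ?thesis using lonely_opp_iff less.prems(4) by blast
      qed
    qed
    then obtain f where f: "lonely_edge V1 E1 f" ..
    have "klee V1 E1"
      by (rule less.hyps[OF _ _ _ V1 f]) (use card_V' cubic_iff cub three_edge_connected_contract[OF c3] in auto)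
    then show ?thesis by (rule klee.expand[OF _ expn])
  qed
qed

lemma in_U_imp_klee: "in_U V E \<Longrightarrow> klee V E"
proof -
  assume U: "in_U V E"
  then have "{e\<in>E. lonely_edge V E e} \<noteq> {}" unfolding in_U_def num_lonely_def by (metis card.empty not_one_le_zero)
  then obtain e where "lonely_edge V E e" by blast
  then show ?thesis using U three_connected_imp_three_edge_connected
    by (intro lonely_imp_klee) (auto simp: in_U_def three_connected_def)
qed

section \<open>Perfect and star matchings in Klee graphs\<close>

context expand
begin

text \<open>At \<open>t\<close> a star matching centred elsewhere looks like a perfect matching, so
  \<open>lift\<close> applies unchanged and adds only a triangle edge, which avoids
  \<open>s\<close>.\<close>

lemma star_matching_old:
  assumes N: "star_matching V E s N" and s: "s \<in> V - {t}"
  shows "\<exists>N'. star_matching V' E' s N'"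
proof -
  have NE: "N \<subseteq> E" and N1: "\<And>v. v \<in> V - {s} \<Longrightarrow> \<exists>!e. e \<in> N \<and> v \<in> e" and Ns: "{e\<in>E. s \<in> e} \<subseteq> N"
    using N by (auto simp: star_matching_def)
  have "t \<in> V - {s}" using t s by auto
  then have t1: "\<exists>!e. e \<in> N \<and> t \<in> e" by (rule N1)
  have inc: "\<exists>!e. e \<in> lift N \<and> v \<in> e" if v: "v \<in> V' - {s}" for v
  proof (cases "v \<in> V - {t}")
    case True
    then have "\<exists>!e. e \<in> N \<and> v \<in> e" "v \<in> V" "v \<noteq> t" using N1[of v] v by auto
    then show ?thesis using lift_matching(1)[OF NE _ _ t1, of v] by simp
  next
    case False
    then obtain u where "u \<in> W" "v = x u" using v V' by auto
    then show ?thesis using lift_matching(2)[OF NE t _ t1, of u] by simp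
  qed
  have "e \<in> lift N" if e: "e \<in> E'" "s \<in> e" for e
  proof -
    obtain f where f: "f \<in> E" "e = \<phi> f" using e E' mem_opp_old[OF s] by auto
    then have "s \<in> f" using mem_\<phi>_old[OF f(1) s] e by simp
    then show ?thesis using f Ns \<phi>_in_lift[OF NE f(1)] by auto
  qed
  then have "star_matching V' E' s (lift N)"
    unfolding star_matching_def using inc lift_matching(3)[OF NE t _ t1] by auto
  then show ?thesis by blast
qed

text \<open>The image of a perfect matching through \<open>{t,w}\<close> touches the triangle at
  \<open>x w\<close> only. Adding both triangle edges at \<open>x w\<close> covers the two other
  triangle vertices once and completes the star.\<close>

lemma star_matching_new:
  assumes M: "perfect_matching V E M" and w: "w \<in> W" "{t,w} \<in> M"
  shows "\<exists>N'. star_matching V' E' (x w) N'"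
proof -
  have ME: "M \<subseteq> E" and M1: "\<And>v. v \<in> V \<Longrightarrow> \<exists>!e. e \<in> M \<and> v \<in> e"
    using M by (auto simp: perfect_matching_def)
  let ?Y = "W - {w}"
  let ?N = "\<phi> ` M \<union> opp ` ?Y"
  have tu: "{t,u} \<in> M \<longleftrightarrow> u = w" for u
  proof
    assume "{t,u} \<in> M"
    then have "{t,u} = {t,w}" using M1[OF t] w(2) by (elim ex1E) (metis insertI1)
    then show "u = w" by (auto simp: doubleton_eq_iff)
  qed (use w in simp)
  have "?N \<subseteq> E'" by (rule sub_E'[OF ME]) auto
  moreover have inc: "\<exists>!e. e \<in> ?N \<and> v \<in> e" if v: "v \<in> V' - {x w}" for v
  proof (cases "v \<in> V - {t}")
    case True
    then show ?thesis using ex1_old[OF ME True] M1 by simp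
  next
    case False
    then obtain u where u: "u \<in> W" "v = x u" using v V' by auto
    then have uw: "u \<noteq> w" using v by auto
    have "\<exists>!e. \<exists>y. (y \<in> W \<and> y \<noteq> w \<and> y \<noteq> u) \<and> e = opp y"
    proof (subst ex1_image_iff)
      show "\<exists>!y. y \<in> W \<and> y \<noteq> w \<and> y \<noteq> u" by (rule W_third_unique[OF w(1) u(1) uw[symmetric]])
    qed (use inj_opp in \<open>auto simp: inj_on_def\<close>)
    moreover have "e \<in> ?N \<and> x u \<in> e \<longleftrightarrow> (\<exists>y. (y \<in> W \<and> y \<noteq> w \<and> y \<noteq> u) \<and> e = opp y)" for e
      unfolding new_incidence[OF ME Diff_subset u(1)] tu using uw by auto
    ultimately show ?thesis unfolding u(2) by simp
  qed
  have inN: "e \<in> ?N" if e: "e \<in> E'" "x w \<in> e" for e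
  proof -
    from e(1) consider f where "f \<in> E" "e = \<phi> f" | y where "y \<in> W" "e = opp y" using E' by auto
    then show ?thesis
    proof cases
      case 1
      then have "f = {t,w}" using mem_\<phi>_new[OF 1(1) w(1)] e by simp
      then show ?thesis using 1 w by auto
    next
      case 2
      then have "y \<noteq> w" using mem_opp_new[OF w(1)] e by simp
      then show ?thesis using 2 by auto
    qed
  qed
  have "{e\<in>E'. x w \<in> e} \<subseteq> ?N" using inN by blast
  ultimately have "star_matching V' E' (x w) ?N" unfolding star_matching_def using inc by simp
  then show ?thesis by blast
qed

lemma matching_through_expansion:
  assumes P: "\<And>e. e \<in> E \<Longrightarrow> \<exists>M. perfect_matching V E M \<and> e \<in> M" and e: "e \<in> E'"
  shows "\<exists>M. perfect_matching V' E' M \<and> e \<in> M"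
proof -
  from e consider f where "f \<in> E" "e = \<phi> f" | y where "y \<in> W" "e = opp y" using E' by auto
  then show ?thesis
  proof cases
    case 1
    then obtain M where M: "perfect_matching V E M" "f \<in> M" using P by blast
    then have "\<phi> f \<in> lift M" using \<phi>_in_lift 1 by (auto simp: perfect_matching_def)
    then show ?thesis using perfect_lift[OF M(1)] 1 by blast
  next
    case 2
    then obtain M where M: "perfect_matching V E M" "{t,y} \<in> M" using P[of "{t,y}"] by (auto simp: in_nb)
    then have "opp y \<in> lift M" using opp_in_lift_perfect[OF M(1) 2(1)] by simp
    then show ?thesis using perfect_lift[OF M(1)] 2 by blast
  qed
qed

end

lemma complete4_props:
  assumes V: "card V = 4" and E: "E = {e. e \<subseteq> V \<and> card e = 2}"
  shows "cubic_graph V E \<and> three_edge_connected V E \<and> (\<forall>e\<in>E. \<exists>M. perfect_matching V E M \<and> e \<in> M)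
    \<and> (\<forall>s\<in>V. \<exists>N. star_matching V E s N)"
proof (intro conjI ballI)
  have fin: "finite V" using V card.infinite by fastforce
  have sg: "simple_graph V E" using fin E by (auto simp: simple_graph_def)
  have nb: "nb E v = V - {v}" if "v \<in> V" for v
    using that E by (auto simp: nb_def card_2_iff doubleton_eq_iff)
  show "cubic_graph V E"
    using sg nb V fin degree_eq_card_nb[OF sg] by (simp add: cubic_graph_def)
  show "three_edge_connected V E"
    unfolding three_edge_connected_def
  proof (intro allI impI)
    fix X assume X: "X \<subseteq> V" "X \<noteq> {}" "X \<noteq> V"
    have finX: "finite X" using X fin finite_subset by blast
    have "cut V E X = X \<times> (V - X)"
      using X(1) E by (auto simp: cut_def card_2_iff)
    then have c: "card (cut V E X) = card X * (4 - card X)"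
      using V X(1) finX by (simp add: card_cartesian_product card_Diff_subset)
    have "card X < 4" using psubset_card_mono[OF fin, of X] X V by auto
    moreover have "card X \<noteq> 0" using X(2) finX by simp
    ultimately have "card X = 1 \<or> card X = 2 \<or> card X = 3" by linarith
    then show "3 \<le> card (cut V E X)" unfolding c by auto
  qed
  show "\<exists>M. perfect_matching V E M \<and> e \<in> M" if "e \<in> E" for e
  proof (intro exI[of _ "{e, V - e}"] conjI)
    have e: "e \<subseteq> V" "card e = 2" using that E by auto
    then have "card (V - e) = 2" using V fin by (simp add: card_Diff_subset finite_subset)
    then show "perfect_matching V E {e, V - e}"
      unfolding perfect_matching_def
    proof (intro conjI ballI)
      fix v assume "v \<in> V"
      then have "e' \<in> {e, V - e} \<and> v \<in> e' \<longleftrightarrow> e' = (if v \<in> e then e else V - e)" for e' by auto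
      then show "\<exists>!e'. e' \<in> {e, V - e} \<and> v \<in> e'" by simp
    qed (use e E in auto)
  qed simp
  show "\<exists>N. star_matching V E s N" if s: "s \<in> V" for s
  proof (intro exI[of _ "{e\<in>E. s \<in> e}"])
    have "\<exists>!e. e \<in> {e\<in>E. s \<in> e} \<and> v \<in> e" if v: "v \<in> V - {s}" for v
    proof -
      have "e \<in> {e\<in>E. s \<in> e} \<and> v \<in> e \<longleftrightarrow> e = {s,v}" for e
        using v s E by (auto simp: card_2_iff)
      then show ?thesis by simp
    qed
    then show "star_matching V E s {e\<in>E. s \<in> e}" by (simp add: star_matching_def)
  qed
qed

lemma cubic_expandI:
  assumes "cubic_graph V E" "expansion V E t x V' E'"
  shows "expand V E t x V' E'"
proof -
  have sg: "simple_graph V E" "t \<in> V" using assms by (auto simp: cubic_graph_def expansion_def)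
  then have "card (nb E t) = 3" using assms degree_eq_card_nb[OF sg(1), of t] by (auto simp: cubic_graph_def)
  then show ?thesis using assms sg by (simp add: expand_def)
qed

text \<open>The two matching properties have to be proved together: a star matching at a new vertex
  comes from a perfect matching through the corresponding edge at \<open>t\<close>. They are the
  hypotheses of \<open>lonely_edges_expansion\<close>.\<close>

lemma klee_props:
  assumes "klee V E"
  shows "cubic_graph V E" "three_edge_connected V E" "4 \<le> card V"
    "\<And>e. e \<in> E \<Longrightarrow> \<exists>M. perfect_matching V E M \<and> e \<in> M"
    "\<And>s. s \<in> V \<Longrightarrow> \<exists>N. star_matching V E s N"
proof -
  have "cubic_graph V E \<and> three_edge_connected V E \<and> 4 \<le> card V \<and>
    (\<forall>e\<in>E. \<exists>M. perfect_matching V E M \<and> e \<in> M) \<and> (\<forall>s\<in>V. \<exists>N. star_matching V E s N)"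
    using assms
  proof induction
    case (K4 V)
    then show ?case using complete4_props[OF K4 refl] by auto
  next
    case (expand V E t x V' E')
    note IH = expand.IH
    interpret expand V E t x V' E' by (rule cubic_expandI[OF _ expand.hyps(2)]) (use IH in simp)
    have "\<exists>N. star_matching V' E' s N" if s: "s \<in> V'" for s
    proof (cases "s \<in> V - {t}")
      case True
      then obtain N where "star_matching V E s N" using IH by blast
      then show ?thesis by (rule star_matching_old[OF _ True])
    next
      case False
      then obtain w where w: "w \<in> W" "s = x w" using s V' by auto
      then have "{t,w} \<in> E" by (simp add: in_nb)
      then obtain M where "perfect_matching V E M" "{t,w} \<in> M" using IH by blast
      then show ?thesis using star_matching_new w by blast
    qed
    moreover have "\<exists>M. perfect_matching V' E' M \<and> e \<in> M" if "e \<in> E'" for e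
      using matching_through_expansion that IH by blast
    ultimately show ?case using IH cubic_iff three_edge_connected_expand card_V' by auto
  qed
  then show "cubic_graph V E" "three_edge_connected V E" "4 \<le> card V"
    "\<And>e. e \<in> E \<Longrightarrow> \<exists>M. perfect_matching V E M \<and> e \<in> M"
    "\<And>s. s \<in> V \<Longrightarrow> \<exists>N. star_matching V E s N" by blast+
qed

lemma klee_expand: "klee V E \<Longrightarrow> expansion V E t x V' E' \<Longrightarrow> expand V E t x V' E'"
  by (rule cubic_expandI[OF klee_props(1)])

section \<open>Loss and survival of lonely edges under expansion\<close>

lemma num_lonely_eq: "num_lonely V E = card {e. lonely_edge V E e}"
proof -
  have "{e\<in>E. lonely_edge V E e} = {e. lonely_edge V E e}" by (auto simp: lonely_edge_def)
  then show ?thesis by (simp add: num_lonely_def)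
qed

lemma finite_lonely: "simple_graph V E \<Longrightarrow> finite {e. lonely_edge V E e}"
  by (rule finite_subset[of _ "Pow V"]) (auto simp: lonely_edge_def simple_graph_def)

text \<open>Every edge of \<open>S\<close> lies in a perfect matching and in \<open>N\<close>, so
  after the expansion two matchings pass through it. One known star matching thus bounds the count
  from above.\<close>

lemma num_lonely_expansion_le:
  assumes H: "klee V E" and ex: "expansion V E t x V' E'" and N: "star_matching V E t N"
    and S: "S \<subseteq> N" "\<And>e. e \<in> S \<Longrightarrow> lonely_edge V E e \<and> t \<notin> e"
  shows "num_lonely V' E' + card S \<le> num_lonely V E"
proof -
  interpret expand V E t x V' E' by (rule klee_expand[OF H ex])
  let ?L = "{e. lonely_edge V E e}"
  have fin: "finite ?L" by (rule finite_lonely[OF simple])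
  have "num_lonely V' E' = card {e. lonely_edge V E e \<and> (t \<in> e \<or> (\<forall>N. star_matching V E t N \<longrightarrow> e \<notin> N))}"
    unfolding num_lonely_eq by (rule lonely_edges_expansion(2)) (use klee_props(4,5)[OF H] t in blast)+
  also have "\<dots> \<le> card (?L - S)"
    by (rule card_mono) (use fin N S in auto)
  also have "\<dots> = num_lonely V E - card S"
    unfolding num_lonely_eq using S fin by (intro card_Diff_subset) (auto intro: finite_subset[of S ?L])
  finally have 1: "num_lonely V' E' \<le> num_lonely V E - card S" .
  have "card S \<le> num_lonely V E"
    unfolding num_lonely_eq by (rule card_mono[OF fin]) (use S in auto)
  then show ?thesis using 1 by linarith
qed

lemma num_lonely_expansion_mono:
  assumes "klee V E" "expansion V E t x V' E'"
  shows "num_lonely V' E' \<le> num_lonely V E"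
proof -
  have "t \<in> V" using assms(2) by (simp add: expansion_def)
  then obtain N where "star_matching V E t N" using klee_props(5)[OF assms(1)] by blast
  then show ?thesis using num_lonely_expansion_le[OF assms, of N "{}"] by simp
qed

lemma lonely_old:
  assumes H: "klee V E" and ex: "expansion V E t x V' E'" and e: "lonely_edge V E e" "t \<notin> e"
    and "\<And>N. star_matching V E t N \<Longrightarrow> e \<notin> N"
  shows "lonely_edge V' E' e"
proof -
  interpret expand V E t x V' E' by (rule klee_expand[OF H ex])
  let ?B = "{e. lonely_edge V E e \<and> (t \<in> e \<or> (\<forall>N. star_matching V E t N \<longrightarrow> e \<notin> N))}"
  have "e \<in> (\<lambda>e. if t \<in> e then x ` (W - e) else e) ` ?B" using assms by (intro image_eqI[of _ _ e]) auto
  moreover have "{e. lonely_edge V' E' e} = (\<lambda>e. if t \<in> e then x ` (W - e) else e) ` ?B"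
    by (rule lonely_edges_expansion(1)) (use klee_props(4,5)[OF H] t in blast)+
  ultimately show ?thesis by blast
qed

text \<open>Every star matching at \<open>t\<close> covers the neighbour \<open>w\<close> by
  \<open>{t,w}\<close> and hence contains no other edge at \<open>w\<close>. This local test proves
  survival without knowing the star matchings.\<close>

lemma lonely_old_at_neighbour:
  assumes H: "klee V E" and ex: "expansion V E t x V' E'" and e: "lonely_edge V E e" "t \<notin> e"
    and w: "w \<in> e" "w \<in> nb E t"
  shows "lonely_edge V' E' e"
proof (rule lonely_old[OF H ex e])
  fix N assume N: "star_matching V E t N"
  have sg: "simple_graph V E" using klee_props(1)[OF H] by (simp add: cubic_graph_def)
  have "w \<in> V - {t}" using w(2) nb_subset[OF sg, of t] by blast
  have "{t,w} \<in> N" using N w(2) by (auto simp: star_matching_def in_nb)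
  moreover have "\<exists>!f. f \<in> N \<and> w \<in> f" using N \<open>w \<in> V - {t}\<close> unfolding star_matching_def by simp
  ultimately have "f = {t,w}" if "f \<in> N" "w \<in> f" for f using that by (elim ex1E) (metis insertCI)
  then show "e \<notin> N" using e(2) w(1) by (metis insertI1)
qed

lemma lonely_new:
  assumes H: "klee V E" and ex: "expansion V E t x V' E'" and "lonely_edge V E {t,w}"
  shows "lonely_edge V' E' (x ` (nb E t - {w}))"
proof -
  interpret expand V E t x V' E' by (rule klee_expand[OF H ex])
  have "w \<in> W" using assms(3) by (simp add: lonely_edge_def in_nb)
  then show ?thesis using lonely_opp_iff assms(3) unfolding opp_def by blast
qed

section \<open>Isomorphisms\<close>

text \<open>Unlike in \<open>graph_iso\<close>, the map is explicit, so that the images of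
  particular vertices can be followed through successive expansions, and simplicity is
  included.\<close>

definition iso :: "('a \<Rightarrow> 'b) \<Rightarrow> 'a set \<Rightarrow> 'a set set \<Rightarrow> 'b set \<Rightarrow> 'b set set \<Rightarrow> bool" where
  "iso f V E V' E' \<longleftrightarrow> simple_graph V E \<and> bij_betw f V V' \<and> (\<lambda>e. f ` e) ` E = E'"

lemma iso_comp: "iso f V E V' E' \<Longrightarrow> iso g V' E' V'' E'' \<Longrightarrow> iso (g \<circ> f) V E V'' E''"
  by (auto simp: iso_def image_comp image_image intro: bij_betw_trans)

lemma iso_simple:
  assumes "iso f V E V' E'"
  shows "simple_graph V' E'"
proof -
  have b: "inj_on f V" "f ` V = V'" and E': "E' = (\<lambda>e. f ` e) ` E" and sg: "simple_graph V E"
    using assms by (auto simp: iso_def bij_betw_def)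
  have "card (f ` e) = 2 \<and> f ` e \<subseteq> V'" if "e \<in> E" for e
    using that sg b card_image[OF inj_on_subset[OF b(1)], of e] by (auto simp: simple_graph_def)
  then show ?thesis using sg b E' by (auto simp: simple_graph_def)
qed

lemma iso_inv:
  assumes "iso f V E V' E'"
  shows "iso (inv_into V f) V' E' V E"
proof -
  have b: "bij_betw f V V'" and E': "E' = (\<lambda>e. f ` e) ` E" and sg: "simple_graph V E"
    using assms by (auto simp: iso_def)
  have i: "inv_into V f ` f ` e = e" if "e \<in> E" for e
    using that sg b by (intro inv_into_image_cancel) (auto simp: bij_betw_def simple_graph_def)
  have "(\<lambda>e. inv_into V f ` e) ` E' = (\<lambda>e. e) ` E" unfolding E' image_comp comp_def using i by (intro image_cong) auto
  then have "(\<lambda>e. inv_into V f ` e) ` E' = E" by simp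
  then show ?thesis using iso_simple[OF assms] bij_betw_inv_into[OF b] by (simp add: iso_def)
qed

lemma iso_imp_graph_iso: "iso f V E V' E' \<Longrightarrow> graph_iso V E V' E'"
  by (auto simp: iso_def graph_iso_def simple_graph_def)

lemma graph_iso_imp_iso:
  assumes "graph_iso V E V' E'" "simple_graph V' E'"
  obtains f where "iso f V E V' E'"
proof -
  obtain f where f: "bij_betw f V V'" "(\<lambda>e. f ` e) ` E = E'" and E: "\<forall>e\<in>E. e \<subseteq> V"
    using assms(1) by (auto simp: graph_iso_def)
  have "card e = 2" if "e \<in> E" for e
  proof -
    have "inj_on f e" using f(1) E that by (meson bij_betw_def inj_on_subset)
    then have "card e = card (f ` e)" by (simp add: card_image)
    also have "\<dots> = 2" using assms(2) f(2) that by (auto simp: simple_graph_def)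
    finally show ?thesis .
  qed
  moreover have "finite V" using bij_betw_finite[OF f(1)] assms(2) by (simp add: simple_graph_def)
  ultimately have "iso f V E V' E'" using f E by (simp add: iso_def simple_graph_def)
  then show ?thesis by (rule that)
qed

lemma iso_edge_iff:
  assumes "iso f V E V' E'" "a \<in> V" "b \<in> V"
  shows "{f a, f b} \<in> E' \<longleftrightarrow> {a,b} \<in> E"
proof
  have inj: "inj_on f V" and E': "E' = (\<lambda>e. f ` e) ` E" and sg: "simple_graph V E"
    using assms(1) by (auto simp: iso_def bij_betw_def)
  assume "{f a, f b} \<in> E'"
  then obtain e where e: "e \<in> E" "f ` e = f ` {a,b}" unfolding E' by auto
  have "e = {a,b}" using inj_on_image_eq_iff[OF inj, of e "{a,b}"] e sg assms(2,3) by (auto simp: simple_graph_def)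
  then show "{a,b} \<in> E" using e by simp
next
  assume "{a,b} \<in> E"
  then have "f ` {a,b} \<in> E'" using assms(1) unfolding iso_def by blast
  then show "{f a, f b} \<in> E'" by simp
qed

lemma iso_nb:
  assumes f: "iso f V E V' E'" and v: "v \<in> V"
  shows "nb E' (f v) = f ` nb E v"
proof -
  have b: "f ` V = V'" using f by (auto simp: iso_def bij_betw_def)
  have sg: "simple_graph V E" using f by (simp add: iso_def)
  show ?thesis
  proof (intro equalityI subsetI)
    fix u assume u: "u \<in> nb E' (f v)"
    then have "u \<in> V'" using nb_subset[OF iso_simple[OF f]] by blast
    then obtain a where a: "a \<in> V" "u = f a" using b by auto
    then have "a \<in> nb E v" using u iso_edge_iff[OF f v] by (simp add: in_nb)
    then show "u \<in> f ` nb E v" using a by auto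
  next
    fix u assume "u \<in> f ` nb E v"
    then obtain a where a: "a \<in> nb E v" "u = f a" by auto
    then have "a \<in> V" using nb_subset[OF sg] by blast
    then show "u \<in> nb E' (f v)" using iso_edge_iff[OF f v] a by (simp add: in_nb)
  qed
qed

lemma iso_cubic:
  assumes f: "iso f V E V' E'" and "cubic_graph V E"
  shows "cubic_graph V' E'"
proof -
  have sg: "simple_graph V E" and b: "inj_on f V" "f ` V = V'" using f by (auto simp: iso_def bij_betw_def)
  note sg' = iso_simple[OF f]
  have "card (nb E' (f v)) = 3" if v: "v \<in> V" for v
  proof -
    have "nb E v \<subseteq> V" using nb_subset[OF sg, of v] by blast
    then have "inj_on f (nb E v)" by (rule inj_on_subset[OF b(1)])
    then show ?thesis
      using assms(2) v iso_nb[OF f v] degree_eq_card_nb[OF sg, of v] by (simp add: card_image cubic_graph_def)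
  qed
  then show ?thesis using sg' b(2) degree_eq_card_nb[OF sg'] by (auto simp: cubic_graph_def)
qed

lemma iso_three_edge_connected:
  assumes f: "iso f V E V' E'" and "three_edge_connected V E"
  shows "three_edge_connected V' E'"
  unfolding three_edge_connected_def
proof (intro allI impI)
  have b: "inj_on f V" "f ` V = V'" and sg: "simple_graph V E" using f by (auto simp: iso_def bij_betw_def)
  fix X assume X: "X \<subseteq> V'" "X \<noteq> {}" "X \<noteq> V'"
  define Y where "Y = {v\<in>V. f v \<in> X}"
  have Y: "Y \<subseteq> V" "f ` Y = X" using X(1) b(2) by (auto simp: Y_def)
  then have Y': "Y \<noteq> {}" "Y \<noteq> V" using X b by auto
  have c1: "(\<lambda>(a,b). (f a, f b)) ` cut V E Y \<subseteq> cut V' E' X"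
  proof
    fix p assume "p \<in> (\<lambda>(a,b). (f a, f b)) ` cut V E Y"
    then obtain a c where p: "p = (f a, f c)" "a \<in> Y" "c \<in> V - Y" "{a,c} \<in> E" by (auto simp: cut_def)
    then show "p \<in> cut V' E' X" using iso_edge_iff[OF f, of a c] b(2) by (auto simp: cut_def Y_def)
  qed
  have c2: "inj_on (\<lambda>(a,b). (f a, f b)) (cut V E Y)"
    using b(1) Y(1) by (auto simp: inj_on_def cut_def)
  have c3: "finite (cut V' E' X)" using finite_cut[OF _ X(1)] iso_simple[OF f] by (simp add: simple_graph_def)
  have "card (cut V E Y) \<le> card (cut V' E' X)" by (rule card_inj_on_le[OF c2 c1 c3])
  moreover have "3 \<le> card (cut V E Y)" using assms(2) Y(1) Y' unfolding three_edge_connected_def by simp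
  ultimately show "3 \<le> card (cut V' E' X)" by linarith
qed

lemma iso_perfect_matching:
  assumes f: "iso f V E V' E'" and M: "perfect_matching V E M"
  shows "perfect_matching V' E' ((\<lambda>e. f ` e) ` M)"
  unfolding perfect_matching_def
proof (intro conjI ballI)
  have b: "inj_on f V" "f ` V = V'" and sg: "simple_graph V E" and E': "E' = (\<lambda>e. f ` e) ` E"
    using f by (auto simp: iso_def bij_betw_def)
  have ME: "M \<subseteq> E" using M by (simp add: perfect_matching_def)
  have MV: "e \<subseteq> V" if "e \<in> M" for e using that ME sg by (auto simp: simple_graph_def)
  show "(\<lambda>e. f ` e) ` M \<subseteq> E'" using ME E' by auto
  fix v' assume "v' \<in> V'"
  then obtain v where v: "v \<in> V" "v' = f v" using b by auto
  have m: "v' \<in> f ` e \<longleftrightarrow> v \<in> e" if "e \<in> M" for e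
    using inj_on_image_mem_iff[OF b(1) v(1) MV[OF that]] v(2) by simp
  have "e' \<in> (\<lambda>e. f ` e) ` M \<and> v' \<in> e' \<longleftrightarrow> (\<exists>e. (e \<in> M \<and> v \<in> e) \<and> e' = f ` e)" for e'
  proof
    assume "e' \<in> (\<lambda>e. f ` e) ` M \<and> v' \<in> e'"
    then obtain e where "e \<in> M" "e' = f ` e" "v' \<in> f ` e" by (elim conjE imageE) simp
    then show "\<exists>e. (e \<in> M \<and> v \<in> e) \<and> e' = f ` e" using m by metis
  next
    assume "\<exists>e. (e \<in> M \<and> v \<in> e) \<and> e' = f ` e"
    then obtain e where "e \<in> M" "v \<in> e" "e' = f ` e" by (elim exE conjE) simp
    then show "e' \<in> (\<lambda>e. f ` e) ` M \<and> v' \<in> e'" using m by (metis imageI)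
  qed
  moreover have "\<exists>!e'. \<exists>e. (e \<in> M \<and> v \<in> e) \<and> e' = f ` e"
  proof (subst ex1_image_iff)
    show "\<exists>!e. e \<in> M \<and> v \<in> e" using M v by (simp add: perfect_matching_def)
    show "e = e'" if "e \<in> M \<and> v \<in> e" "e' \<in> M \<and> v \<in> e'" "f ` e = f ` e'" for e e'
      using inj_on_image_eq_iff[OF b(1), of e e'] MV that by simp
  qed
  ultimately show "\<exists>!e'. e' \<in> (\<lambda>e. f ` e) ` M \<and> v' \<in> e'" by simp
qed

lemma iso_lonely:
  assumes f: "iso f V E V' E'" and e: "lonely_edge V E e"
  shows "lonely_edge V' E' (f ` e)"
proof -
  have b: "bij_betw f V V'" and sg: "simple_graph V E" and E': "E' = (\<lambda>e. f ` e) ` E"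
    using f by (auto simp: iso_def)
  let ?g = "inv_into V f"
  have gf: "?g ` f ` e = e" if "e \<in> E" for e
    using that sg b by (intro inv_into_image_cancel) (auto simp: bij_betw_def simple_graph_def)
  have eE: "e \<in> E" and "\<exists>!M. perfect_matching V E M \<and> e \<in> M" using e by (auto simp: lonely_edge_iff)
  then obtain M where M: "perfect_matching V E M" "e \<in> M"
    and uniq: "\<And>N. perfect_matching V E N \<Longrightarrow> e \<in> N \<Longrightarrow> N = M" by (elim ex1E) metis
  have "\<exists>!M'. perfect_matching V' E' M' \<and> f ` e \<in> M'"
  proof (rule ex1I[of _ "(\<lambda>e. f ` e) ` M"])
    show "perfect_matching V' E' ((\<lambda>e. f ` e) ` M) \<and> f ` e \<in> (\<lambda>e. f ` e) ` M"
      using iso_perfect_matching[OF f M(1)] M(2) by simp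
    fix N' assume N': "perfect_matching V' E' N' \<and> f ` e \<in> N'"
    have N'E: "N' \<subseteq> (\<lambda>e. f ` e) ` E" using N' E' by (simp add: perfect_matching_def)
    have "perfect_matching V E ((\<lambda>e. ?g ` e) ` N')" using iso_perfect_matching[OF iso_inv[OF f]] N' by blast
    moreover have "e \<in> (\<lambda>e. ?g ` e) ` N'" using N' gf[OF eE] by (intro image_eqI[of _ _ "f ` e"]) auto
    ultimately have "(\<lambda>e. ?g ` e) ` N' = M" by (rule uniq)
    moreover have "f ` ?g ` e' = e'" if "e' \<in> N'" for e'
      using that N'E gf by force
    ultimately show "N' = (\<lambda>e. f ` e) ` M" by (force simp: image_image)
  qed
  then show ?thesis using eE E' by (auto simp: lonely_edge_iff)
qed

lemma iso_num_lonely_le: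
  assumes f: "iso f V E V' E'"
  shows "num_lonely V E \<le> num_lonely V' E'"
  unfolding num_lonely_eq
proof (rule card_inj_on_le)
  have b: "inj_on f V" and sg: "simple_graph V E" using f by (auto simp: iso_def bij_betw_def)
  show "inj_on (\<lambda>e. f ` e) {e. lonely_edge V E e}"
  proof (rule inj_onI)
    fix e e' assume "e \<in> {e. lonely_edge V E e}" "e' \<in> {e. lonely_edge V E e}" "f ` e = f ` e'"
    then show "e = e'" using inj_on_image_eq_iff[OF b, of e e'] sg by (auto simp: lonely_edge_def simple_graph_def)
  qed
  show "(\<lambda>e. f ` e) ` {e. lonely_edge V E e} \<subseteq> {e. lonely_edge V' E' e}" using iso_lonely[OF f] by auto
  show "finite {e. lonely_edge V' E' e}" by (rule finite_lonely[OF iso_simple[OF f]])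
qed

lemma iso_num_lonely: "iso f V E V' E' \<Longrightarrow> num_lonely V E = num_lonely V' E'"
  using iso_num_lonely_le iso_inv by (metis order_antisym)

text \<open>Triangle vertices correspond through the outer neighbours that they take over. The
  values of \<open>F\<close> are recorded so that the construction can be iterated.\<close>

lemma iso_expansion:
  assumes f: "iso f V1 E1 V2 E2" and x: "expand V1 E1 t x V1' E1'" and y: "expansion V2 E2 (f t) y V2' E2'"
  obtains F where "iso F V1' E1' V2' E2'" "\<And>v. v \<in> V1 - {t} \<Longrightarrow> F v = f v" "\<And>w. w \<in> nb E1 t \<Longrightarrow> F (x w) = y (f w)"
proof -
  interpret expand V1 E1 t x V1' E1' by (fact x)
  have b: "inj_on f V1" "f ` V1 = V2" and E2: "E2 = (\<lambda>e. f ` e) ` E1" using f by (auto simp: iso_def bij_betw_def)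
  define F where "F v = (if v \<in> V1 - {t} then f v else y (f (inv_into W x v)))" for v
  have Fold: "F v = f v" if "v \<in> V1 - {t}" for v using that by (simp add: F_def)
  have Fnew: "F (x w) = y (f w)" if w: "w \<in> W" for w
  proof -
    have "x w \<notin> V1 - {t}" using fresh w by auto
    then show ?thesis unfolding F_def using inv_into_f_f[OF inj w] by auto
  qed
  have nb2: "nb E2 (f t) = f ` W" by (rule iso_nb[OF f t])
  have y': "inj_on y (f ` W)" "y ` f ` W \<inter> (V2 - {f t}) = {}" "V2' = (V2 - {f t}) \<union> y ` f ` W"
    "E2' = {e\<in>E2. f t \<notin> e} \<union> (\<lambda>w. {y w, w}) ` f ` W \<union> (\<lambda>w. y ` (f ` W - {w})) ` f ` W"
    using y by (auto simp: expansion_def nb2)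
  have V2t: "V2 - {f t} = f ` (V1 - {t})" using b t by (auto simp: inj_on_def)
  have F1: "F ` (V1 - {t}) = V2 - {f t}" unfolding V2t using Fold by (rule image_cong[OF refl])
  have F2: "F ` x ` W = y ` f ` W" unfolding image_image using Fnew by (rule image_cong[OF refl])
  have bij: "bij_betw F V1' V2'"
    unfolding V' y'(3)
  proof (rule bij_betw_combine)
    show "bij_betw F (V1 - {t}) (V2 - {f t})"
      using F1 inj_on_subset[OF b(1), of "V1 - {t}"] Fold by (simp add: bij_betw_def inj_on_def)
    have "inj_on F (x ` W)"
    proof (rule inj_onI)
      fix p q assume "p \<in> x ` W" "q \<in> x ` W" "F p = F q"
      then obtain u w where uw: "u \<in> W" "w \<in> W" "p = x u" "q = x w" "y (f u) = y (f w)" using Fnew by auto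
      then have "f u = f w" using y'(1) by (auto simp: inj_on_def)
      then show "p = q" using b(1) uw W_sub by (auto simp: inj_on_def)
    qed
    then show "bij_betw F (x ` W) (y ` f ` W)" using F2 by (simp add: bij_betw_def)
    show "(V2 - {f t}) \<inter> y ` f ` W = {}" using y'(2) by auto
  qed
  have old: "(\<lambda>e. F ` e) ` {e\<in>E1. t \<notin> e} = {e\<in>E2. f t \<notin> e}"
  proof -
    have 1: "F ` e = f ` e" if "e \<in> E1" "t \<notin> e" for e
    proof (rule image_cong[OF refl])
      show "F v = f v" if "v \<in> e" for v
        using Fold[of v] that \<open>e \<in> E1\<close> \<open>t \<notin> e\<close> simple by (auto simp: simple_graph_def)
    qed
    have 2: "f t \<in> f ` e \<longleftrightarrow> t \<in> e" if "e \<in> E1" for e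
      using inj_on_image_mem_iff[OF b(1) t, of e] that simple by (simp add: simple_graph_def)
    have "(\<lambda>e. F ` e) ` {e\<in>E1. t \<notin> e} = (\<lambda>e. f ` e) ` {e\<in>E1. t \<notin> e}" by (rule image_cong[OF refl], rule 1) auto
    also have "\<dots> = {e\<in>E2. f t \<notin> e}" unfolding E2 using 2 by auto
    finally show ?thesis .
  qed
  have FW: "F w = f w" if "w \<in> W" for w using Fold W_sub that by blast
  have cross: "(\<lambda>e. F ` e) ` (\<lambda>w. {x w, w}) ` W = (\<lambda>w. {y w, w}) ` f ` W"
    unfolding image_image using Fnew FW by (intro image_cong) auto
  have tri: "(\<lambda>e. F ` e) ` (\<lambda>w. x ` (W - {w})) ` W = (\<lambda>w. y ` (f ` W - {w})) ` f ` W"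
    unfolding image_image
  proof (intro image_cong refl)
    fix w assume w: "w \<in> W"
    have "f ` (W - {w}) = f ` W - {f w}"
      using inj_on_image_set_diff[OF inj_on_subset[OF b(1)], of W W "{w}"] W_sub w by auto
    moreover have "(\<lambda>v. F (x v)) ` (W - {w}) = (\<lambda>v. y (f v)) ` (W - {w})"
      using Fnew by (intro image_cong) auto
    ultimately show "(\<lambda>v. F (x v)) ` (W - {w}) = y ` (f ` W - {f w})" by (metis image_image)
  qed
  have "E1' = {e\<in>E1. t \<notin> e} \<union> (\<lambda>w. {x w, w}) ` W \<union> (\<lambda>w. x ` (W - {w})) ` W"
    using expn by (simp add: expansion_def)
  then have "(\<lambda>e. F ` e) ` E1' = E2'" unfolding y'(4) by (simp only: image_Un old cross tri)
  then have "iso F V1' E1' V2' E2'" using bij simple' by (simp add: iso_def)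
  then show ?thesis using that Fold Fnew by blast
qed

section \<open>Ladders\<close>

lemma complete4_lonely:
  assumes V: "card V = 4" and e: "e \<subseteq> V" "card e = 2"
  shows "lonely_edge V {e. e \<subseteq> V \<and> card e = 2} e"
proof -
  let ?E = "{e. e \<subseteq> V \<and> card e = 2}"
  have fin: "finite V" using V card.infinite by fastforce
  have c2: "card (V - e) = 2" using V e fin by (simp add: card_Diff_subset finite_subset)
  have sg: "simple_graph V ?E" using fin by (auto simp: simple_graph_def)
  obtain M where M: "perfect_matching V ?E M \<and> e \<in> M" using complete4_props[OF V refl] e by blast
  have eq: "N = {e, V - e}" if N: "perfect_matching V ?E N" "e \<in> N" for N
  proof -
    have P: "pairing V N" "N \<subseteq> ?E" using N(1) perfect_matching_iff_pairing[OF sg] by auto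
    have f: "f = V - e" if "f \<in> N" "f \<noteq> e" for f
    proof (rule card_subset_eq)
      show "f \<subseteq> V - e" using that P pairing_eqI[OF P(1) _ N(2), of f] by blast
      show "card f = card (V - e)" using that P(2) c2 by auto
    qed (use fin in simp)
    have "N \<noteq> {e}"
    proof
      assume "N = {e}"
      then have "V = e" using P(1) by (simp add: pairing_def)
      then show False using V e by simp
    qed
    then obtain f where "f \<in> N" "f \<noteq> e" using N(2) by blast
    then have "V - e \<in> N" using f by blast
    then show ?thesis using f N(2) by blast
  qed
  have "N = M" if "perfect_matching V ?E N \<and> e \<in> N" for N using eq[of N] eq[of M] M that by simp
  then have "\<exists>!M. perfect_matching V ?E M \<and> e \<in> M" using M by (rule ex1I[rotated])
  then show ?thesis using e by (simp add: lonely_edge_iff)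
qed

text \<open>Shifting names past \<open>Max V\<close> makes them fresh, so over \<open>nat\<close>
  every vertex can be expanded. This provides the model expansions to which the counting lemmas are
  applied.\<close>

lemma ex_expansion:
  fixes V :: "nat set"
  assumes "simple_graph V E" "s \<in> V"
  obtains y V' E' where "expansion V E s y V' E'"
proof -
  let ?y = "\<lambda>w. w + Suc (Max V)"
  have "finite V" using assms by (simp add: simple_graph_def)
  then have "\<forall>v\<in>V. v \<le> Max V" by simp
  then have "w + Suc (Max V) \<notin> V" for w by (metis add_Suc_right le_add2 not_less_eq_eq)
  then have "expansion V E s ?y (V - {s} \<union> ?y ` nb E s)
      ({e\<in>E. s \<notin> e} \<union> (\<lambda>w. {?y w, w}) ` nb E s \<union> (\<lambda>w. ?y ` (nb E s - {w})) ` nb E s)"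
    using assms by (auto simp: expansion_def inj_on_def)
  then show ?thesis by (rule that)
qed

text \<open>The ladder with rungs \<open>{2i+1, 2i+2}\<close>, whose two ends are closed by the adjacent vertices \<open>0\<close> and \<open>2n+1\<close>:
  for \<open>n = 1, 2\<close> it is \<open>K\<^sub>4\<close> and the prism, and in general the extended prism with pattern \<open>(3,\<dots>,3)\<close>
  (\<open>n - 2\<close> entries).\<close>

definition LV :: "nat \<Rightarrow> nat set" where
  "LV n = {0..2 * n + 1}"

text \<open>The rail edges with \<open>j = 0\<close> and \<open>j = 2 * n - 1\<close> already join
  each apex to one end of a rail. The three edges listed separately are the other join at each apex
  and the long edge between the apexes.\<close>

definition LE :: "nat \<Rightarrow> nat set set" where
  "LE n = (\<lambda>j. {j, j + 2}) ` {..<2 * n} \<union> (\<lambda>i. {2 * i + 1, 2 * i + 2}) ` {..<n}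
     \<union> {{0, 1}, {2 * n, 2 * n + 1}, {0, 2 * n + 1}}"

lemma LE_simple: "1 \<le> n \<Longrightarrow> simple_graph (LV n) (LE n)"
  by (auto simp: simple_graph_def LV_def LE_def)

lemma nb_LE_last: "1 \<le> n \<Longrightarrow> nb (LE n) (2 * n + 1) = {0, 2 * n - 1, 2 * n}"
  by (auto simp: nb_def LE_def doubleton_eq_iff image_iff)

text \<open>Expanding the far apex \<open>2 * n + 1\<close> yields a new rung and a new apex: the
  neighbours \<open>2 * n - 1\<close> and \<open>2 * n\<close> receive the rung
  \<open>2 * n + 1\<close>, \<open>2 * n + 2\<close>, so the old apex name now belongs to a rail,
  and \<open>0\<close> receives the apex \<open>2 * n + 3\<close>.\<close>

definition ladder_map :: "nat \<Rightarrow> nat \<Rightarrow> nat" where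
  "ladder_map n w = (if w = 0 then 2 * n + 3 else w + 2)"

lemma ladder_expansion:
  assumes n: "1 \<le> n"
  shows "expansion (LV n) (LE n) (2 * n + 1) (ladder_map n) (LV (Suc n)) (LE (Suc n))"
proof -
  let ?t = "2 * n + 1" and ?W = "{0, 2 * n - 1, 2 * n}"
  obtain m where m: "n = Suc m" using n by (cases n) auto
  have m1: "ladder_map n 0 = 2 * m + 5" "ladder_map n (2 * n - 1) = 2 * m + 3" "ladder_map n (2 * n) = 2 * m + 4"
    by (auto simp: ladder_map_def m)
  have W: "?W = {0, 2 * m + 1, 2 * m + 2}" by (auto simp: m)
  have old: "{e\<in>LE n. ?t \<notin> e} = (\<lambda>j. {j, j + 2}) ` {..<2 * m + 1} \<union> (\<lambda>i. {2 * i + 1, 2 * i + 2}) ` {..<n} \<union> {{0,1}}"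
    by (auto simp: LE_def m) presburger?
  define R where "R = (\<lambda>j. {j, j + 2}) ` {..<2 * m + 1}"
  define G where "G = (\<lambda>i. {2 * i + 1, 2 * i + 2}) ` {..<n}"
  have old': "{e\<in>LE n. ?t \<notin> e} = R \<union> G \<union> {{0,1}}" unfolding old R_def G_def ..
  have rails: "{..<2 * Suc n} = {..<2 * m + 1} \<union> {2 * m + 1, 2 * m + 2, 2 * m + 3}" by (auto simp: m)
  have R: "(\<lambda>j. {j, j + 2}) ` {..<2 * Suc n} = R \<union> {{2 * m + 1, 2 * m + 3}, {2 * m + 2, 2 * m + 4}, {2 * m + 3, 2 * m + 5}}"
    unfolding rails image_Un image_insert image_empty R_def by (simp add: eval_nat_numeral)
  have G: "(\<lambda>i. {2 * i + 1, 2 * i + 2}) ` {..<Suc n} = insert {2 * m + 3, 2 * m + 4} G"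
    unfolding G_def lessThan_Suc image_insert by (simp add: m eval_nat_numeral)
  have c: "{{0, 1}, {2 * Suc n, 2 * Suc n + 1}, {0, 2 * Suc n + 1}} = {{0,1}, {2 * m + 4, 2 * m + 5}, {0, 2 * m + 5}}"
    by (simp add: m eval_nat_numeral)
  have flip: "{2 * m + 5, 0} = {0, 2 * m + 5}" "{2 * m + 3, 2 * m + 1} = {2 * m + 1, 2 * m + 3}"
    "{2 * m + 4, 2 * m + 2} = {2 * m + 2, 2 * m + 4}" "{2 * m + 5, 2 * m + 4} = {2 * m + 4, 2 * m + 5}"
    "{2 * m + 5, 2 * m + 3} = {2 * m + 3, 2 * m + 5}" by (simp_all only: insert_commute)
  have new: "LE (Suc n) = {e\<in>LE n. ?t \<notin> e} \<union> {{2 * m + 5, 0}, {2 * m + 3, 2 * m + 1}, {2 * m + 4, 2 * m + 2}}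
     \<union> {{2 * m + 3, 2 * m + 4}, {2 * m + 5, 2 * m + 4}, {2 * m + 5, 2 * m + 3}}"
    unfolding old' unfolding LE_def R G c flip
    by (rule set_eqI) (simp only: Un_iff insert_iff empty_iff, argo)
  have e0: "?W - {0} = {2 * n - 1, 2 * n}" "?W - {2 * n - 1} = {0, 2 * n}" "?W - {2 * n} = {0, 2 * n - 1}"
    using n by auto
  have opp: "(\<lambda>w. ladder_map n ` (?W - {w})) ` ?W = {{2 * m + 3, 2 * m + 4}, {2 * m + 5, 2 * m + 4}, {2 * m + 5, 2 * m + 3}}"
    by (simp only: image_insert image_empty e0 m1)
  have cross: "(\<lambda>w. {ladder_map n w, w}) ` ?W = {{2 * m + 5, 0}, {2 * m + 3, 2 * m + 1}, {2 * m + 4, 2 * m + 2}}"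
    by (simp only: image_insert image_empty m1) (simp add: m)
  have im: "ladder_map n ` ?W = {2 * m + 5, 2 * m + 3, 2 * m + 4}" by (simp only: image_insert image_empty m1)
  show ?thesis
    unfolding expansion_def nb_LE_last[OF n] opp cross im new
  proof (intro conjI refl)
    show "inj_on (ladder_map n) ?W" unfolding W by (simp add: inj_on_def ladder_map_def m)
    show "LV (Suc n) = LV n - {?t} \<union> {2 * m + 5, 2 * m + 3, 2 * m + 4}" by (auto simp: LV_def m)
  qed (auto simp: LV_def m)
qed

lemma LE_1_explicit: "LE 1 = {{0,2},{1,3},{1,2},{0,1},{2,3},{0,3}}"
proof -
  have r: "{..<2 * 1} = {0,1::nat}" "{..<1} = {0::nat}" by auto
  show ?thesis unfolding LE_def r by (simp add: insert_commute numeral_eq_Suc)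
qed

lemma LV_1: "LV 1 = {0,1,2,3}"
  by (auto simp: LV_def)

lemma LE_1: "LE 1 = {e. e \<subseteq> LV 1 \<and> card e = 2}"
proof (intro equalityI subsetI)
  fix e assume "e \<in> {e. e \<subseteq> LV 1 \<and> card e = 2}"
  then have "card e = 2" "e \<subseteq> LV 1" by auto
  then obtain a b where "e = {a,b}" "a \<noteq> b" by (auto simp: card_2_iff)
  moreover from this have "a \<in> {0,1,2,3}" "b \<in> {0,1,2,3}" using \<open>e \<subseteq> LV 1\<close> LV_1 by auto
  ultimately show "e \<in> LE 1" unfolding LE_1_explicit
    by (elim insertE emptyE) (simp_all add: insert_commute)
next
  fix e assume "e \<in> LE 1"
  then show "e \<in> {e. e \<subseteq> LV 1 \<and> card e = 2}" using LE_simple[of 1] by (simp add: simple_graph_def)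
qed

lemma ladder_klee: "1 \<le> n \<Longrightarrow> klee (LV n) (LE n)"
proof (induction n rule: nat_induct_at_least)
  case base
  have "card (LV 1) = 4" by (simp add: LV_def)
  then show ?case unfolding LE_1 by (rule klee.K4)
next
  case (Suc n)
  then show ?case using klee.expand ladder_expansion by (metis (full_types))
qed

lemma ladder_lonely_old:
  assumes "1 \<le> n" "lonely_edge (LV n) (LE n) e" "2 * n + 1 \<notin> e" "w \<in> e" "w = 0 \<or> w = 2 * n - 1 \<or> w = 2 * n"
  shows "lonely_edge (LV (Suc n)) (LE (Suc n)) e"
  by (rule lonely_old_at_neighbour[OF ladder_klee ladder_expansion _ _ assms(4)])
    (use assms nb_LE_last[of n] in auto)

lemma ladder_lonely_new:
  assumes "1 \<le> n" "lonely_edge (LV n) (LE n) {2 * n + 1, w}"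
  shows "lonely_edge (LV (Suc n)) (LE (Suc n)) (ladder_map n ` ({0, 2 * n - 1, 2 * n} - {w}))"
  using lonely_new[OF ladder_klee ladder_expansion assms(2)] assms(1) nb_LE_last[of n] by simp

lemma ladder1_lonely: "e \<in> LE 1 \<Longrightarrow> lonely_edge (LV 1) (LE 1) e"
proof -
  have "card (LV 1) = 4" by (simp add: LV_def)
  then show "e \<in> LE 1 \<Longrightarrow> lonely_edge (LV 1) (LE 1) e" unfolding LE_1 using complete4_lonely by blast
qed

text \<open>The edges at \<open>0\<close> survive each expansion because \<open>0\<close> is
  adjacent to the expanded apex. Those at the far end are replaced by the triangle edges opposite to
  them, which are again the two at the new apex.\<close>

lemma ladder_caps_lonely:
  assumes "1 \<le> n"
  shows "lonely_edge (LV n) (LE n) {0,1} \<and> lonely_edge (LV n) (LE n) {0,2} \<and>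
    lonely_edge (LV n) (LE n) {2 * n - 1, 2 * n + 1} \<and> lonely_edge (LV n) (LE n) {2 * n, 2 * n + 1}"
  using assms
proof (induction n rule: nat_induct_at_least)
  case base
  have "{0,1} \<in> LE 1" "{0,2} \<in> LE 1" "{1,3} \<in> LE 1" "{2,3} \<in> LE 1"
    unfolding LE_1_explicit by simp_all
  then have "lonely_edge (LV 1) (LE 1) {0,1}" "lonely_edge (LV 1) (LE 1) {0,2}"
    "lonely_edge (LV 1) (LE 1) {1,3}" "lonely_edge (LV 1) (LE 1) {2,3}" using ladder1_lonely by blast+
  moreover have "2 * 1 - 1 = (1::nat)" "2 * 1 + 1 = (3::nat)" "2 * 1 = (2::nat)" by simp_all
  ultimately show ?case by metis
next
  case (Suc n)
  have d: "{0, 2 * n - 1, 2 * n} - {2 * n} = {0, 2 * n - 1}" "{0, 2 * n - 1, 2 * n} - {2 * n - 1} = {0, 2 * n}"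
    using Suc.hyps by auto
  have m: "ladder_map n 0 = 2 * Suc n + 1" "ladder_map n (2 * n - 1) = 2 * Suc n - 1" "ladder_map n (2 * n) = 2 * Suc n"
    using Suc.hyps by (simp_all add: ladder_map_def)
  have n01: "2 * n + 1 \<notin> {0,1::nat}" using Suc.hyps by simp
  have "2 * n + 1 \<noteq> 2" by presburger
  then have n02: "2 * n + 1 \<notin> {0,2::nat}" by simp
  have IH: "lonely_edge (LV n) (LE n) {0,1}" "lonely_edge (LV n) (LE n) {0,2}"
    "lonely_edge (LV n) (LE n) {2 * n + 1, 2 * n - 1}" "lonely_edge (LV n) (LE n) {2 * n + 1, 2 * n}"
    using Suc.IH by (simp_all only: insert_commute)
  show ?case
  proof (intro conjI)
    show "lonely_edge (LV (Suc n)) (LE (Suc n)) {0,1}" by (rule ladder_lonely_old[OF Suc.hyps IH(1) n01, of 0]) simp_all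
    show "lonely_edge (LV (Suc n)) (LE (Suc n)) {0,2}" by (rule ladder_lonely_old[OF Suc.hyps IH(2) n02, of 0]) simp_all
    show "lonely_edge (LV (Suc n)) (LE (Suc n)) {2 * Suc n - 1, 2 * Suc n + 1}"
      using ladder_lonely_new[OF Suc.hyps IH(4)] unfolding d image_insert image_empty m by (simp only: insert_commute)
    show "lonely_edge (LV (Suc n)) (LE (Suc n)) {2 * Suc n, 2 * Suc n + 1}"
      using ladder_lonely_new[OF Suc.hyps IH(3)] unfolding d image_insert image_empty m by (simp only: insert_commute)
  qed
qed

lemma LE_2: "LE 2 = {{0,2},{1,3},{2,4},{3,5},{1,2},{3,4},{0,1},{4,5},{0,5}}"
proof -
  have r: "{..<2 * 2} = {0,1,2,3::nat}" "{..<2} = {0,1::nat}" by auto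
  show ?thesis unfolding LE_def r by (simp add: insert_commute numeral_eq_Suc)
qed

lemma LE_3: "LE 3 = {{0,2},{1,3},{2,4},{3,5},{4,6},{5,7},{1,2},{3,4},{5,6},{0,1},{6,7},{0,7}}"
proof -
  have r: "{..<2 * 3} = {0,1,2,3,4,5::nat}" "{..<3} = {0,1,2::nat}" by auto
  show ?thesis unfolding LE_def r by (simp add: insert_commute numeral_eq_Suc)
qed

lemma LV_2: "LV 2 = {0,1,2,3,4,5}" and LV_3: "LV 3 = {0,1,2,3,4,5,6,7}"
  by (auto simp: LV_def)

text \<open>Up to three rungs there is a lonely rung besides the four edges of
  \<open>ladder_caps_lonely\<close>, which excludes these ladders from having exactly four lonely
  edges. The rung \<open>{3,4}\<close> arises as the edge opposite to the long edge of K4.\<close>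

lemma ladder_middle_rungs_lonely:
  "lonely_edge (LV 1) (LE 1) {1,2}" "lonely_edge (LV 2) (LE 2) {1,2}" "lonely_edge (LV 3) (LE 3) {3,4}"
proof -
  show 1: "lonely_edge (LV 1) (LE 1) {1,2}" by (rule ladder1_lonely) (unfold LE_1_explicit, simp)
  have "lonely_edge (LV (Suc 1)) (LE (Suc 1)) {1,2}" by (rule ladder_lonely_old[OF _ 1, of 1]) auto
  then show "lonely_edge (LV 2) (LE 2) {1,2}" by (metis Suc_1)
  have "lonely_edge (LV 1) (LE 1) {3,0}"
    by (rule ladder1_lonely) (unfold LE_1_explicit, simp add: insert_commute)
  moreover have "2 * 1 - 1 = (1::nat)" "2 * 1 + 1 = (3::nat)" "2 * 1 = (2::nat)" "Suc 1 = 2" by simp_all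
  ultimately have "lonely_edge (LV 2) (LE 2) (ladder_map 1 ` ({0, 1, 2} - {0}))"
    using ladder_lonely_new[of 1 0] by (metis order_refl)
  moreover have "ladder_map 1 ` ({0, 1, 2} - {0}) = {3,4}" by (simp add: ladder_map_def insert_Diff_if numeral_eq_Suc)
  ultimately have 2: "lonely_edge (LV 2) (LE 2) {3,4}" by simp
  have "lonely_edge (LV (Suc 2)) (LE (Suc 2)) {3,4}" by (rule ladder_lonely_old[OF _ 2, of 3]) auto
  then show "lonely_edge (LV 3) (LE 3) {3,4}" by simp
qed

text \<open>The counting form can be decided by simplification on explicit edge lists.\<close>

lemma star_matchingI:
  assumes "N \<subseteq> E" "{e\<in>E. s \<in> e} \<subseteq> N" "\<And>v. v \<in> V \<Longrightarrow> v \<noteq> s \<Longrightarrow> card {e\<in>N. v \<in> e} = 1"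
  shows "star_matching V E s N"
proof -
  have "\<exists>!e. e \<in> N \<and> v \<in> e" if "v \<in> V - {s}" for v
  proof -
    have "card {e\<in>N. v \<in> e} = 1" using assms(3) that by auto
    then obtain e where "{e\<in>N. v \<in> e} = {e}" by (metis One_nat_def card_1_singleton_iff)
    then have "f \<in> N \<and> v \<in> f \<longleftrightarrow> f = e" for f by (metis (mono_tags, lifting) mem_Collect_eq singleton_iff)
    then show ?thesis by simp
  qed
  then show ?thesis using assms(1,2) by (simp add: star_matching_def)
qed

text \<open>K4 has six edges. In the expansions of the prism and of the three-rung ladder at the far
  apex, the given star matchings contain the lonely rungs \<open>{1,2}\<close> and
  \<open>{3,4}\<close>, so each step loses one edge; from four rungs on monotonicity
  suffices.\<close>

lemma ladder_num_lonely_le: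
  "num_lonely (LV 3) (LE 3) \<le> 5" "4 \<le> n \<Longrightarrow> num_lonely (LV n) (LE n) \<le> 4"
proof -
  have step: "num_lonely (LV (Suc n)) (LE (Suc n)) + card S \<le> num_lonely (LV n) (LE n)"
    if "1 \<le> n" "star_matching (LV n) (LE n) (2 * n + 1) N" "S \<subseteq> N"
      "\<And>e. e \<in> S \<Longrightarrow> lonely_edge (LV n) (LE n) e \<and> 2 * n + 1 \<notin> e" for n N S
    using num_lonely_expansion_le[OF ladder_klee ladder_expansion] that by blast
  have mono: "num_lonely (LV (Suc n)) (LE (Suc n)) \<le> num_lonely (LV n) (LE n)" if "1 \<le> n" for n
    by (rule num_lonely_expansion_mono[OF ladder_klee ladder_expansion]) (use that in auto)
  have "num_lonely (LV 1) (LE 1) \<le> card (LE 1)"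
    unfolding num_lonely_def by (rule card_mono) (auto simp: LE_def)
  also have "card (LE 1) = 6" unfolding LE_1 using n_subsets[of "LV 1" 2] by (simp add: LV_def numeral_eq_Suc)
  finally have 2: "num_lonely (LV 2) (LE 2) \<le> 6" using mono[of 1] by (simp add: numeral_2_eq_2)
  have s5: "star_matching (LV 2) (LE 2) 5 {{0,5},{3,5},{4,5},{1,2}}"
    by (rule star_matchingI) (auto simp: LE_2 LV_2 Collect_disj_eq Collect_conv_if conj_disj_distribR)
  have "num_lonely (LV 3) (LE 3) + 1 \<le> num_lonely (LV 2) (LE 2)"
    using step[of 2 _ "{{1,2}}"] s5 ladder_middle_rungs_lonely by (simp add: numeral_3_eq_3)
  then show 3: "num_lonely (LV 3) (LE 3) \<le> 5" using 2 by simp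
  have s7: "star_matching (LV 3) (LE 3) 7 {{0,7},{5,7},{6,7},{1,2},{3,4}}"
    by (rule star_matchingI) (auto simp: LE_3 LV_3 Collect_disj_eq Collect_conv_if conj_disj_distribR)
  have "num_lonely (LV (Suc 3)) (LE (Suc 3)) + 1 \<le> num_lonely (LV 3) (LE 3)"
    using step[of 3 _ "{{3,4}}"] s7 ladder_middle_rungs_lonely by simp
  then have 4: "num_lonely (LV 4) (LE 4) \<le> 4" using 3 by simp
  show "num_lonely (LV n) (LE n) \<le> 4" if "4 \<le> n"
    using that
  proof (induction n rule: nat_induct_at_least)
    case base then show ?case by (rule 4)
  next
    case (Suc n) then show ?case using mono[of n] by simp
  qed
qed

lemma num_lonely_ge:
  assumes "simple_graph V E" "\<And>e. e \<in> S \<Longrightarrow> lonely_edge V E e"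
  shows "card S \<le> num_lonely V E"
  unfolding num_lonely_eq by (rule card_mono[OF finite_lonely[OF assms(1)]]) (use assms in auto)

lemma ladder_num_lonely:
  assumes "1 \<le> n"
  shows "num_lonely (LV n) (LE n) = 4 \<longleftrightarrow> 4 \<le> n"
proof
  assume 4: "num_lonely (LV n) (LE n) = 4"
  show "4 \<le> n"
  proof (rule ccontr)
    assume "\<not> 4 \<le> n"
    then consider "n = 1" | "n = 2" | "n = 3" using assms by linarith
    then obtain r where r: "lonely_edge (LV n) (LE n) r" "r \<notin> {{0,1},{0,2},{2 * n - 1, 2 * n + 1},{2 * n, 2 * n + 1}}"
      using ladder_middle_rungs_lonely by cases (auto simp: doubleton_eq_iff)
    have "card {r,{0,1},{0,2},{2 * n - 1, 2 * n + 1},{2 * n, 2 * n + 1}} = 5"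
      using r(2) assms by (auto simp: doubleton_eq_iff card_insert_if)
    moreover have "card {r,{0,1},{0,2},{2 * n - 1, 2 * n + 1},{2 * n, 2 * n + 1}} \<le> num_lonely (LV n) (LE n)"
      by (rule num_lonely_ge[OF LE_simple[OF assms]]) (use ladder_caps_lonely[OF assms] r(1) in auto)
    ultimately show False using 4 by simp
  qed
next
  assume n: "4 \<le> n"
  have "card {{0,1},{0,2},{2 * n - 1, 2 * n + 1},{2 * n, 2 * n + 1}} = 4"
    using n by (auto simp: doubleton_eq_iff card_insert_if)
  moreover have "card {{0,1},{0,2},{2 * n - 1, 2 * n + 1},{2 * n, 2 * n + 1}} \<le> num_lonely (LV n) (LE n)"
    by (rule num_lonely_ge[OF LE_simple[OF assms]]) (use ladder_caps_lonely[OF assms] in auto)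
  ultimately show "num_lonely (LV n) (LE n) = 4" using ladder_num_lonely_le(2)[OF n] by simp
qed

section \<open>The extended prism with pattern (3,1)\<close>

definition PV :: "nat set" where
  "PV = {0,1,2,3,4,5,6,7,8,9}"

text \<open>This is the three-rung ladder expanded at the end \<open>5\<close> of its last rung: the
  triangle is \<open>5\<close>, \<open>8\<close>, \<open>9\<close>, where \<open>5\<close> keeps the
  neighbour \<open>3\<close> while \<open>8\<close> and \<open>9\<close> take over \<open>6\<close>
  and \<open>7\<close>.\<close>

definition PE :: "nat set set" where
  "PE = {{0,2},{1,3},{2,4},{4,6},{1,2},{3,4},{0,1},{6,7},{0,7},{3,5},{6,8},{7,9},{5,8},{5,9},{8,9}}"

definition P_map :: "nat \<Rightarrow> nat" where
  "P_map w = (if w = 3 then 5 else if w = 6 then 8 else 9)"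

lemma nb_LE_3: "nb (LE 3) 5 = {3,6,7}"
  by (auto simp: nb_def LE_3 doubleton_eq_iff)

lemma P_expansion: "expansion (LV 3) (LE 3) 5 P_map PV PE"
proof -
  have m: "P_map 3 = 5" "P_map 6 = 8" "P_map 7 = 9" by (simp_all add: P_map_def)
  have d: "{3,6,7} - {3} = {6,7::nat}" "{3,6,7} - {6} = {3,7::nat}" "{3,6,7} - {7} = {3,6::nat}" by auto
  have old: "{e\<in>LE 3. 5 \<notin> e} = {{0,2},{1,3},{2,4},{4,6},{1,2},{3,4},{0,1},{6,7},{0,7}}"
    (is "_ = ?A")
  proof -
    let ?B = "{{3,5},{5,7},{5,6::nat}}"
    have "LE 3 = ?A \<union> ?B" unfolding LE_3 by (simp add: insert_commute)
    then have "e \<in> LE 3 \<longleftrightarrow> e \<in> ?A \<or> e \<in> ?B" for e by (simp only: Un_iff)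
    moreover have "\<forall>e\<in>?A. 5 \<notin> e" "\<forall>e\<in>?B. 5 \<in> e" by simp_all
    ultimately show ?thesis by (intro set_eqI) (metis (no_types, lifting) mem_Collect_eq)
  qed
  show ?thesis
    unfolding expansion_def nb_LE_3 old image_insert image_empty m d
  proof (intro conjI)
    show "inj_on P_map {3,6,7}" by (simp add: inj_on_def P_map_def)
    show "PE = {{0,2},{1,3},{2,4},{4,6},{1,2},{3,4},{0,1},{6,7},{0,7}} \<union> {{5,3},{8,6},{9,7}} \<union> {{8,9},{5,9},{5,8}}"
      unfolding PE_def by (simp add: insert_commute)
  qed (auto simp: LV_3 PV_def)
qed

lemma P_klee: "klee PV PE"
  using klee.expand[OF ladder_klee P_expansion] by simp

lemma P_simple: "simple_graph PV PE"
  using klee_props(1)[OF P_klee] by (simp add: cubic_graph_def)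

lemma P_lonely:
  "lonely_edge PV PE {0,2}" "lonely_edge PV PE {3,4}" "lonely_edge PV PE {6,7}" "lonely_edge PV PE {5,8}"
proof -
  have K: "klee (LV 3) (LE 3)" by (rule ladder_klee) simp
  have caps: "lonely_edge (LV 3) (LE 3) {0,2}" "lonely_edge (LV 3) (LE 3) {5,7}" "lonely_edge (LV 3) (LE 3) {6,7}"
    using ladder_caps_lonely[of 3] by simp_all
  show "lonely_edge PV PE {3,4}"
    by (rule lonely_old_at_neighbour[OF K P_expansion ladder_middle_rungs_lonely(3), of 3]) (auto simp: nb_LE_3)
  show "lonely_edge PV PE {6,7}"
    by (rule lonely_old_at_neighbour[OF K P_expansion caps(3), of 6]) (auto simp: nb_LE_3)
  have "{3,6,7} - {7} = {3,6::nat}" by auto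
  then show "lonely_edge PV PE {5,8}"
    using lonely_new[OF K P_expansion caps(2)] by (simp add: nb_LE_3 P_map_def insert_commute)
  show "lonely_edge PV PE {0,2}"
  proof (rule lonely_old[OF K P_expansion caps(1)])
    fix N assume N: "star_matching (LV 3) (LE 3) 5 N"
    then have NE: "N \<subseteq> LE 3" by (simp add: star_matching_def)
    have ex1: "\<exists>!e. e \<in> N \<and> v \<in> e" if "v \<in> {2,3,4,6}" for v
    proof -
      have "v \<in> LV 3 - {5}" using that unfolding LV_3 by auto
      then show ?thesis using N unfolding star_matching_def by blast
    qed
    have uniq: "e = f" if "v \<in> {2,3,4,6}" "e \<in> N" "f \<in> N" "v \<in> e" "v \<in> f" for v e f
      using ex1[OF that(1)] that by (elim ex1E) metis
    have s: "{3,5} \<in> N" "{5,6} \<in> N"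
      using N by (auto simp: star_matching_def LE_3)
    show "{0,2} \<notin> N"
    proof
      assume "{0,2} \<in> N"
      obtain f where f: "f \<in> N" "4 \<in> f" using ex1_implies_ex[OF ex1[of 4]] by auto
      then have "f \<in> LE 3" using NE by auto
      then have "f = {2,4} \<or> f = {3,4} \<or> f = {4,6}" using f(2) unfolding LE_3 by auto
      then show False
      proof (elim disjE)
        assume "f = {2,4}"
        then have "{2,4} = {0,2::nat}" using f(1) \<open>{0,2} \<in> N\<close> by (intro uniq[of 2]) simp_all
        then show False by (simp add: doubleton_eq_iff)
      next
        assume "f = {3,4}"
        then have "{3,4} = {3,5::nat}" using f(1) s(1) by (intro uniq[of 3]) simp_all
        then show False by (simp add: doubleton_eq_iff)
      next
        assume "f = {4,6}"
        then have "{4,6} = {5,6::nat}" using f(1) s(2) by (intro uniq[of 6]) simp_all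
        then show False by (simp add: doubleton_eq_iff)
      qed
    qed
  qed auto
qed

lemma P_num_lonely: "num_lonely PV PE = 4"
proof -
  have K: "klee (LV 3) (LE 3)" by (rule ladder_klee) simp
  \<comment> \<open>This star matching contains the lonely edge \<open>{0,1}\<close>, so at most
    four of the at most five lonely edges of the ladder remain.\<close>
  have "star_matching (LV 3) (LE 3) 5 {{3,5},{5,6},{5,7},{2,4},{0,1}}"
    by (rule star_matchingI) (auto simp: LE_3 LV_3 Collect_disj_eq Collect_conv_if conj_disj_distribR)
  then have "num_lonely PV PE + card {{0,1::nat}} \<le> num_lonely (LV 3) (LE 3)"
    by (rule num_lonely_expansion_le[OF K P_expansion]) (use ladder_caps_lonely[of 3] in auto)
  then have "num_lonely PV PE \<le> 4" using ladder_num_lonely_le(1) by simp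
  moreover have "card {{0,2},{3,4},{6,7},{5,8::nat}} \<le> num_lonely PV PE"
    by (rule num_lonely_ge[OF P_simple]) (use P_lonely in auto)
  moreover have "card {{0,2},{3,4},{6,7},{5,8::nat}} = 4" by (simp add: doubleton_eq_iff)
  ultimately show ?thesis by simp
qed

text \<open>For each of the ten vertices an explicit star matching contains one of the four lonely
  edges away from it, so every expansion loses one.\<close>

lemma P_expansion_num_lonely:
  assumes ex: "expansion PV PE s y V' E'"
  shows "num_lonely V' E' \<le> 3"
proof -
  have star: ?thesis if "star_matching PV PE s N" "e \<in> N" "s \<notin> e" "e \<in> {{0,2},{3,4},{6,7},{5,8}}" for N e
  proof -
    have "lonely_edge PV PE e" using that(4) P_lonely by auto
    then have "num_lonely V' E' + card {e} \<le> num_lonely PV PE"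
      using that by (intro num_lonely_expansion_le[OF P_klee ex that(1)]) auto
    then show ?thesis using P_num_lonely by simp
  qed
  have "star_matching PV PE 0 {{0,2},{0,1},{0,7},{3,4},{5,9},{6,8}}" by (rule star_matchingI) (auto simp: PE_def PV_def Collect_disj_eq Collect_conv_if conj_disj_distribR)
  then have s0: ?thesis if "s = 0" using star[of _ "{3,4}"] that by simp
  have "star_matching PV PE 1 {{1,3},{1,2},{0,1},{4,6},{5,8},{7,9}}" by (rule star_matchingI) (auto simp: PE_def PV_def Collect_disj_eq Collect_conv_if conj_disj_distribR)
  then have s1: ?thesis if "s = 1" using star[of _ "{5,8}"] that by simp
  have "star_matching PV PE 2 {{0,2},{2,4},{1,2},{3,5},{6,7},{8,9}}" by (rule star_matchingI) (auto simp: PE_def PV_def Collect_disj_eq Collect_conv_if conj_disj_distribR)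
  then have s2: ?thesis if "s = 2" using star[of _ "{6,7}"] that by simp
  have "star_matching PV PE 3 {{1,3},{3,4},{3,5},{0,2},{6,7},{8,9}}" by (rule star_matchingI) (auto simp: PE_def PV_def Collect_disj_eq Collect_conv_if conj_disj_distribR)
  then have s3: ?thesis if "s = 3" using star[of _ "{0,2}"] that by simp
  have "star_matching PV PE 4 {{2,4},{4,6},{3,4},{0,1},{5,8},{7,9}}" by (rule star_matchingI) (auto simp: PE_def PV_def Collect_disj_eq Collect_conv_if conj_disj_distribR)
  then have s4: ?thesis if "s = 4" using star[of _ "{5,8}"] that by simp
  have "star_matching PV PE 5 {{3,5},{5,8},{5,9},{0,1},{2,4},{6,7}}" by (rule star_matchingI) (auto simp: PE_def PV_def Collect_disj_eq Collect_conv_if conj_disj_distribR)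
  then have s5: ?thesis if "s = 5" using star[of _ "{6,7}"] that by simp
  have "star_matching PV PE 6 {{4,6},{6,7},{6,8},{0,2},{1,3},{5,9}}" by (rule star_matchingI) (auto simp: PE_def PV_def Collect_disj_eq Collect_conv_if conj_disj_distribR)
  then have s6: ?thesis if "s = 6" using star[of _ "{0,2}"] that by simp
  have "star_matching PV PE 7 {{6,7},{0,7},{7,9},{1,3},{2,4},{5,8}}" by (rule star_matchingI) (auto simp: PE_def PV_def Collect_disj_eq Collect_conv_if conj_disj_distribR)
  then have s7: ?thesis if "s = 7" using star[of _ "{5,8}"] that by simp
  have "star_matching PV PE 8 {{6,8},{5,8},{8,9},{0,7},{1,2},{3,4}}" by (rule star_matchingI) (auto simp: PE_def PV_def Collect_disj_eq Collect_conv_if conj_disj_distribR)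
  then have s8: ?thesis if "s = 8" using star[of _ "{3,4}"] that by simp
  have "star_matching PV PE 9 {{7,9},{5,9},{8,9},{0,2},{1,3},{4,6}}" by (rule star_matchingI) (auto simp: PE_def PV_def Collect_disj_eq Collect_conv_if conj_disj_distribR)
  then have s9: ?thesis if "s = 9" using star[of _ "{0,2}"] that by simp
  have "s \<in> PV" using ex by (simp add: expansion_def)
  then have "s = 0 \<or> s = 1 \<or> s = 2 \<or> s = 3 \<or> s = 4 \<or> s = 5 \<or> s = 6 \<or> s = 7 \<or> s = 8 \<or> s = 9"
    by (simp add: PV_def)
  then show ?thesis using s0 s1 s2 s3 s4 s5 s6 s7 s8 s9 by blast
qed

section \<open>Expansions of ladders\<close>

text \<open>The period four comes from the numbering: a step by two along a rail and the step from
  \<open>2 * i + 1\<close> to \<open>2 * i + 2\<close> across a rung both reverse the sign.\<close>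

definition ladder_sign :: "nat \<Rightarrow> int" where
  "ladder_sign j = (if j mod 4 = 0 \<or> j mod 4 = 1 then 1 else - 1)"

lemma ladder_sign_sum: "(\<Sum>j=1..2 * n. ladder_sign j) = 0"
proof (induction n)
  case (Suc n)
  have "{1..2 * Suc n} = insert (2 * n + 2) (insert (2 * n + 1) {1..2 * n})" by auto
  then have "(\<Sum>j=1..2 * Suc n. ladder_sign j) = ladder_sign (2 * n + 2) + ladder_sign (2 * n + 1)"
    using Suc by simp
  also have "\<dots> = 0" by (simp add: ladder_sign_def) presburger
  finally show ?case .
qed simp

text \<open>The rails and rungs form a balanced bipartite graph with sides given by \<open>ladder_sign\<close>, so a star matching
  centred in it cannot stay within it.\<close>

lemma ladder_star_avoids_long_edge:
  assumes n: "1 \<le> n" and N: "star_matching (LV n) (LE n) s N" and s: "s \<in> {1..2 * n}"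
  shows "{0, 2 * n + 1} \<notin> N"
proof
  assume long: "{0, 2 * n + 1} \<in> N"
  \<comment> \<open>The sign is extended by zero to the apexes, so that the long edge has sum zero
    like the rails and rungs; once it lies in \<open>N\<close>, no other edge of \<open>N\<close>
    meets an apex.\<close>
  define c where "c j = (if j \<in> {1..2 * n} then ladder_sign j else 0)" for j
  have NE: "N \<subseteq> LE n" and N1: "\<And>v. v \<in> LV n \<Longrightarrow> v \<noteq> s \<Longrightarrow> \<exists>!e. e \<in> N \<and> v \<in> e"
    and Ns: "{e\<in>LE n. s \<in> e} \<subseteq> N" using N by (auto simp: star_matching_def)
  have finLE: "finite (LE n)" by (simp add: LE_def)
  then have finN: "finite N" using NE finite_subset by blast
  have ends: "0 \<in> LV n" "0 \<noteq> s" "2 * n + 1 \<in> LV n" "2 * n + 1 \<noteq> s" using s by (auto simp: LV_def)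
  have other: "0 \<notin> e \<and> 2 * n + 1 \<notin> e" if "e \<in> N" "e \<noteq> {0, 2 * n + 1}" for e
  proof -
    have "\<exists>!e. e \<in> N \<and> 0 \<in> e" "\<exists>!e. e \<in> N \<and> 2 * n + 1 \<in> e"
      by (rule N1[OF ends(1,2)], rule N1[OF ends(3,4)])
    then show ?thesis using that long by (metis insertI1 insertI2)
  qed
  have edge0: "(\<Sum>v\<in>LV n. if v \<in> e then c v else 0) = 0" if e: "e \<in> N" for e
  proof -
    have two: "(\<Sum>v\<in>LV n. if v \<in> {a,b} then c v else 0) = c a + c b" if "a \<in> LV n" "b \<in> LV n" "a \<noteq> b" for a b
    proof -
      have "(\<Sum>v\<in>LV n. if v \<in> {a,b} then c v else 0) = (\<Sum>v\<in>{a,b}. c v)"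
        using that by (intro sum.mono_neutral_cong_right) (auto simp: LV_def)
      then show ?thesis using that by simp
    qed
    show ?thesis
    proof (cases "e = {0, 2 * n + 1}")
      case True
      then show ?thesis using two[of 0 "2 * n + 1"] by (simp add: LV_def c_def)
    next
      case False
      note o = other[OF e False]
      have "e \<in> LE n" using e NE by auto
      then consider j where "j < 2 * n" "e = {j, j + 2}" | i where "i < n" "e = {2 * i + 1, 2 * i + 2}"
        using o by (auto simp: LE_def)
      then show ?thesis
      proof cases
        case 1
        then have "1 \<le> j" "j + 2 \<le> 2 * n" using o by auto
        then have "c j + c (j + 2) = 0" unfolding c_def ladder_sign_def by (simp, presburger)
        then show ?thesis using two[of j "j + 2"] 1 \<open>j + 2 \<le> 2 * n\<close> by (simp add: LV_def)
      next
        case 2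
        then have "c (2 * i + 1) + c (2 * i + 2) = 0" unfolding c_def ladder_sign_def by (simp, presburger)
        then show ?thesis using two[of "2 * i + 1" "2 * i + 2"] 2 by (simp add: LV_def)
      qed
    qed
  qed
  have K: "klee (LV n) (LE n)" by (rule ladder_klee[OF n])
  have sV: "s \<in> LV n" using s by (simp add: LV_def)
  have deg: "card {e\<in>N. v \<in> e} = (if v = s then 3 else 1)" if v: "v \<in> LV n" for v
  proof (cases "v = s")
    case True
    have "{e\<in>N. s \<in> e} = {e\<in>LE n. s \<in> e}" using Ns NE by auto
    then show ?thesis using True klee_props(1)[OF K] sV by (simp add: cubic_graph_def degree_def)
  next
    case False
    obtain e where e: "e \<in> N \<and> v \<in> e" "\<forall>f. f \<in> N \<and> v \<in> f \<longrightarrow> f = e"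
      by (rule ex1E[OF N1[OF v False]])
    have "{e\<in>N. v \<in> e} \<subseteq> {e}" using e(2)[rule_format] by auto
    moreover have "{e} \<subseteq> {e\<in>N. v \<in> e}" using e(1) by simp
    ultimately have "{e\<in>N. v \<in> e} = {e}" by (rule equalityI)
    then show ?thesis using False by simp
  qed
  \<comment> \<open>Double counting: each edge of \<open>N\<close> has sum zero, while every vertex
    is met once except \<open>s\<close>, which is met three times. The signs add up to zero, so
    \<open>2 * c s = 0\<close> remains.\<close>
  have "0 = (\<Sum>e\<in>N. \<Sum>v\<in>LV n. if v \<in> e then c v else 0)" using edge0 by simp
  also have "\<dots> = (\<Sum>v\<in>LV n. \<Sum>e\<in>N. if v \<in> e then c v else 0)" by (rule sum.swap)
  also have "\<dots> = (\<Sum>v\<in>LV n. int (card {e\<in>N. v \<in> e}) * c v)"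
  proof (rule sum.cong[OF refl])
    fix v
    have "(\<Sum>e\<in>N. if v \<in> e then c v else 0) = (\<Sum>e\<in>{e\<in>N. v \<in> e}. c v)"
      using finN by (subst sum.inter_filter) auto
    then show "(\<Sum>e\<in>N. if v \<in> e then c v else 0) = int (card {e\<in>N. v \<in> e}) * c v" by simp
  qed
  also have "\<dots> = (\<Sum>v\<in>LV n. c v + (if v = s then 2 * c v else 0))"
    by (rule sum.cong) (simp_all add: deg)
  also have "\<dots> = (\<Sum>v\<in>LV n. c v) + 2 * c s"
    using sV by (simp add: sum.distrib LV_def)
  also have "(\<Sum>v\<in>LV n. c v) = (\<Sum>j=1..2 * n. ladder_sign j)"
    by (rule sum.mono_neutral_cong_right) (auto simp: LV_def c_def)
  finally have "c s = 0" using ladder_sign_sum[of n] by simp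
  then show False using s by (simp add: c_def ladder_sign_def split: if_splits)
qed

text \<open>Both apexes differ from \<open>s\<close> and so are covered exactly once, and the long
  edge is excluded; only the two lonely edges at each apex are left for this.\<close>

lemma ladder_star_caps:
  assumes n: "1 \<le> n" and N: "star_matching (LV n) (LE n) s N" and s: "s \<in> {1..2 * n}"
  obtains a b where "a \<in> {1,2}" "{0,a} \<in> N" "b \<in> {2 * n - 1, 2 * n}" "{b, 2 * n + 1} \<in> N"
proof -
  have NE: "N \<subseteq> LE n" and N1: "\<And>v. v \<in> LV n \<Longrightarrow> v \<noteq> s \<Longrightarrow> \<exists>!e. e \<in> N \<and> v \<in> e"
    using N by (auto simp: star_matching_def)
  note long = ladder_star_avoids_long_edge[OF assms]
  have ends: "0 \<in> LV n" "0 \<noteq> s" "2 * n + 1 \<in> LV n" "2 * n + 1 \<noteq> s" using s by (auto simp: LV_def)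
  obtain e where e: "e \<in> N" "0 \<in> e" using ex1_implies_ex[OF N1[OF ends(1,2)]] by auto
  have "e = {0,1} \<or> e = {0,2}"
  proof -
    have "e \<in> LE n" "e \<noteq> {0, 2 * n + 1}" using e NE long by auto
    then consider j where "e = {j, j + 2}" | i where "e = {2 * i + 1, 2 * i + 2}" | "e = {0,1}" | "e = {2 * n, 2 * n + 1}"
      unfolding LE_def by blast
    then show ?thesis
    proof cases
      case 1
      then have "j = 0" using e(2) by auto
      then show ?thesis using 1 by (simp add: numeral_2_eq_2)
    next
      case 2
      then show ?thesis using e(2) by auto
    next
      case 4
      then show ?thesis using e(2) n by auto
    qed simp
  qed
  moreover obtain f where f: "f \<in> N" "2 * n + 1 \<in> f" using ex1_implies_ex[OF N1[OF ends(3,4)]] by auto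
  moreover have "f = {2 * n - 1, 2 * n + 1} \<or> f = {2 * n, 2 * n + 1}"
  proof -
    have "f \<in> LE n" "f \<noteq> {0, 2 * n + 1}" using f NE long by auto
    then consider j where "j < 2 * n" "f = {j, j + 2}" | i where "i < n" "f = {2 * i + 1, 2 * i + 2}" | "f = {0,1}" | "f = {2 * n, 2 * n + 1}"
      unfolding LE_def by blast
    then show ?thesis
    proof cases
      case 1
      then have "j = 2 * n - 1" "j + 2 = 2 * n + 1" using f(2) by auto
      then show ?thesis using 1 by simp
    next
      case 2
      then show ?thesis using f(2) by auto
    qed (use f(2) n in auto)
  qed
  ultimately show ?thesis using e that by blast
qed

text \<open>One star matching contains a lonely edge at each apex. For \<open>2 \<le> n\<close> the
  two ends of the ladder are disjoint, so at most one of these edges contains \<open>s\<close>, and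
  none does if \<open>s\<close> lies on neither outer rung.\<close>

lemma ladder_expansion_num_lonely:
  assumes n: "2 \<le> n" and ex: "expansion (LV n) (LE n) s y V' E'" and s: "s \<in> {1..2 * n}"
  shows "num_lonely V' E' + 1 \<le> num_lonely (LV n) (LE n)"
    and "s \<notin> {1,2,2 * n - 1,2 * n} \<Longrightarrow> num_lonely V' E' + 2 \<le> num_lonely (LV n) (LE n)"
proof -
  have n1: "1 \<le> n" using n by simp
  have K: "klee (LV n) (LE n)" by (rule ladder_klee[OF n1])
  have "s \<in> LV n" using ex by (simp add: expansion_def)
  then obtain N where N: "star_matching (LV n) (LE n) s N" using klee_props(5)[OF K] by blast
  obtain a b where ab: "a \<in> {1,2}" "{0,a} \<in> N" "b \<in> {2 * n - 1, 2 * n}" "{b, 2 * n + 1} \<in> N"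
    by (rule ladder_star_caps[OF n1 N s])
  have lon: "lonely_edge (LV n) (LE n) {0,a}" "lonely_edge (LV n) (LE n) {b, 2 * n + 1}"
    using ladder_caps_lonely[OF n1] ab(1,3) by auto
  have le: "num_lonely V' E' + card S \<le> num_lonely (LV n) (LE n)"
    if "S \<subseteq> {{0,a},{b, 2 * n + 1}}" "\<And>e. e \<in> S \<Longrightarrow> s \<notin> e" for S
    by (rule num_lonely_expansion_le[OF K ex N]) (use that ab lon in auto)
  have "s \<notin> {0,a} \<or> s \<notin> {b, 2 * n + 1}" using ab n s by auto
  then show "num_lonely V' E' + 1 \<le> num_lonely (LV n) (LE n)"
  proof
    assume "s \<notin> {0,a}"
    then show ?thesis using le[of "{{0,a}}"] by simp
  next
    assume "s \<notin> {b, 2 * n + 1}"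
    then show ?thesis using le[of "{{b, 2 * n + 1}}"] by simp
  qed
  assume "s \<notin> {1,2,2 * n - 1,2 * n}"
  then have "s \<notin> {0,a}" "s \<notin> {b, 2 * n + 1}" using ab s by auto
  moreover have "{0,a} \<noteq> {b, 2 * n + 1}" using ab n by (auto simp: doubleton_eq_iff)
  ultimately show "num_lonely V' E' + 2 \<le> num_lonely (LV n) (LE n)"
    using le[of "{{0,a},{b, 2 * n + 1}}"] by auto
qed

section \<open>Symmetries of the ladders\<close>

lemma iso_autI:
  assumes sg: "simple_graph V E" and inj: "inj_on f V" and V: "f ` V \<subseteq> V" and E: "\<And>e. e \<in> E \<Longrightarrow> f ` e \<in> E"
  shows "iso f V E V E"
proof -
  have fin: "finite V" "finite E"
    using sg finite_subset[of E "Pow V"] by (auto simp: simple_graph_def)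
  have "f ` V = V" by (rule endo_inj_surj[OF fin(1) V inj])
  moreover have "inj_on (\<lambda>e. f ` e) E"
  proof (rule inj_onI)
    fix e e' assume "e \<in> E" "e' \<in> E" "f ` e = f ` e'"
    then show "e = e'" using inj_on_image_eq_iff[OF inj, of e e'] sg by (auto simp: simple_graph_def)
  qed
  then have "(\<lambda>e. f ` e) ` E = E" using E by (intro endo_inj_surj[OF fin(2)]) auto
  ultimately show ?thesis using sg inj by (simp add: iso_def bij_betw_def)
qed

definition ladder_orbit :: "nat \<Rightarrow> nat \<Rightarrow> nat \<Rightarrow> bool" where
  "ladder_orbit n s t \<longleftrightarrow> (\<exists>f. iso f (LV n) (LE n) (LV n) (LE n) \<and> f s = t)"

lemma ladder_orbit_trans: "ladder_orbit n s t \<Longrightarrow> ladder_orbit n t u \<Longrightarrow> ladder_orbit n s u"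
  unfolding ladder_orbit_def using iso_comp by (metis comp_apply)

lemma ladder_orbit_refl: "1 \<le> n \<Longrightarrow> ladder_orbit n s s"
  unfolding ladder_orbit_def using LE_simple by (intro exI[of _ "\<lambda>v. v"] conjI iso_autI) auto

lemma ladder_orbit_reverse:
  assumes n: "1 \<le> n" and s: "s \<in> LV n"
  shows "ladder_orbit n s (2 * n + 1 - s)"
  unfolding ladder_orbit_def
proof (intro exI[of _ "\<lambda>v. 2 * n + 1 - v"] conjI iso_autI refl)
  let ?f = "\<lambda>v. 2 * n + 1 - v"
  show "simple_graph (LV n) (LE n)" by (rule LE_simple[OF n])
  show "inj_on ?f (LV n)" "?f ` LV n \<subseteq> LV n" by (auto simp: inj_on_def LV_def)
  fix e assume "e \<in> LE n"
  then consider j where "j < 2 * n" "e = {j, j + 2}" | i where "i < n" "e = {2 * i + 1, 2 * i + 2}"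
    | "e = {0,1}" | "e = {2 * n, 2 * n + 1}" | "e = {0, 2 * n + 1}"
    unfolding LE_def by blast
  then show "?f ` e \<in> LE n"
  proof cases
    case 1
    then have "?f ` e = {2 * n - 1 - j, 2 * n - 1 - j + 2}" by (auto simp: insert_commute)
    moreover have "2 * n - 1 - j \<in> {..<2 * n}" using 1 by auto
    ultimately show ?thesis unfolding LE_def by blast
  next
    case 2
    then have "?f ` e = {2 * (n - 1 - i) + 1, 2 * (n - 1 - i) + 2}" by (auto simp: insert_commute)
    moreover have "n - 1 - i \<in> {..<n}" using 2 by auto
    ultimately show ?thesis unfolding LE_def by blast
  next
    case 3
    then have "?f ` e = {2 * n, 2 * n + 1}" by (auto simp: insert_commute)
    then show ?thesis unfolding LE_def by blast
  next
    case 4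
    then have "?f ` e = {0, 1}" by (auto simp: insert_commute)
    then show ?thesis unfolding LE_def by blast
  next
    case 5
    then have "?f ` e = {0, 2 * n + 1}" by (auto simp: insert_commute)
    then show ?thesis unfolding LE_def by blast
  qed
qed

lemma K4_orbit: "s \<in> LV 1 \<Longrightarrow> ladder_orbit 1 s 3"
  unfolding ladder_orbit_def
proof (intro exI[of _ "\<lambda>v. if v = s then 3 else if v = 3 then s else v"] conjI iso_autI)
  assume s: "s \<in> LV 1"
  let ?f = "\<lambda>v. if v = s then 3 else if v = 3 then s else v"
  show "simple_graph (LV 1) (LE 1)" by (rule LE_simple) simp
  show inj: "inj_on ?f (LV 1)" by (auto simp: inj_on_def)
  have three: "3 \<in> LV 1" unfolding LV_1 by simp
  show "?f ` LV 1 \<subseteq> LV 1" using s three by auto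
  fix e assume "e \<in> LE 1"
  then have e: "e \<subseteq> LV 1" "card e = 2" unfolding LE_1 by auto
  have "card (?f ` e) = 2" using card_image[OF inj_on_subset[OF inj e(1)]] e(2) by simp
  moreover have "?f ` e \<subseteq> LV 1" using e(1) s three by auto
  ultimately show "?f ` e \<in> LE 1" unfolding LE_1 by simp
qed simp

text \<open>In this numbering the triangles of the prism are \<open>{0,1,2}\<close> and
  \<open>{3,4,5}\<close>, joined by \<open>{1,3}\<close>, \<open>{2,4}\<close>,
  \<open>{0,5}\<close>. The maps transpose two vertices of one triangle together with their partners
  in the other.\<close>

lemma prism_orbit_side: "ladder_orbit 2 3 5" "ladder_orbit 2 4 5"
proof -
  have "iso (\<lambda>v. if v = 3 then 5 else if v = 5 then 3 else if v = 1 then 0 else if v = 0 then 1 else v) (LV 2) (LE 2) (LV 2) (LE 2)" (is "iso ?f _ _ _ _")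
  proof (rule iso_autI[OF LE_simple])
    show "inj_on ?f (LV 2)" unfolding LV_2 by (simp add: inj_on_def)
    show "?f ` LV 2 \<subseteq> LV 2" unfolding LV_2 by simp
    have "\<forall>e\<in>LE 2. ?f ` e \<in> LE 2" unfolding LE_2 by (simp add: doubleton_eq_iff)
    then show "?f ` e \<in> LE 2" if "e \<in> LE 2" for e using that by blast
  qed simp
  then show "ladder_orbit 2 3 5" unfolding ladder_orbit_def by (intro exI conjI) (assumption, simp)
  have "iso (\<lambda>v. if v = 4 then 5 else if v = 5 then 4 else if v = 2 then 0 else if v = 0 then 2 else v) (LV 2) (LE 2) (LV 2) (LE 2)" (is "iso ?f _ _ _ _")
  proof (rule iso_autI[OF LE_simple])
    show "inj_on ?f (LV 2)" unfolding LV_2 by (simp add: inj_on_def)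
    show "?f ` LV 2 \<subseteq> LV 2" unfolding LV_2 by simp
    have "\<forall>e\<in>LE 2. ?f ` e \<in> LE 2" unfolding LE_2 by (simp add: doubleton_eq_iff)
    then show "?f ` e \<in> LE 2" if "e \<in> LE 2" for e using that by blast
  qed simp
  then show "ladder_orbit 2 4 5" unfolding ladder_orbit_def by (intro exI conjI) (assumption, simp)
qed

lemma prism_orbit:
  assumes "s \<in> LV 2"
  shows "ladder_orbit 2 s 5"
proof -
  have rev: "ladder_orbit 2 s (5 - s)" if "s \<in> LV 2" for s using ladder_orbit_reverse[OF _ that] by simp
  have "ladder_orbit 2 1 4" "ladder_orbit 2 2 3" "ladder_orbit 2 0 5"
    using rev[of 1] rev[of 2] rev[of 0] by (simp_all add: LV_2)
  then have "ladder_orbit 2 1 5" "ladder_orbit 2 2 5" "ladder_orbit 2 0 5"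
    using prism_orbit_side ladder_orbit_trans by blast+
  moreover have "ladder_orbit 2 5 5" by (rule ladder_orbit_refl) simp
  ultimately show ?thesis using assms prism_orbit_side by (auto simp: LV_2)
qed

text \<open>Besides the reversal, the exchange of the two rails is an automorphism; together they
  move every end of an outer rung to \<open>5\<close>, the vertex expanded in
  \<open>P_expansion\<close>.\<close>

lemma ladder3_orbit:
  assumes "s \<in> {1,2,5,6}"
  shows "ladder_orbit 3 s 5"
proof -
  have rev: "ladder_orbit 3 s (7 - s)" if "s \<in> LV 3" for s using ladder_orbit_reverse[OF _ that] by simp
  have "iso (\<lambda>v. if v = 1 then 2 else if v = 2 then 1 else if v = 3 then 4 else if v = 4 then 3 else if v = 5 then 6 else if v = 6 then 5 else v) (LV 3) (LE 3) (LV 3) (LE 3)" (is "iso ?f _ _ _ _")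
  proof (rule iso_autI[OF LE_simple])
    show "inj_on ?f (LV 3)" unfolding LV_3 by (simp add: inj_on_def)
    show "?f ` LV 3 \<subseteq> LV 3" unfolding LV_3 by simp
    have "\<forall>e\<in>LE 3. ?f ` e \<in> LE 3" unfolding LE_3 by (simp add: doubleton_eq_iff)
    then show "?f ` e \<in> LE 3" if "e \<in> LE 3" for e using that by blast
  qed simp
  then have 6: "ladder_orbit 3 6 5" unfolding ladder_orbit_def by (intro exI conjI) (assumption, simp)
  have "ladder_orbit 3 1 6" "ladder_orbit 3 2 5" using rev[of 1] rev[of 2] by (simp_all add: LV_3)
  then have "ladder_orbit 3 1 5" "ladder_orbit 3 2 5" using 6 ladder_orbit_trans by blast+
  moreover have "ladder_orbit 3 5 5" by (rule ladder_orbit_refl) simp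
  ultimately show ?thesis using assms 6 by auto
qed

lemma iso_expansion_graph:
  assumes "klee V1 E1" "iso f V1 E1 V2 E2" "expansion V1 E1 t x V1' E1'" "expansion V2 E2 (f t) y V2' E2'"
  shows "\<exists>F. iso F V1' E1' V2' E2'"
  using iso_expansion[OF assms(2) klee_expand[OF assms(1,3)] assms(4)] by metis

text \<open>Expanding never creates lonely edges, so a Klee graph with at least four lonely edges arises through Klee graphs
  with at least four lonely edges.\<close>

lemma klee_classification:
  assumes "klee V E" "4 \<le> num_lonely V E"
  shows "(\<exists>n f. 1 \<le> n \<and> iso f V E (LV n) (LE n)) \<or> (\<exists>f. iso f V E PV PE)"
  using assms
proof induction
  case (K4 V)
  have fin: "finite V" using K4 card.infinite by fastforce
  have "card (LV 1) = card V" using K4 by (simp add: LV_def)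
  then obtain f where f: "bij_betw f V (LV 1)" using finite_same_card_bij[OF fin, of "LV 1"] by (auto simp: LV_def)
  have fi: "inj_on f V" "f ` V = LV 1" using f by (auto simp: bij_betw_def)
  let ?E = "{e. e \<subseteq> V \<and> card e = 2}"
  have "(\<lambda>e. f ` e) ` ?E = LE 1"
    unfolding LE_1
  proof (intro equalityI subsetI)
    fix e' assume "e' \<in> (\<lambda>e. f ` e) ` ?E"
    then obtain e where e: "e \<subseteq> V" "card e = 2" "e' = f ` e" by auto
    then show "e' \<in> {e. e \<subseteq> LV 1 \<and> card e = 2}" using card_image[OF inj_on_subset[OF fi(1) e(1)]] fi(2) by auto
  next
    fix e' assume "e' \<in> {e. e \<subseteq> LV 1 \<and> card e = 2}"
    then have e': "e' \<subseteq> f ` V" "card e' = 2" using fi(2) by auto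
    then obtain e where e: "e \<subseteq> V" "e' = f ` e" by (auto simp: subset_image_iff)
    then have "card e = 2" using card_image[OF inj_on_subset[OF fi(1) e(1)]] e'(2) by simp
    then show "e' \<in> (\<lambda>e. f ` e) ` ?E" using e by auto
  qed
  moreover have "simple_graph V ?E" using fin by (auto simp: simple_graph_def)
  ultimately have "iso f V ?E (LV 1) (LE 1)" using f by (simp add: iso_def)
  then show ?case by blast
next
  case (expand V E t x V' E')
  note H = expand.hyps(1) and ex = expand.hyps(2)
  have tV: "t \<in> V" using ex by (simp add: expansion_def)
  have 4: "4 \<le> num_lonely V' E'" by (rule expand.prems)
  have "4 \<le> num_lonely V E" using 4 num_lonely_expansion_mono[OF H ex] by linarith
  then consider n f where "1 \<le> n" "iso f V E (LV n) (LE n)" | f where "iso f V E PV PE"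
    using expand.IH by blast
  then show ?case
  proof cases
    case 2
    then have "f t \<in> PV" using tV by (auto simp: iso_def bij_betw_def)
    then obtain y U D where y: "expansion PV PE (f t) y U D" using ex_expansion[OF P_simple] by blast
    then obtain F where "iso F V' E' U D" using iso_expansion_graph[OF H 2 ex] by blast
    then have "num_lonely V' E' = num_lonely U D" by (rule iso_num_lonely)
    then show ?thesis using P_expansion_num_lonely[OF y] 4 by simp
  next
    case 1
    note n = 1(1) and f = 1(2)
    define s where "s = f t"
    have sV: "s \<in> LV n" using tV f by (auto simp: iso_def bij_betw_def s_def)
    have orbit: "\<exists>F. iso F V' E' U D" if "ladder_orbit n s u" "expansion (LV n) (LE n) u y U D" for u y U D
    proof -
      obtain g where g: "iso g (LV n) (LE n) (LV n) (LE n)" "g s = u" using \<open>ladder_orbit n s u\<close> by (auto simp: ladder_orbit_def)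
      have "expansion (LV n) (LE n) ((g \<circ> f) t) y U D" using that(2) g(2) by (simp add: s_def)
      then show ?thesis by (rule iso_expansion_graph[OF H iso_comp[OF f g(1)] ex])
    qed
    show ?thesis
    proof (cases "ladder_orbit n s (2 * n + 1)")
      \<comment> \<open>A vertex equivalent to the apex leads to the next ladder. In K4 and the
        prism all vertices are of this kind.\<close>
      case True
      then show ?thesis using orbit[OF True ladder_expansion[OF n]] by (metis le_SucI n)
    next
      case False
      have "s \<noteq> 0" "s \<noteq> 2 * n + 1"
        using False ladder_orbit_refl[OF n, of s] ladder_orbit_reverse[OF n sV] by (metis minus_nat.diff_0, metis)
      then have s: "s \<in> {1..2 * n}" using sV by (auto simp: LV_def)
      have "n \<noteq> 1" using False K4_orbit[of s] sV by (auto simp: numeral_3_eq_3)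
      moreover have "n \<noteq> 2" using False prism_orbit[of s] sV by auto
      ultimately have n3: "3 \<le> n" using n by linarith
      \<comment> \<open>The counting lemmas speak about expansions of the ladder itself, so a model
        expansion at \<open>s\<close> is formed and shown isomorphic to the given graph.\<close>
      obtain y U D where y: "expansion (LV n) (LE n) s y U D" using ex_expansion[OF LE_simple[OF n] sV] by blast
      obtain F where F: "iso F V' E' U D" using orbit[OF ladder_orbit_refl[OF n] y] by blast
      have l: "num_lonely V' E' = num_lonely U D" using F by (rule iso_num_lonely)
      have "2 \<le> n" using n3 by simp
      note kill = ladder_expansion_num_lonely[OF this y s]
      \<comment> \<open>A ladder with at least four rungs has exactly four lonely edges and cannot
        afford the loss of one. With three rungs there are at most five, which permits one loss but
        not two and so places \<open>s\<close> on an outer rung.\<close>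
      have "n = 3"
      proof (rule ccontr)
        assume "n \<noteq> 3"
        then have "num_lonely (LV n) (LE n) = 4" using ladder_num_lonely[OF n] n3 by simp
        then show False using kill(1) l 4 by linarith
      qed
      moreover have "s \<in> {1,2,2 * n - 1,2 * n}"
        using kill(2) l 4 ladder_num_lonely_le(1) \<open>n = 3\<close> by fastforce
      ultimately have "ladder_orbit 3 s 5" using ladder3_orbit[of s] by simp
      then have "\<exists>F. iso F V' E' PV PE" using orbit P_expansion \<open>n = 3\<close> by blast
      then show ?thesis by blast
    qed
  qed
qed

section \<open>Extended prisms\<close>

text \<open>Since \<open>expansion\<close> acts on the whole neighbourhood of a vertex, the
  invariant fixes the full neighbourhoods of the triangle vertices; the bound by \<open>n\<close>
  makes the names \<open>n + j\<close> fresh.\<close>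

definition state_ok :: "pstate \<Rightarrow> bool" where
  "state_ok st = (case st of (V, E, x, w, n) \<Rightarrow> simple_graph V E \<and> V \<subseteq> {..<n} \<and>
     x 1 \<in> V \<and> x 2 \<in> V \<and> x 3 \<in> V \<and> x 1 \<noteq> x 2 \<and> x 1 \<noteq> x 3 \<and> x 2 \<noteq> x 3 \<and>
     (\<forall>s\<in>{1,2,3}. \<forall>j\<in>{1,2,3}. w s \<noteq> x j) \<and>
     nb E (x 1) = {w 1, x 2, x 3} \<and> nb E (x 2) = {w 2, x 1, x 3} \<and> nb E (x 3) = {w 3, x 1, x 2})"

text \<open>\<open>ext_step\<close> names the new triangle by index, \<open>expansion\<close> by the
  neighbour taken over. The translation sends the outer neighbour \<open>w s\<close> to
  \<open>n + s\<close> and each remaining \<open>x j\<close> to \<open>n + j\<close>.\<close>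

definition state_map :: "pstate \<Rightarrow> nat \<Rightarrow> nat \<Rightarrow> nat" where
  "state_map st s u = (case st of (V, E, x, w, n) \<Rightarrow>
     if u = w s then n + s else if u = x 1 then n + 1 else if u = x 2 then n + 2 else n + 3)"

lemma ext_step_expansion:
  assumes ok: "state_ok (V, E, x, w, n)" and s: "s \<in> {1,3}"
    and st: "ext_step s (V, E, x, w, n) = (V', E', x', w', n')"
  shows "expansion V E (x s) (state_map (V, E, x, w, n) s) V' E'"
proof -
  let ?y = "state_map (V, E, x, w, n) s"
  define A where "A = {e\<in>E. x s \<notin> e}"
  note st' = st[unfolded ext_step_def Let_def prod.case prod.inject]
  have V': "V' = (V - {x s}) \<union> {n + 1, n + 2, n + 3}"
    by (rule conjunct1[OF st', symmetric])
  have E': "E' = A \<union> {{n + 1, n + 2}, {n + 1, n + 3}, {n + 2, n + 3}}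
        \<union> {{n + j, x j} | j. j \<in> {1,2,3} \<and> j \<noteq> s} \<union> {{n + s, w s}}"
    unfolding A_def by (rule conjunct1[OF conjunct2[OF st'], symmetric])
  have fresh: "v < n" if "v \<in> V" for v using ok that by (auto simp: state_ok_def)
  have big: "n + 1 \<notin> V" "n + 2 \<notin> V" "n + 3 \<notin> V" using fresh by force+
  have facts: "x 1 \<in> V" "x 2 \<in> V" "x 3 \<in> V" "x 1 \<noteq> x 2" "x 1 \<noteq> x 3" "x 2 \<noteq> x 3"
    "nb E (x 1) = {w 1, x 2, x 3}" "nb E (x 2) = {w 2, x 1, x 3}" "nb E (x 3) = {w 3, x 1, x 2}"
    using ok by (simp_all add: state_ok_def)
  from s consider (1) "s = 1" | (3) "s = 3" by auto
  then show ?thesis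
  proof cases
    case 1
    have ne: "w 1 \<noteq> x 1" "w 1 \<noteq> x 2" "w 1 \<noteq> x 3" using ok by (simp_all add: state_ok_def)
    have y: "?y (w 1) = n + 1" "?y (x 2) = n + 2" "?y (x 3) = n + 3"
      using 1 ne facts(4-6) by (simp_all add: state_map_def)
    have d: "{w 1, x 2, x 3} - {w 1} = {x 2, x 3}" "{w 1, x 2, x 3} - {x 2} = {w 1, x 3}" "{w 1, x 2, x 3} - {x 3} = {w 1, x 2}"
      using ne facts(4-6) by auto
    have j: "{{n + j, x j} | j. j \<in> {1,2,3} \<and> j \<noteq> (1::nat)} = {{n + 2, x 2}, {n + 3, x 3}}" by auto
    show ?thesis
      unfolding expansion_def 1 facts(7) image_insert image_empty y[unfolded 1] d
    proof (intro conjI)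
      show "x 1 \<in> V" by (rule facts)
      show "inj_on (state_map (V, E, x, w, n) 1) {w 1, x 2, x 3}" using y[unfolded 1] by (simp add: inj_on_def)
      show "{n + 1, n + 2, n + 3} \<inter> (V - {x 1}) = {}" using big by blast
      show "V' = V - {x 1} \<union> {n + 1, n + 2, n + 3}" using V' 1 by simp
      show "E' = {e \<in> E. x 1 \<notin> e} \<union> {{n + 1, w 1}, {n + 2, x 2}, {n + 3, x 3}} \<union> {{n + 2, n + 3}, {n + 1, n + 3}, {n + 1, n + 2}}"
        unfolding E' A_def 1 j by (rule set_eqI) (simp only: Un_iff insert_iff empty_iff, argo)
    qed
  next
    case 3
    have ne: "w 3 \<noteq> x 1" "w 3 \<noteq> x 2" "w 3 \<noteq> x 3" using ok by (simp_all add: state_ok_def)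
    have y: "?y (w 3) = n + 3" "?y (x 1) = n + 1" "?y (x 2) = n + 2"
      using 3 ne facts(4-6) by (simp_all add: state_map_def)
    have d: "{w 3, x 1, x 2} - {w 3} = {x 1, x 2}" "{w 3, x 1, x 2} - {x 1} = {w 3, x 2}" "{w 3, x 1, x 2} - {x 2} = {w 3, x 1}"
      using ne facts(4-6) by auto
    have j: "{{n + j, x j} | j. j \<in> {1,2,3} \<and> j \<noteq> (3::nat)} = {{n + 1, x 1}, {n + 2, x 2}}" by auto
    have flip: "{n + 3, n + 1} = {n + 1, n + 3}" "{n + 3, n + 2} = {n + 2, n + 3}" by (rule insert_commute)+
    show ?thesis
      unfolding expansion_def 3 facts(9) image_insert image_empty y[unfolded 3] d
    proof (intro conjI)
      show "x 3 \<in> V" by (rule facts)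
      show "inj_on (state_map (V, E, x, w, n) 3) {w 3, x 1, x 2}" using y[unfolded 3] by (simp add: inj_on_def)
      show "{n + 3, n + 1, n + 2} \<inter> (V - {x 3}) = {}" using big by blast
      show "V' = V - {x 3} \<union> {n + 3, n + 1, n + 2}" using V' 3 by auto
      show "E' = {e \<in> E. x 3 \<notin> e} \<union> {{n + 3, w 3}, {n + 1, x 1}, {n + 2, x 2}} \<union> {{n + 1, n + 2}, {n + 3, n + 2}, {n + 3, n + 1}}"
        unfolding E' A_def 3 j flip by (rule set_eqI) (simp only: Un_iff insert_iff empty_iff, argo)
    qed
  qed
qed

lemma ext_step_ok:
  assumes ok: "state_ok (V, E, x, w, n)"
    and st: "ext_step 3 (V, E, x, w, n) = (V', E', x', w', n')"
  shows "state_ok (V', E', x', w', n')"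
proof -
  have ok': "x 1 \<noteq> x 2" "x 1 \<noteq> x 3" "x 2 \<noteq> x 3" "x 1 \<in> V" "x 2 \<in> V" "x 3 \<in> V" "V \<subseteq> {..<n}" "simple_graph V E"
    and w3: "w 3 \<noteq> x 1" "w 3 \<noteq> x 2" and nb3: "nb E (x 3) = {w 3, x 1, x 2}"
    using ok by (simp_all add: state_ok_def)
  have card_nb: "card (nb E (x 3)) = 3" using nb3 ok' w3 by simp
  interpret expand V E "x 3" "state_map (V, E, x, w, n) 3" V' E'
    using ext_step_expansion[OF ok _ st] ok'(8) card_nb by (simp add: expand_def)
  have x': "x' = (\<lambda>j. n + j)" "w' 1 = x 1" "w' 2 = x 2" "w' 3 = w 3" "n' = n + 4"
    using st by (auto simp: ext_step_def Let_def)
  have m: "state_map (V, E, x, w, n) 3 (w 3) = n + 3" "state_map (V, E, x, w, n) 3 (x 1) = n + 1"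
    "state_map (V, E, x, w, n) 3 (x 2) = n + 2"
    using w3 ok' by (simp_all add: state_map_def)
  have d: "{w 3, x 1, x 2} - {w 3} = {x 1, x 2}" "{w 3, x 1, x 2} - {x 1} = {w 3, x 2}" "{w 3, x 1, x 2} - {x 2} = {w 3, x 1}"
    using w3 ok' by auto
  have nb': "nb E' (n + 1) = {x 1, n + 3, n + 2}" "nb E' (n + 2) = {x 2, n + 3, n + 1}" "nb E' (n + 3) = {w 3, n + 1, n + 2}"
    using nb_new[of "x 1"] nb_new[of "x 2"] nb_new[of "w 3"] unfolding nb3 m d image_insert image_empty by simp_all
  have "w 3 \<in> V" using W_sub unfolding nb3 by simp
  then have lt: "x 1 < n" "x 2 < n" "w 3 < n" using ok' by auto
  have "V' = (V - {x 3}) \<union> {n + 3, n + 1, n + 2}" using V' unfolding nb3 image_insert image_empty m .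
  then have "V' \<subseteq> {..<n + 4}" "n + 1 \<in> V'" "n + 2 \<in> V'" "n + 3 \<in> V'" using ok'(7) by auto
  then show ?thesis using simple' nb' lt x'(2-4) unfolding state_ok_def x'(1,5) by auto
qed

lemma ext_prism_state_Suc: "ext_prism_state (replicate (Suc k) 3) = ext_step 3 (ext_prism_state (replicate k 3))"
  unfolding ext_prism_state_def replicate_append_same[symmetric] replicate_Suc by simp

lemma prism_ok: "state_ok prism_state"
  by (auto simp: state_ok_def prism_state_def simple_graph_def nb_def doubleton_eq_iff)

text \<open>The last two rail vertices and the last apex of the ladder form the triangle \<open>T\<^sub>v\<close>.\<close>

lemma ladder_iso_ext_prism:
  assumes "ext_prism_state (replicate k 3) = (V, E, x, w, n)"
  shows "state_ok (V, E, x, w, n) \<and> (\<exists>f. iso f (LV (k + 2)) (LE (k + 2)) V E \<and>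
    f 0 = w 3 \<and> f (2 * k + 3) = x 1 \<and> f (2 * k + 4) = x 2 \<and> f (2 * k + 5) = x 3)"
  using assms
proof (induction k arbitrary: V E x w n)
  case 0
  then have st: "(V, E, x, w, n) = prism_state" by (simp add: ext_prism_state_def)
  let ?f = "\<lambda>v::nat. if v = 0 then 2 else if v = 1 then 0 else if v = 2 then 1 else v"
  have V: "V = {0,1,2,3,4,5}" and E: "E = {{0,1},{0,2},{1,2}, {3,4},{3,5},{4,5}, {0,3},{1,4},{2,5}}"
    and x: "x = (\<lambda>i. i + 2)" and w: "w = (\<lambda>i. i - 1)"
    using st by (auto simp: prism_state_def)
  have "bij_betw ?f (LV 2) V" unfolding V LV_2 by (auto simp: bij_betw_def inj_on_def)
  moreover have "(\<lambda>e. ?f ` e) ` LE 2 = E" unfolding E LE_2 image_insert image_empty by (simp add: insert_commute)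
  ultimately have "iso ?f (LV 2) (LE 2) V E" using LE_simple[of 2] by (simp add: iso_def)
  moreover have "?f 0 = w 3" "?f 3 = x 1" "?f 4 = x 2" "?f 5 = x 3" by (simp_all add: x w)
  ultimately have "\<exists>f. iso f (LV 2) (LE 2) V E \<and> f 0 = w 3 \<and> f 3 = x 1 \<and> f 4 = x 2 \<and> f 5 = x 3" by blast
  moreover have "0 + 2 = (2::nat)" "2 * 0 + 3 = (3::nat)" "2 * 0 + 4 = (4::nat)" "2 * 0 + 5 = (5::nat)" by simp_all
  ultimately show ?case using prism_ok st by metis
next
  case (Suc k)
  obtain V0 E0 x0 w0 n0 where st0: "ext_prism_state (replicate k 3) = (V0, E0, x0, w0, n0)"
    by (metis prod_cases5)
  have step: "ext_step 3 (V0, E0, x0, w0, n0) = (V, E, x, w, n)"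
    using Suc.prems ext_prism_state_Suc st0 by simp
  obtain f where ok: "state_ok (V0, E0, x0, w0, n0)" and f: "iso f (LV (k + 2)) (LE (k + 2)) V0 E0"
    and fv: "f 0 = w0 3" "f (2 * k + 3) = x0 1" "f (2 * k + 4) = x0 2" "f (2 * k + 5) = x0 3"
    using Suc.IH[OF st0] by blast
  let ?n = "k + 2"
  have n1: "1 \<le> ?n" by simp
  have t: "2 * ?n + 1 = 2 * k + 5" "2 * ?n - 1 = 2 * k + 3" "2 * ?n = 2 * k + 4" by simp_all
  note lex = ladder_expansion[OF n1]
  have ex: "expansion V0 E0 (f (2 * ?n + 1)) (state_map (V0, E0, x0, w0, n0) 3) V E"
    using ext_step_expansion[OF ok _ step] unfolding t(1) fv(4) by simp
  obtain F where F: "iso F (LV (Suc ?n)) (LE (Suc ?n)) V E"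
    "\<And>v. v \<in> LV ?n - {2 * ?n + 1} \<Longrightarrow> F v = f v"
    "\<And>u. u \<in> nb (LE ?n) (2 * ?n + 1) \<Longrightarrow> F (ladder_map ?n u) = state_map (V0, E0, x0, w0, n0) 3 (f u)"
    using iso_expansion[OF f klee_expand[OF ladder_klee[OF n1] lex] ex] by metis
  have nb: "nb (LE ?n) (2 * ?n + 1) = {0, 2 * k + 3, 2 * k + 4}" unfolding nb_LE_last[OF n1] t(2) unfolding t(3) ..
  have ne: "w0 3 \<noteq> x0 1" "w0 3 \<noteq> x0 2" "x0 1 \<noteq> x0 2" using ok by (simp_all add: state_ok_def)
  have new: "x = (\<lambda>j. n0 + j)" "w 3 = w0 3" using step by (auto simp: ext_step_def Let_def)
  have F0: "F (2 * k + 7) = n0 + 3" "F (2 * k + 5) = n0 + 1" "F (2 * k + 6) = n0 + 2"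
    using F(3)[of 0] F(3)[of "2 * k + 3"] F(3)[of "2 * k + 4"] fv ne unfolding nb
    by (simp_all add: ladder_map_def state_map_def add.commute)
  have "F 0 = w0 3" using F(2)[of 0] fv by (simp add: LV_def)
  moreover have "2 * Suc k + 3 = 2 * k + 5" "2 * Suc k + 4 = 2 * k + 6" "2 * Suc k + 5 = 2 * k + 7" by simp_all
  ultimately have "F 0 = w 3" "F (2 * Suc k + 3) = x 1" "F (2 * Suc k + 4) = x 2" "F (2 * Suc k + 5) = x 3"
    using F0 new by (simp_all only:)
  moreover have "iso F (LV (Suc k + 2)) (LE (Suc k + 2)) V E" using F(1) by simp
  ultimately show ?case using ext_step_ok[OF ok step] by blast
qed

lemma ext_prism_3_iso:
  obtains f where "iso f (LV (k + 2)) (LE (k + 2)) (ext_prism_V (replicate k 3)) (ext_prism_E (replicate k 3))"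
proof -
  obtain V E x w n where st: "ext_prism_state (replicate k 3) = (V, E, x, w, n)" by (metis prod_cases5)
  then show ?thesis using ladder_iso_ext_prism[OF st] that by (auto simp: ext_prism_V_def ext_prism_E_def)
qed

lemma ext_prism_31_iso:
  obtains f where "iso f PV PE (ext_prism_V [3,1]) (ext_prism_E [3,1])"
proof -
  obtain V E x w n where st: "ext_prism_state (replicate 1 3) = (V, E, x, w, n)" by (metis prod_cases5)
  \<comment> \<open>After one extension \<open>2 * k + 3\<close> is \<open>5\<close>, so the vertex
    \<open>x 1\<close> expanded next is the image of the vertex expanded in
    \<open>P_expansion\<close>.\<close>
  obtain f where ok: "state_ok (V, E, x, w, n)" and f: "iso f (LV 3) (LE 3) V E" and f5: "f 5 = x 1"
    using ladder_iso_ext_prism[OF st] by (auto simp: numeral_3_eq_3 eval_nat_numeral)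
  obtain V' E' x' w' n' where st': "ext_step 1 (V, E, x, w, n) = (V', E', x', w', n')" by (metis prod_cases5)
  have "ext_prism_state [3,1] = (V', E', x', w', n')" using st st' by (simp add: ext_prism_state_def)
  then have VE: "ext_prism_V [3,1] = V'" "ext_prism_E [3,1] = E'" by (simp_all add: ext_prism_V_def ext_prism_E_def)
  have "expansion V E (f 5) (state_map (V, E, x, w, n) 1) V' E'"
    using ext_step_expansion[OF ok _ st'] f5 by simp
  then have "\<exists>F. iso F PV PE V' E'"
    using iso_expansion_graph[OF ladder_klee f P_expansion] by simp
  then show ?thesis using that VE by blast
qed

text \<open>What is carried along \<open>f\<close> is not \<open>klee\<close> but its consequences:
  cubicity, 3-edge-connectivity, the number of vertices and that of lonely edges.\<close>

lemma in_U_k_iso: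
  assumes K: "klee V' E'" and l: "num_lonely V' E' = 4" and f: "iso f V' E' V E"
  shows "in_U_k 4 V E"
proof -
  note p = klee_props(1-3)[OF K]
  have "card V = card V'" using f bij_betw_same_card by (metis iso_def)
  then have "three_connected V E"
    using three_edge_connected_imp_three_connected[OF iso_cubic[OF f p(1)] iso_three_edge_connected[OF f p(2)]] p(3) by simp
  then show ?thesis using iso_cubic[OF f p(1)] iso_num_lonely[OF f] l by (simp add: in_U_k_def in_U_def)
qed

lemma graph_iso_in_U_k:
  assumes K: "klee V' E'" "num_lonely V' E' = 4" and g: "iso g V' E' V'' E''" and h: "graph_iso V E V'' E''"
  shows "in_U_k 4 V E"
proof -
  obtain f where f: "iso f V E V'' E''" by (rule graph_iso_imp_iso[OF h iso_simple[OF g]])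
  show ?thesis by (rule in_U_k_iso[OF K iso_comp[OF g iso_inv[OF f]]])
qed

theorem mainTheorem11:
  fixes V :: "'a set" and E :: "'a set set"
  shows "in_U_k 4 V E \<longleftrightarrow>
    (graph_iso V E (ext_prism_V [3, 1]) (ext_prism_E [3, 1]) \<or>
     (\<exists>k\<ge>2. graph_iso V E (ext_prism_V (replicate k 3)) (ext_prism_E (replicate k 3))))"
proof
  assume U: "in_U_k 4 V E"
  then have K: "klee V E" and l: "num_lonely V E = 4" by (auto simp: in_U_k_def intro: in_U_imp_klee)
  then consider n f where "1 \<le> n" "iso f V E (LV n) (LE n)" | f where "iso f V E PV PE"
    using klee_classification[OF K] by auto
  then show "graph_iso V E (ext_prism_V [3, 1]) (ext_prism_E [3, 1]) \<or>
     (\<exists>k\<ge>2. graph_iso V E (ext_prism_V (replicate k 3)) (ext_prism_E (replicate k 3)))"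
  proof cases
    case 1
    then have "4 \<le> n" using ladder_num_lonely[OF 1(1)] iso_num_lonely[OF 1(2)] l by simp
    \<comment> \<open>The prism is the ladder with two rungs, so \<open>n\<close> rungs correspond
      to \<open>n - 2\<close> extensions and \<open>4 \<le> n\<close> becomes
      \<open>2 \<le> k\<close>.\<close>
    then obtain k where k: "n = k + 2" "2 \<le> k" using le_Suc_ex[of 4 n] by (metis add.commute add_2_eq_Suc add_le_cancel_left le_add1 le_Suc_ex numeral_Bit0 add.left_commute)
    obtain g where "iso g (LV (k + 2)) (LE (k + 2)) (ext_prism_V (replicate k 3)) (ext_prism_E (replicate k 3))"
      by (rule ext_prism_3_iso)
    then show ?thesis using iso_imp_graph_iso[OF iso_comp] 1(2) k by blast
  next
    case 2
    obtain g where "iso g PV PE (ext_prism_V [3,1]) (ext_prism_E [3,1])" by (rule ext_prism_31_iso)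
    then show ?thesis using iso_imp_graph_iso[OF iso_comp[OF 2]] by blast
  qed
next
  assume "graph_iso V E (ext_prism_V [3, 1]) (ext_prism_E [3, 1]) \<or>
     (\<exists>k\<ge>2. graph_iso V E (ext_prism_V (replicate k 3)) (ext_prism_E (replicate k 3)))"
  then show "in_U_k 4 V E"
  proof (elim disjE exE conjE)
    assume h: "graph_iso V E (ext_prism_V [3, 1]) (ext_prism_E [3, 1])"
    obtain g where "iso g PV PE (ext_prism_V [3,1]) (ext_prism_E [3,1])" by (rule ext_prism_31_iso)
    then show ?thesis using graph_iso_in_U_k[OF P_klee P_num_lonely _ h] by blast
  next
    fix k :: nat assume k: "2 \<le> k" and h: "graph_iso V E (ext_prism_V (replicate k 3)) (ext_prism_E (replicate k 3))"
    obtain g where g: "iso g (LV (k + 2)) (LE (k + 2)) (ext_prism_V (replicate k 3)) (ext_prism_E (replicate k 3))"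
      by (rule ext_prism_3_iso)
    have "klee (LV (k + 2)) (LE (k + 2))" "num_lonely (LV (k + 2)) (LE (k + 2)) = 4"
      using ladder_klee[of "k + 2"] ladder_num_lonely[of "k + 2"] k by simp_all
    then show ?thesis using graph_iso_in_U_k[OF _ _ g h] by blast
  qed
qed

end
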